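(* Let $g$ be a $q$-wavelet associated with the $q$-Bessel operator in $\mathcal{S}_{*q,\alpha}(\mathbb{R}_q)$. Then: 1) for every $f\in\mathcal{S}_{*q,\alpha}(\mathbb{R}_q)$, $$\Psi_{q,g}^\alpha(f)(a,b)=R_{\alpha,q}\left[\Phi_{q,W_{\alpha,q}(g)}\left(R_{\alpha,q}^{-1}(f)\right)(a,\cdot)\right](b),\qquad a\in\mathbb{R}_{q,+},\ b\in\widetilde{\mathbb{R}}_{q,+};$$ 2) for every $f\in\mathcal{S}_{*q,-1/2}(\mathbb{R}_q)$, $$\Phi_{q,W_{\alpha,q}(g)}(f)(a,b)=W_{\alpha,q}\left[\Psi_{q,g}^\alpha\left(W_{\alpha,q}^{-1}(f)\right)(a,\cdot)\right](b),\qquad a\in\mathbb{R}_{q,+},\ b\in\widetilde{\mathbb{R}}_{q,+}.$$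
   Context: Fix $q\in\,]0,1[$ with $\frac{\log(1-q)}{\log q}\in\mathbb{Z}$ and $\alpha>-\frac12$. Functions are complex valued. $(a;q)_0=1$, $(a;q)_n=\prod_{k=0}^{n-1}(1-aq^k)$, $(a;q)_\infty=\prod_{k\ge0}(1-aq^k)$; $\Gamma_q(x)=\frac{(q;q)_\infty}{(q^x;q)_\infty}(1-q)^{1-x}$, and $\Gamma_{q^2}$ is the same with $q$ replaced by $q^2$. $\mathbb{R}_{q,+}=\{q^n:n\in\mathbb{Z}\}$, $\widetilde{\mathbb{R}}_{q,+}=\mathbb{R}_{q,+}\cup\{0\}$, $\mathbb{R}_q=\{\pm q^n:n\in\mathbb{Z}\}\cup\{0\}$. Jackson integrals: $\int_0^af(x)d_qx=(1-q)a\sum_{n\ge0}f(aq^n)q^n$, $\int_0^\infty f(x)d_qx=(1-q)\sum_{n\in\mathbb{Z}}f(q^n)q^n$, $\int_a^\infty=\int_0^\infty-\int_0^a$. $q$-derivative: $D_qf(x)=\frac{f(x)-f(qx)}{(1-q)x}$ for $x\ne0$, $D_qf(0)=f'(0)$. $\mathcal{S}_{*q}(\mathbb{R}_q)$: the restrictions to $\mathbb{R}_q$ of even, infinitely $q$-differentiable functions $f$ on $\mathbb{R}$ with $P_{n,m,q}(f)=\sup_{x\in\mathbb{R},\,0\le k\le n}|(1+x^2)^mD_q^kf(x)|<\infty$ for all $n,m\in\mathbb{N}$, with the induced topology of these semi-norms. For $\beta\in\{\alpha,-\frac12\}$, $\mathcal{S}_{*q,\beta}(\mathbb{R}_q)=\{f\in\mathcal{S}_{*q}(\mathbb{R}_q):\int_0^\infty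 f(x)x^{2k+2\beta+1}d_qx=0,\ k=0,1,\dots\}$. For $\beta\in\{\alpha,-\frac12\}$: $j_\beta^{(3)}(z;q^2)=\sum_{n\ge0}\frac{(-1)^nq^{n(n-1)}(1-q)^{2n}z^{2n}}{(q^2;q^2)_n(q^{2\beta+2};q^2)_n}$, $c_{\beta,q}=\frac{(1+q^{-1})^{-\beta}}{\Gamma_{q^2}(\beta+1)}$, $\mathcal{F}_{\beta,q}(f)(\lambda)=c_{\beta,q}\int_0^\infty f(x)j_\beta^{(3)}(\lambda x;q^2)x^{2\beta+1}d_qx$, with $\mathcal{F}_{\beta,q}^{-1}=q^{-4\beta-2}\mathcal{F}_{\beta,q}$. $\mathcal{F}_{\alpha,q}$ is the $q$-Bessel Fourier transform and $\mathcal{F}_q=\mathcal{F}_{-1/2,q}$ the $q$-Fourier-cosine transform. For $x\in\widetilde{\mathbb{R}}_{q,+}$ the translation $T^\beta_{q,x}$ is given by $\mathcal{F}_{\beta,q}(T^\beta_{q,x}f)(\lambda)=j_\beta^{(3)}(\lambda x;q^2)\mathcal{F}_{\beta,q}(f)(\lambda)$; $T_{q,x}=T^{-1/2}_{q,x}$. $q$-Riemann-Liouville transform: $R_{\alpha,q}(f)(x)=\frac{(1+q)\Gamma_{q^2}(\alpha+1)}{\Gamma_{q^2}(1/2)\Gamma_{q^2}(\alpha+1/2)}\int_0^1\frac{(t^2q^2;q^2)_\infty}{(t^2q^{2\alpha+1};q^2)_\infty}f(xt)\,d_qt$; it is an isomorphism of $\mathcal{S}_{*q,-1/2}(\mathbb{R}_q)$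 onto $\mathcal{S}_{*q,\alpha}(\mathbb{R}_q)$. $q$-Weyl transform: $W_{\alpha,q}(f)(x)=\frac{q(1+q^{-1})^{-\alpha+1/2}}{\Gamma_{q^2}(\alpha+1/2)}\int_{qx}^\infty\frac{(q^2x^2/t^2;q^2)_\infty}{(q^{2\alpha+1}x^2/t^2;q^2)_\infty}f(t)t^{2\alpha}d_qt$ for $x\in\widetilde{\mathbb{R}}_{q,+}$, extended evenly; $\mathcal{F}_{\alpha,q}=\mathcal{F}_q\circ W_{\alpha,q}$ on $\mathcal{S}_{*q}(\mathbb{R}_q)$, and $W_{\alpha,q}$ is an isomorphism of $\mathcal{S}_{*q,\alpha}(\mathbb{R}_q)$ onto $\mathcal{S}_{*q,-1/2}(\mathbb{R}_q)$. A $q$-wavelet associated with the $q$-Bessel operator is an even $g$, square integrable on $\mathbb{R}_{q,+}$ for $x^{2\alpha+1}d_qx$, with $0<C_g=\int_0^\infty|\mathcal{F}_{\alpha,q}(g)(a)|^2\frac{d_qa}{a}<\infty$. For $a\in\mathbb{R}_{q,+}$, $b\in\widetilde{\mathbb{R}}_{q,+}$: $g_a(x)=a^{-2\alpha-2}g(x/a)$, $g_{a,b}=\sqrt a\,T_{q,b}^\alpha(g_a)$, $\Psi^{\alpha}_{q,g}(f)(a,b)=c_{\alpha,q}\int_0^\infty f(x)\overline{g_{a,b}(x)}\,x^{2\alpha+1}d_qx$. A $q$-wavelet is an even $h$, square integrable on $\mathbb{R}_{q,+}$ for $d_qx$, with $0<C_h^c=\int_0^\infty|\mathcal{F}_q(h)(a)|^2\frac{d_qa}{a}<\infty$.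 With $H_a(h)(x)=\frac1{\sqrt a}h(x/a)$ and $h^c_{a,b}=T_{q,b}(H_a(h))$, the continuous $q$-wavelet transform is $\Phi_{q,h}(f)(a,b)=c_{-1/2,q}\int_0^\infty f(x)\overline{h^c_{a,b}(x)}\,d_qx$, $a\in\mathbb{R}_{q,+}$, $b\in\widetilde{\mathbb{R}}_{q,+}$. *)

theory Defs
  imports "HOL-Analysis.Analysis"
begin

definition qpoch :: "real \<Rightarrow> real \<Rightarrow> nat \<Rightarrow> real" where
  "qpoch a q n = (\<Prod>k<n. 1 - a * q ^ k)"

definition qpoch_inf :: "real \<Rightarrow> real \<Rightarrow> real" where
  "qpoch_inf a q = (\<Prod>k. 1 - a * q ^ k)"

definition qGamma :: "real \<Rightarrow> real \<Rightarrow> real" where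
  "qGamma q x = qpoch_inf q q / qpoch_inf (q powr x) q * (1 - q) powr (1 - x)"

definition Rq_pos :: "real \<Rightarrow> real set" where
  "Rq_pos q = range (\<lambda>n::int. q powi n)"

definition Rq_pos0 :: "real \<Rightarrow> real set" where
  "Rq_pos0 q = Rq_pos q \<union> {0}"

definition Rq :: "real \<Rightarrow> real set" where
  "Rq q = Rq_pos q \<union> uminus ` Rq_pos q \<union> {0}"

(* The bilateral series of the Jackson integral over ]0,\<infinity>[ is read as an unconditional sum,
   which for complex-valued integrands is the same as absolute convergence. *)

definition jackson_integrable :: "real \<Rightarrow> (real \<Rightarrow> 'a::real_normed_vector) \<Rightarrow> bool" where
  "jackson_integrable q f \<longleftrightarrow> (\<lambda>n::int. q powi n *\<^sub>R f (q powi n)) summable_on UNIV"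

definition jackson_0_infty :: "real \<Rightarrow> (real \<Rightarrow> 'a::real_normed_vector) \<Rightarrow> 'a" where
  "jackson_0_infty q f = (1 - q) *\<^sub>R (\<Sum>\<^sub>\<infinity>n::int. q powi n *\<^sub>R f (q powi n))"

definition jackson_0_to :: "real \<Rightarrow> real \<Rightarrow> (real \<Rightarrow> 'a::real_normed_vector) \<Rightarrow> 'a" where
  "jackson_0_to q a f = ((1 - q) * a) *\<^sub>R (\<Sum>n::nat. q ^ n *\<^sub>R f (a * q ^ n))"

definition jackson_from :: "real \<Rightarrow> real \<Rightarrow> (real \<Rightarrow> 'a::real_normed_vector) \<Rightarrow> 'a" where
  "jackson_from q a f = jackson_0_infty q f - jackson_0_to q a f"

definition qderiv :: "real \<Rightarrow> (real \<Rightarrow> complex) \<Rightarrow> real \<Rightarrow> complex" where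
  "qderiv q f x =
     (if x = 0 then vector_derivative f (at 0)
      else (f x - f (q * x)) /\<^sub>R ((1 - q) * x))"

(* Away from 0 the q-derivatives always exist, so infinite q-differentiability only demands
   that each iterate be differentiable at 0. *)
definition inf_q_differentiable :: "real \<Rightarrow> (real \<Rightarrow> complex) \<Rightarrow> bool" where
  "inf_q_differentiable q f \<longleftrightarrow> (\<forall>k. (qderiv q ^^ k) f differentiable (at 0))"

(* Functions on Rq are represented as extensional functions, i.e. undefined outside Rq, so that
   equality in the space is equality on Rq. *)
definition S_q :: "real \<Rightarrow> (real \<Rightarrow> complex) set" where
  "S_q q =
     {restrict f (Rq q) | f.
        (\<forall>x. f (- x) = f x) \<and> inf_q_differentiable q f \<and>
        (\<forall>n m::nat. bdd_above
           ((\<lambda>(x, k). cmod ((1 + x\<^sup>2) ^ m *\<^sub>R (qderiv q ^^ k) f x)) ` (UNIV \<times> {..n})))}"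

(* For f in S_q and \<beta> \<ge> -1/2 the moment integrals below always converge absolutely, so their
   vanishing is never an artefact of the default value of a divergent sum. *)
definition S_q_mom :: "real \<Rightarrow> real \<Rightarrow> (real \<Rightarrow> complex) set" where
  "S_q_mom q \<beta> =
     {f \<in> S_q q. \<forall>k::nat. jackson_0_infty q (\<lambda>x. x powr (2 * real k + 2 * \<beta> + 1) *\<^sub>R f x) = 0}"

definition j3 :: "real \<Rightarrow> real \<Rightarrow> real \<Rightarrow> real" where
  "j3 q \<beta> z =
     (\<Sum>n::nat. (- 1) ^ n * q ^ (n * (n - 1)) * (1 - q) ^ (2 * n) * z ^ (2 * n)
                / (qpoch (q\<^sup>2) (q\<^sup>2) n * qpoch (q powr (2 * \<beta> + 2)) (q\<^sup>2) n))"

definition c_q :: "real \<Rightarrow> real \<Rightarrow> real" where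
  "c_q q \<beta> = (1 + 1 / q) powr (- \<beta>) / qGamma (q\<^sup>2) (\<beta> + 1)"

definition F_q :: "real \<Rightarrow> real \<Rightarrow> (real \<Rightarrow> complex) \<Rightarrow> real \<Rightarrow> complex" where
  "F_q q \<beta> f l =
     c_q q \<beta> *\<^sub>R jackson_0_infty q (\<lambda>x. (j3 q \<beta> (l * x) * x powr (2 * \<beta> + 1)) *\<^sub>R f x)"

definition F_q_inv :: "real \<Rightarrow> real \<Rightarrow> (real \<Rightarrow> complex) \<Rightarrow> real \<Rightarrow> complex" where
  "F_q_inv q \<beta> f x = q powr (- 4 * \<beta> - 2) *\<^sub>R F_q q \<beta> f x"

(* The translation is the operator with F (T f) l = j3 (l * x) * F f l, solved for T f by
   applying the inverse transform. *)
definition T_q :: "real \<Rightarrow> real \<Rightarrow> real \<Rightarrow> (real \<Rightarrow> complex) \<Rightarrow> real \<Rightarrow> complex" where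
  "T_q q \<beta> x f = F_q_inv q \<beta> (\<lambda>l. j3 q \<beta> (l * x) *\<^sub>R F_q q \<beta> f l)"

definition q_RL :: "real \<Rightarrow> real \<Rightarrow> (real \<Rightarrow> complex) \<Rightarrow> real \<Rightarrow> complex" where
  "q_RL q \<alpha> f = (\<lambda>x\<in>Rq q.
     ((1 + q) * qGamma (q\<^sup>2) (\<alpha> + 1) / (qGamma (q\<^sup>2) (1 / 2) * qGamma (q\<^sup>2) (\<alpha> + 1 / 2))) *\<^sub>R
     jackson_0_to q 1 (\<lambda>t.
       (qpoch_inf (t\<^sup>2 * q\<^sup>2) (q\<^sup>2) / qpoch_inf (t\<^sup>2 * q powr (2 * \<alpha> + 1)) (q\<^sup>2)) *\<^sub>R f (x * t)))"

(* The absolute value implements the even extension from the nonnegative part of Rq.  The terms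
   with t < \<bar>x\<bar> do not contribute to the integral. *)
definition q_Weyl :: "real \<Rightarrow> real \<Rightarrow> (real \<Rightarrow> complex) \<Rightarrow> real \<Rightarrow> complex" where
  "q_Weyl q \<alpha> f = (\<lambda>x\<in>Rq q.
     (q * (1 + 1 / q) powr (- \<alpha> + 1 / 2) / qGamma (q\<^sup>2) (\<alpha> + 1 / 2)) *\<^sub>R
     jackson_from q (q * \<bar>x\<bar>) (\<lambda>t.
       (qpoch_inf (q\<^sup>2 * x\<^sup>2 / t\<^sup>2) (q\<^sup>2) / qpoch_inf (q powr (2 * \<alpha> + 1) * x\<^sup>2 / t\<^sup>2) (q\<^sup>2)
         * t powr (2 * \<alpha>)) *\<^sub>R f t))"

definition q_RL_inv :: "real \<Rightarrow> real \<Rightarrow> (real \<Rightarrow> complex) \<Rightarrow> real \<Rightarrow> complex" where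
  "q_RL_inv q \<alpha> = inv_into (S_q_mom q (- 1 / 2)) (q_RL q \<alpha>)"

definition q_Weyl_inv :: "real \<Rightarrow> real \<Rightarrow> (real \<Rightarrow> complex) \<Rightarrow> real \<Rightarrow> complex" where
  "q_Weyl_inv q \<alpha> = inv_into (S_q_mom q \<alpha>) (q_Weyl q \<alpha>)"

definition bessel_q_wavelet :: "real \<Rightarrow> real \<Rightarrow> (real \<Rightarrow> complex) \<Rightarrow> bool" where
  "bessel_q_wavelet q \<alpha> g \<longleftrightarrow>
     (\<forall>x\<in>Rq q. g (- x) = g x) \<and>
     jackson_integrable q (\<lambda>x. (cmod (g x))\<^sup>2 * x powr (2 * \<alpha> + 1)) \<and>
     jackson_integrable q (\<lambda>a. (cmod (F_q q \<alpha> g a))\<^sup>2 / a) \<and>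
     0 < jackson_0_infty q (\<lambda>a. (cmod (F_q q \<alpha> g a))\<^sup>2 / a)"

definition bessel_atom :: "real \<Rightarrow> real \<Rightarrow> (real \<Rightarrow> complex) \<Rightarrow> real \<Rightarrow> real \<Rightarrow> real \<Rightarrow> complex" where
  "bessel_atom q \<alpha> g a b x =
     sqrt a *\<^sub>R T_q q \<alpha> b (\<lambda>y. a powr (- 2 * \<alpha> - 2) *\<^sub>R g (y / a)) x"

definition bessel_wavelet_transform ::
    "real \<Rightarrow> real \<Rightarrow> (real \<Rightarrow> complex) \<Rightarrow> (real \<Rightarrow> complex) \<Rightarrow> real \<Rightarrow> real \<Rightarrow> complex" where
  "bessel_wavelet_transform q \<alpha> g f a b =
     c_q q \<alpha> *\<^sub>R
     jackson_0_infty q (\<lambda>x. x powr (2 * \<alpha> + 1) *\<^sub>R (f x * cnj (bessel_atom q \<alpha> g a b x)))"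

definition q_atom :: "real \<Rightarrow> (real \<Rightarrow> complex) \<Rightarrow> real \<Rightarrow> real \<Rightarrow> real \<Rightarrow> complex" where
  "q_atom q h a b = T_q q (- 1 / 2) b (\<lambda>y. (1 / sqrt a) *\<^sub>R h (y / a))"

definition q_wavelet_transform ::
    "real \<Rightarrow> (real \<Rightarrow> complex) \<Rightarrow> (real \<Rightarrow> complex) \<Rightarrow> real \<Rightarrow> real \<Rightarrow> complex" where
  "q_wavelet_transform q h f a b =
     c_q q (- 1 / 2) *\<^sub>R jackson_0_infty q (\<lambda>x. f x * cnj (q_atom q h a b x))"

end

theory Submission
  imports Defs
begin

text \<open>On the spectral side the theorem is a statement about kernels.  Put \<open>p = q\<^sup>2\<close> and use
  \<open>x = q powi N\<close> as lattice points.  Selfadjointness of the Hankel transform turns the wavelet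
  transform of order \<open>\<beta>\<close> at the scale \<open>q powi A\<close> into one Hankel transform in the position \<open>b\<close>
  (theorem \<open>bessel_wavelet_transform_qH\<close>): up to a constant it is the sum over \<open>L\<close> of
  \<open>j3 q \<beta> (q powi L * b)\<close> against the density \<open>cnj (F g (q powi (A + L))) * F f (q powi L)\<close>, where
  \<open>F = F_q q \<beta>\<close>; the \<open>q\<close>-wavelet transform is the case \<open>\<beta> = - 1 / 2\<close>.  The operators \<open>q_RL\<close> and
  \<open>q_Weyl\<close>, applied in \<open>b\<close>, only see the kernel, and two \<open>q\<close>-analogues of Sonine's integrals
  (\<open>qJ_sonine_contract\<close>, \<open>qJ_sonine_dilate\<close>) say that \<open>q_RL\<close> carries the cosine kernel to the Bessel
  kernel of order \<open>\<alpha>\<close> while \<open>q_Weyl\<close> carries the latter back, up to a power of \<open>q powi L\<close>.  By the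
  adjoint forms of the same formulas (\<open>F_q_Weyl\<close>, \<open>F_q_RL\<close>) the densities on both sides agree up to
  that power, and the constants match (\<open>const_cancel\<close>).\<close>

text \<open>The inverse transforms are meaningful only on the ranges of \<open>q_RL\<close> and \<open>q_Weyl\<close>, so these operators
  must be shown to be surjective between the spaces of functions with vanishing moments.  A
  preimage is prescribed through its spectral density: transform the given function, multiply by a
  power of \<open>q powi L\<close>, and transform back.  This requires the inversion formula of the Hankel
  transform, which follows from the orthogonality of the kernel on the lattice (\<open>qJ_orthogonal\<close>),
  its stability on rapidly decreasing sequences (\<open>schwartz_seq_qH\<close>), and the equivalence of
  vanishing moments with flatness of the transform at \<open>0\<close>, thanks to which the non-smooth power
  does no harm.\<close>

text \<open>It remains to compare rapidly decreasing sequences with the function space of the theorem, whose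
  members are restrictions of functions on the whole line.  One direction is a \<open>q\<close>-Taylor expansion
  at \<open>0\<close>.  For the other an asymptotic expansion along the lattice has to be extended to the line,
  which is done by Borel summation (\<open>S_q_extension\<close>).\<close>

section \<open>Infinite products and the \<open>q\<close>-exponential series\<close>

locale q_base =
  fixes p :: real
  assumes p_pos: "0 < p" and p_less_1: "p < 1"
begin

lemma p_nz [simp]: "p \<noteq> 0" and p_nonneg [simp]: "0 \<le> p" and p_le_1 [simp]: "p \<le> 1"
  using p_pos p_less_1 by auto

lemma pow_pos [simp]: "0 < p ^ n" and powi_pos [simp]: "0 < p powi i"
  using p_pos by auto

lemma p_pow_less_1: "0 < n \<Longrightarrow> p ^ n < 1"
  using p_pos p_less_1 by (simp add: power_less_one_iff)

end

lemma qpoch_0 [simp]: "qpoch a p 0 = 1"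
  by (simp add: qpoch_def)

lemma qpoch_Suc: "qpoch a p (Suc n) = qpoch a p n * (1 - a * p ^ n)"
  by (simp add: qpoch_def)

lemma qpoch_add: "qpoch a p (m + n) = qpoch a p m * qpoch (a * p ^ m) p n"
  by (induction n) (simp_all add: qpoch_Suc power_add mult_ac)

context q_base
begin

lemma convergent_prod_qpoch: "convergent_prod (\<lambda>k. 1 - a * p ^ k)"
proof -
  have "summable (\<lambda>k. norm (1 - a * p ^ k - 1))"
    using p_pos p_less_1 by (simp add: abs_mult summable_mult summable_geometric)
  then show ?thesis
    by (intro abs_convergent_prod_imp_convergent_prod summable_imp_abs_convergent_prod)
qed

lemma qpoch_tendsto: "qpoch a p \<longlonglongrightarrow> qpoch_inf a p"
proof -
  have "(\<lambda>n. \<Prod>k\<le>n. 1 - a * p ^ k) \<longlonglongrightarrow> qpoch_inf a p"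
    unfolding qpoch_inf_def by (rule convergent_prod_LIMSEQ[OF convergent_prod_qpoch])
  then have "(\<lambda>n. qpoch a p (Suc n)) \<longlonglongrightarrow> qpoch_inf a p"
    by (simp add: qpoch_def lessThan_Suc_atMost)
  then show ?thesis by (rule LIMSEQ_imp_Suc)
qed

lemma qpoch_inf_split: "qpoch_inf a p = qpoch a p n * qpoch_inf (a * p ^ n) p"
proof -
  have "(\<lambda>m. qpoch a p (n + m)) \<longlonglongrightarrow> qpoch a p n * qpoch_inf (a * p ^ n) p"
    unfolding qpoch_add by (intro tendsto_intros qpoch_tendsto)
  moreover have "(\<lambda>m. qpoch a p (n + m)) \<longlonglongrightarrow> qpoch_inf a p"
    using LIMSEQ_ignore_initial_segment[OF qpoch_tendsto, of a n] by (simp add: add.commute)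
  ultimately show ?thesis using LIMSEQ_unique by blast
qed

lemma qpoch_inf_step: "qpoch_inf a p = (1 - a) * qpoch_inf (a * p) p"
  using qpoch_inf_split[of a 1] by (simp add: qpoch_def)

lemma qpoch_inf_eq_0:
  assumes "a * p ^ n = 1"
  shows "qpoch_inf a p = 0"
  using qpoch_inf_split[of a "Suc n"] assms by (simp add: qpoch_Suc)

lemma qpoch_inf_0 [simp]: "qpoch_inf 0 p = 1"
  by (simp add: qpoch_inf_def)

lemma mult_pow_le_1: "\<lbrakk>0 \<le> a; a \<le> 1\<rbrakk> \<Longrightarrow> a * p ^ k \<le> 1"
  by (intro mult_le_one) (simp_all add: power_le_one)

lemma mult_pow_less_1: "\<lbrakk>0 \<le> a; a < 1\<rbrakk> \<Longrightarrow> a * p ^ k < 1"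
  using mult_left_le[of "p ^ k" a] by (simp add: power_le_one)

lemma qpoch_bounds: "\<lbrakk>0 \<le> a; a \<le> 1\<rbrakk> \<Longrightarrow> 0 \<le> qpoch a p n \<and> qpoch a p n \<le> 1"
  unfolding qpoch_def by (intro conjI prod_nonneg prod_le_1 ballI) (simp_all add: mult_pow_le_1)

lemma qpoch_pos: "\<lbrakk>0 \<le> a; a < 1\<rbrakk> \<Longrightarrow> 0 < qpoch a p n"
  unfolding qpoch_def by (intro prod_pos ballI) (simp add: mult_pow_less_1)

lemma qpoch_inf_bounds: "\<lbrakk>0 \<le> a; a \<le> 1\<rbrakk> \<Longrightarrow> 0 \<le> qpoch_inf a p \<and> qpoch_inf a p \<le> 1"
  by (intro conjI LIMSEQ_le_const[OF qpoch_tendsto] LIMSEQ_le_const2[OF qpoch_tendsto])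
     (auto simp: qpoch_bounds)

lemma qpoch_inf_pos: "\<lbrakk>0 \<le> a; a < 1\<rbrakk> \<Longrightarrow> 0 < qpoch_inf a p"
  unfolding qpoch_inf_def
  by (rule less_0_prodinf[OF convergent_prod_qpoch]) (simp add: mult_pow_less_1)

lemma qpoch_inf_le_qpoch: "\<lbrakk>0 \<le> a; a \<le> 1\<rbrakk> \<Longrightarrow> qpoch_inf a p \<le> qpoch a p n"
  by (subst qpoch_inf_split[of a n], intro mult_left_le)
     (use qpoch_bounds[of a n] qpoch_inf_bounds[of "a * p ^ n"] mult_le_one[of a "p ^ n"]
      in \<open>auto simp: power_le_one\<close>)

text \<open>This truncation of bilateral sequences makes the series over the lattice converge.\<close>

lemma qpoch_inf_powi_nonpos: "m \<le> 0 \<Longrightarrow> qpoch_inf (p powi m) p = 0"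
  by (rule qpoch_inf_eq_0[of _ "nat (- m)"])
     (simp add: power_int_def field_simps)

lemma qpoch_inf_powi_Suc: "qpoch_inf (p powi (int m + 1)) p = qpoch_inf p p / qpoch p p m"
proof -
  have "p powi (int m + 1) = p * p ^ m"
    by (simp add: power_int_add)
  then show ?thesis
    by (subst qpoch_inf_split[of p m]) (use qpoch_pos[of p m] p_pos p_less_1 in auto)
qed

lemma qpoch_inf_powi_bounds: "0 \<le> qpoch_inf (p powi m) p \<and> qpoch_inf (p powi m) p \<le> 1"
proof (cases "m \<le> 0")
  case False
  then show ?thesis
    by (intro qpoch_inf_bounds) (auto intro: power_int_le_one)
qed (simp add: qpoch_inf_powi_nonpos)

end

text \<open>Coefficients of Euler's expansion of the infinite product \<open>qpoch_inf\<close>.\<close>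

definition qexp_coeff :: "real \<Rightarrow> nat \<Rightarrow> real" where
  "qexp_coeff p n = (- 1) ^ n * p ^ (n * (n - 1) div 2) / qpoch p p n"

text \<open>Coefficients of the \<open>q\<close>-binomial series.\<close>

definition qbinom_coeff :: "real \<Rightarrow> real \<Rightarrow> nat \<Rightarrow> real" where
  "qbinom_coeff p a n = qpoch a p n / qpoch p p n"

lemma qexp_coeff_0 [simp]: "qexp_coeff p 0 = 1"
  by (simp add: qexp_coeff_def)

lemma qbinom_coeff_0 [simp]: "qbinom_coeff p a 0 = 1"
  by (simp add: qbinom_coeff_def)

context q_base
begin

lemma qpoch_p_pos [simp]: "0 < qpoch p p n"
  using qpoch_pos p_pos p_less_1 by simp

lemma qpoch_p_nz [simp]: "qpoch p p n \<noteq> 0"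
  using qpoch_p_pos[of n] by linarith

lemma p_mult_pow [simp]: "p * p ^ n < 1" "p * p ^ n \<noteq> 1"
  using p_pow_less_1[of "Suc n"] by simp_all

lemma qexp_coeff_Suc: "qexp_coeff p (Suc n) * (1 - p ^ Suc n) = - (p ^ n) * qexp_coeff p n"
proof -
  have "Suc n * n div 2 = n + n * (n - 1) div 2"
    by (cases n) (simp_all add: algebra_simps)
  then show ?thesis
    by (simp add: qexp_coeff_def qpoch_Suc power_add divide_simps)
qed

lemma qexp_coeff_nz [simp]: "qexp_coeff p n \<noteq> 0"
  using p_pos by (simp add: qexp_coeff_def)

lemma qbinom_coeff_Suc:
  "qbinom_coeff p a (Suc n) * (1 - p ^ Suc n) = (1 - a * p ^ n) * qbinom_coeff p a n"
  by (simp add: qbinom_coeff_def qpoch_Suc divide_simps)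

lemma qbinom_coeff_bounds:
  assumes "0 \<le> a" "a \<le> 1"
  shows "0 \<le> qbinom_coeff p a n" "qbinom_coeff p a n \<le> 1 / qpoch_inf p p"
proof -
  show "0 \<le> qbinom_coeff p a n"
    unfolding qbinom_coeff_def using qpoch_bounds[OF assms, of n] less_imp_le[OF qpoch_p_pos]
    by (intro divide_nonneg_nonneg) auto
  show "qbinom_coeff p a n \<le> 1 / qpoch_inf p p"
    unfolding qbinom_coeff_def using qpoch_bounds[OF assms, of n] qpoch_inf_pos[of p] p_less_1
    by (intro frac_le qpoch_inf_le_qpoch) auto
qed

text \<open>The factor \<open>p ^ n\<close> in the recursion makes these coefficients decay faster than every
  geometric sequence.\<close>

lemma summable_abs_qexp_coeff: "summable (\<lambda>n. \<bar>qexp_coeff p n\<bar> * x ^ n)" if "0 \<le> x" for x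
proof -
  have "(\<lambda>n. p ^ n / (1 - p) * x) \<longlonglongrightarrow> 0 / (1 - p) * x"
    using p_pos p_less_1 by (intro tendsto_intros LIMSEQ_power_zero) auto
  then have "\<forall>\<^sub>F n in sequentially. p ^ n / (1 - p) * x < 1 / 2"
    by (intro order_tendstoD) auto
  then obtain N where N: "\<And>n. n \<ge> N \<Longrightarrow> p ^ n / (1 - p) * x < 1 / 2"
    by (auto simp: eventually_sequentially)
  have "norm (\<bar>qexp_coeff p (Suc n)\<bar> * x ^ Suc n) \<le> 1 / 2 * norm (\<bar>qexp_coeff p n\<bar> * x ^ n)"
    if "n \<ge> N" for n
  proof -
    define D where "D = 1 - p ^ Suc n"
    have D: "1 - p \<le> D" "0 < 1 - p"
      using p_less_1 power_decreasing[of 1 "Suc n" p] by (simp_all add: D_def)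
    have "\<bar>qexp_coeff p (Suc n) * D\<bar> = \<bar>- (p ^ n) * qexp_coeff p n\<bar>"
      unfolding D_def by (simp only: qexp_coeff_Suc)
    then have "\<bar>qexp_coeff p (Suc n)\<bar> * D = p ^ n * \<bar>qexp_coeff p n\<bar>"
      using D by (simp add: abs_mult)
    moreover have "\<bar>qexp_coeff p (Suc n)\<bar> * (1 - p) \<le> \<bar>qexp_coeff p (Suc n)\<bar> * D"
      using D by (intro mult_left_mono) auto
    ultimately have "\<bar>qexp_coeff p (Suc n)\<bar> \<le> p ^ n * \<bar>qexp_coeff p n\<bar> / (1 - p)"
      using D by (simp add: pos_le_divide_eq)
    then have "\<bar>qexp_coeff p (Suc n)\<bar> * x ^ Suc n
        \<le> (p ^ n * \<bar>qexp_coeff p n\<bar> / (1 - p)) * x ^ Suc n"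
      using \<open>0 \<le> x\<close> by (intro mult_right_mono) auto
    also have "\<dots> = (p ^ n / (1 - p) * x) * (\<bar>qexp_coeff p n\<bar> * x ^ n)"
      by simp
    also have "\<dots> \<le> 1 / 2 * (\<bar>qexp_coeff p n\<bar> * x ^ n)"
      using N[OF that] \<open>0 \<le> x\<close> by (intro mult_right_mono) auto
    finally show ?thesis using \<open>0 \<le> x\<close> by simp
  qed
  then show ?thesis
    by (intro summable_ratio_test[of "1/2" N]) auto
qed

lemma summable_qexp: "summable (\<lambda>n. qexp_coeff p n * x ^ n)"
  using summable_abs_qexp_coeff[of "\<bar>x\<bar>"]
  by (intro summable_rabs_cancel[of "\<lambda>n. qexp_coeff p n * x ^ n"]) (simp add: abs_mult power_abs)

text \<open>Euler's expansion of the infinite product and the \<open>q\<close>-binomial theorem both come from a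
  first-order functional equation relating \<open>x\<close> and \<open>x * p\<close>; this is the limit of its iteration.\<close>

lemma powser_iterate_tendsto:
  fixes c :: "nat \<Rightarrow> real"
  assumes "summable (\<lambda>n. c n * K ^ n)" "0 < K"
  shows "(\<lambda>m. \<Sum>n. c n * (x * p ^ m) ^ n) \<longlonglongrightarrow> c 0"
proof -
  have "isCont (\<lambda>y. \<Sum>n. c n * y ^ n) 0"
    using isCont_powser[OF assms(1), of 0] assms(2) by simp
  moreover have "(\<lambda>m. x * p ^ m) \<longlonglongrightarrow> 0"
    using p_pos p_less_1 by (auto intro!: tendsto_eq_intros LIMSEQ_power_zero)
  ultimately show ?thesis
    using isCont_tendsto_compose[of 0 "\<lambda>y. \<Sum>n. c n * y ^ n" "\<lambda>m. x * p ^ m" sequentially]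
    by (simp add: powser_zero)
qed

theorem qexp_series: "(\<Sum>n. qexp_coeff p n * x ^ n) = qpoch_inf x p"
proof -
  define g where "g y = (\<Sum>n. qexp_coeff p n * y ^ n)" for y
  have step: "g y = (1 - y) * g (y * p)" for y
  proof -
    have "(\<lambda>n. qexp_coeff p n * y ^ n - qexp_coeff p n * (y * p) ^ n) sums (g y - g (y * p))"
      unfolding g_def by (intro sums_diff summable_sums summable_qexp)
    then have "(\<lambda>n. qexp_coeff p (Suc n) * y ^ Suc n - qexp_coeff p (Suc n) * (y * p) ^ Suc n)
        sums (g y - g (y * p))"
      by (subst sums_Suc_iff[of "\<lambda>n. qexp_coeff p n * y ^ n - qexp_coeff p n * (y * p) ^ n"]) simp
    moreover have "qexp_coeff p (Suc n) * y ^ Suc n - qexp_coeff p (Suc n) * (y * p) ^ Suc n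
        = - y * (qexp_coeff p n * (y * p) ^ n)" for n
    proof -
      have "qexp_coeff p (Suc n) * y ^ Suc n - qexp_coeff p (Suc n) * (y * p) ^ Suc n
          = y ^ Suc n * (qexp_coeff p (Suc n) * (1 - p ^ Suc n))"
        by (simp add: algebra_simps power_mult_distrib)
      then show ?thesis
        unfolding qexp_coeff_Suc by (simp add: power_mult_distrib)
    qed
    ultimately have "(\<lambda>n. - y * (qexp_coeff p n * (y * p) ^ n)) sums (g y - g (y * p))"
      by simp
    moreover have "(\<lambda>n. - y * (qexp_coeff p n * (y * p) ^ n)) sums (- y * g (y * p))"
      unfolding g_def by (intro sums_mult summable_sums summable_qexp)
    ultimately have "g y - g (y * p) = - y * g (y * p)"
      by (rule sums_unique2)
    then show ?thesis by (simp add: algebra_simps)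
  qed
  have iter: "g x = qpoch x p m * g (x * p ^ m)" for m
    by (induction m) (simp_all add: qpoch_Suc step[of "x * p ^ _"] mult_ac)
  have "(\<lambda>m. qpoch x p m * g (x * p ^ m)) \<longlonglongrightarrow> qpoch_inf x p * 1"
    unfolding g_def using powser_iterate_tendsto[OF summable_qexp[of 1]]
    by (intro tendsto_mult qpoch_tendsto) simp
  then have "(\<lambda>m. g x) \<longlonglongrightarrow> qpoch_inf x p"
    by (simp flip: iter)
  then show ?thesis
    using LIMSEQ_unique[OF tendsto_const] by (auto simp: g_def)
qed

lemma summable_qbinom:
  assumes "0 \<le> a" "a \<le> 1" "\<bar>z\<bar> < 1"
  shows "summable (\<lambda>n. qbinom_coeff p a n * \<bar>z\<bar> ^ n)" "summable (\<lambda>n. qbinom_coeff p a n * z ^ n)"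
proof -
  show *: "summable (\<lambda>n. qbinom_coeff p a n * \<bar>z\<bar> ^ n)"
  proof (rule summable_comparison_test')
    show "summable (\<lambda>n. 1 / qpoch_inf p p * \<bar>z\<bar> ^ n)"
      using assms by (intro summable_mult summable_geometric) simp
    show "norm (qbinom_coeff p a n * \<bar>z\<bar> ^ n) \<le> 1 / qpoch_inf p p * \<bar>z\<bar> ^ n" for n
      using qbinom_coeff_bounds[OF assms(1,2), of n] by (simp add: abs_mult mult_right_mono del: times_divide_eq_left)
  qed
  show "summable (\<lambda>n. qbinom_coeff p a n * z ^ n)"
    using * qbinom_coeff_bounds(1)[OF assms(1,2)]
    by (intro summable_rabs_cancel[of "\<lambda>n. qbinom_coeff p a n * z ^ n"]) (simp add: abs_mult power_abs)
qed

theorem q_binomial: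
  assumes "0 \<le> a" "a \<le> 1" "\<bar>z\<bar> < 1"
  shows "(\<Sum>n. qbinom_coeff p a n * z ^ n) = qpoch_inf (a * z) p / qpoch_inf z p"
proof -
  define f where "f y = (\<Sum>n. qbinom_coeff p a n * y ^ n)" for y
  have step: "(1 - y) * f y = (1 - a * y) * f (y * p)" if y: "\<bar>y\<bar> < 1" for y
  proof -
    have yp: "\<bar>y * p\<bar> < 1"
      using y p_pos p_less_1 mult_left_le[of p "\<bar>y\<bar>"] by (simp add: abs_mult)
    note s = summable_qbinom(2)[OF assms(1,2) y] and sp = summable_qbinom(2)[OF assms(1,2) yp]
    have "(\<lambda>n. qbinom_coeff p a n * y ^ n - qbinom_coeff p a n * (y * p) ^ n) sums (f y - f (y * p))"
      unfolding f_def by (intro sums_diff summable_sums s sp)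
    then have "(\<lambda>n. qbinom_coeff p a (Suc n) * y ^ Suc n - qbinom_coeff p a (Suc n) * (y * p) ^ Suc n)
        sums (f y - f (y * p))"
      by (subst sums_Suc_iff[of "\<lambda>n. qbinom_coeff p a n * y ^ n - qbinom_coeff p a n * (y * p) ^ n"]) simp
    moreover have "qbinom_coeff p a (Suc n) * y ^ Suc n - qbinom_coeff p a (Suc n) * (y * p) ^ Suc n
        = y * (qbinom_coeff p a n * y ^ n) - a * y * (qbinom_coeff p a n * (y * p) ^ n)" for n
    proof -
      have "qbinom_coeff p a (Suc n) * y ^ Suc n - qbinom_coeff p a (Suc n) * (y * p) ^ Suc n
          = y ^ Suc n * (qbinom_coeff p a (Suc n) * (1 - p ^ Suc n))"
        by (simp add: algebra_simps power_mult_distrib)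
      then show ?thesis
        unfolding qbinom_coeff_Suc by (simp add: power_mult_distrib algebra_simps)
    qed
    ultimately have "(\<lambda>n. y * (qbinom_coeff p a n * y ^ n) - a * y * (qbinom_coeff p a n * (y * p) ^ n))
        sums (f y - f (y * p))" by simp
    moreover have "(\<lambda>n. y * (qbinom_coeff p a n * y ^ n) - a * y * (qbinom_coeff p a n * (y * p) ^ n))
        sums (y * f y - a * y * f (y * p))"
      unfolding f_def by (intro sums_diff sums_mult summable_sums s sp)
    ultimately have "f y - f (y * p) = y * f y - a * y * f (y * p)"
      by (rule sums_unique2)
    then show ?thesis by (simp add: algebra_simps)
  qed
  have iter: "qpoch z p m * f z = qpoch (a * z) p m * f (z * p ^ m)" for m
  proof (induction m)
    case (Suc m)
    have "\<bar>z * p ^ m\<bar> < 1"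
      using assms(3) power_le_one[of p m] mult_left_le[of "p ^ m" "\<bar>z\<bar>"] by (simp add: abs_mult)
    note step = step[OF this]
    have "qpoch z p (Suc m) * f z = (1 - z * p ^ m) * (qpoch z p m * f z)"
      by (simp add: qpoch_Suc)
    also have "\<dots> = qpoch (a * z) p m * ((1 - z * p ^ m) * f (z * p ^ m))"
      by (simp add: Suc)
    also have "\<dots> = qpoch (a * z) p (Suc m) * f (z * p ^ Suc m)"
      by (simp only: step) (simp add: qpoch_Suc mult_ac)
    finally show ?case .
  qed simp
  have "(\<lambda>m. qpoch (a * z) p m * f (z * p ^ m)) \<longlonglongrightarrow> qpoch_inf (a * z) p * 1"
    unfolding f_def
    using powser_iterate_tendsto[OF summable_qbinom(2)[OF assms(1,2), of "1/2"]]
    by (intro tendsto_mult qpoch_tendsto) simp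
  moreover have "(\<lambda>m. qpoch z p m * f z) \<longlonglongrightarrow> qpoch_inf z p * f z"
    by (intro tendsto_intros qpoch_tendsto)
  ultimately have eq: "qpoch_inf z p * f z = qpoch_inf (a * z) p"
    using LIMSEQ_unique by (simp add: iter)
  have "1 - z * p ^ i \<noteq> 0" for i
    using assms(3) power_le_one[of p i] mult_left_le[of "p ^ i" "\<bar>z\<bar>"]
      abs_le_D1[of "z * p ^ i" "\<bar>z\<bar>"] by (force simp: abs_mult)
  then have "qpoch_inf z p \<noteq> 0"
    unfolding qpoch_inf_def by (intro prodinf_nonzero convergent_prod_qpoch)
  with eq show ?thesis by (simp add: f_def field_simps)
qed

text \<open>Comparing coefficients in products of the above series amounts to finite convolutions.  Splitting
  \<open>1 - p ^ Suc m = (1 - p ^ n) + p ^ n * (1 - p ^ (Suc m - n))\<close> under the sum lets the recursions of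
  both factors act and yields a recursion in \<open>m\<close>.\<close>

lemma convolution_step:
  fixes u v :: "nat \<Rightarrow> real"
  shows "(\<Sum>n\<le>Suc m. u n * v (Suc m - n)) * (1 - p ^ Suc m) =
    (\<Sum>n\<le>m. u (Suc n) * (1 - p ^ Suc n) * v (m - n)) +
    (\<Sum>n\<le>m. p ^ n * u n * (v (Suc (m - n)) * (1 - p ^ Suc (m - n))))"
proof -
  have "(\<Sum>n\<le>Suc m. u n * v (Suc m - n)) * (1 - p ^ Suc m)
      = (\<Sum>n\<le>Suc m. u n * (1 - p ^ n) * v (Suc m - n) + p ^ n * u n * (v (Suc m - n) * (1 - p ^ (Suc m - n))))"
    unfolding sum_distrib_right
  proof (rule sum.cong)
    fix n assume "n \<in> {..Suc m}"
    then have "p ^ Suc m = p ^ n * p ^ (Suc m - n)" by (simp flip: power_add)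
    then show "u n * v (Suc m - n) * (1 - p ^ Suc m)
      = u n * (1 - p ^ n) * v (Suc m - n) + p ^ n * u n * (v (Suc m - n) * (1 - p ^ (Suc m - n)))"
      by (simp only:) (simp add: algebra_simps)
  qed simp
  also have "\<dots> = (\<Sum>n\<le>Suc m. u n * (1 - p ^ n) * v (Suc m - n))
      + (\<Sum>n\<le>Suc m. p ^ n * u n * (v (Suc m - n) * (1 - p ^ (Suc m - n))))"
    by (rule sum.distrib)
  also have "(\<Sum>n\<le>Suc m. u n * (1 - p ^ n) * v (Suc m - n))
      = (\<Sum>n\<le>m. u (Suc n) * (1 - p ^ Suc n) * v (m - n))"
    by (subst sum.atMost_Suc_shift) simp
  also have "(\<Sum>n\<le>Suc m. p ^ n * u n * (v (Suc m - n) * (1 - p ^ (Suc m - n))))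
      = (\<Sum>n\<le>m. p ^ n * u n * (v (Suc m - n) * (1 - p ^ (Suc m - n))))"
    by simp
  also have "\<dots> = (\<Sum>n\<le>m. p ^ n * u n * (v (Suc (m - n)) * (1 - p ^ Suc (m - n))))"
    by (intro sum.cong) (auto simp: Suc_diff_le)
  finally show ?thesis .
qed

text \<open>The coefficient form of \<open>(qpoch_inf (a * z) p / qpoch_inf z p) * (1 / qpoch_inf (a * z) p) = 1 / qpoch_inf z p\<close>.\<close>

lemma qbinom_convolution:
  "(\<Sum>n\<le>m. qbinom_coeff p a n * (a ^ (m - n) / qpoch p p (m - n))) = 1 / qpoch p p m"
proof (induction m)
  case (Suc m)
  define v where "v n = a ^ n / qpoch p p n" for n
  have v: "v (Suc n) * (1 - p ^ Suc n) = a * v n" for n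
    by (simp add: v_def qpoch_Suc divide_simps)
  have "(\<Sum>n\<le>Suc m. qbinom_coeff p a n * v (Suc m - n)) * (1 - p ^ Suc m)
      = (\<Sum>n\<le>m. (1 - a * p ^ n) * qbinom_coeff p a n * v (m - n)) +
        (\<Sum>n\<le>m. p ^ n * qbinom_coeff p a n * (a * v (m - n)))"
    by (subst convolution_step) (simp only: qbinom_coeff_Suc v)
  also have "\<dots> = (\<Sum>n\<le>m. qbinom_coeff p a n * v (m - n))"
    unfolding sum.distrib[symmetric] by (intro sum.cong) (auto simp: algebra_simps)
  also have "\<dots> = 1 / qpoch p p m" using Suc by (simp add: v_def)
  finally show ?case by (simp add: v_def qpoch_Suc field_simps)
qed simp

text \<open>The coefficient form of \<open>qpoch_inf z p * (1 / qpoch_inf z p) = 1\<close>.\<close>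

lemma qexp_convolution:
  "(\<Sum>n\<le>m. qexp_coeff p n / qpoch p p (m - n)) = (if m = 0 then 1 else 0)"
proof (cases m)
  case (Suc m')
  define v where "v n = 1 / qpoch p p n" for n
  have v: "v (Suc n) * (1 - p ^ Suc n) = v n" for n
    by (simp add: v_def qpoch_Suc divide_simps)
  have "(\<Sum>n\<le>Suc m'. qexp_coeff p n * v (Suc m' - n)) * (1 - p ^ Suc m')
      = (\<Sum>n\<le>m'. - (p ^ n) * qexp_coeff p n * v (m' - n)) +
        (\<Sum>n\<le>m'. p ^ n * qexp_coeff p n * v (m' - n))"
    by (subst convolution_step) (simp only: qexp_coeff_Suc v)
  also have "\<dots> = 0" unfolding sum.distrib[symmetric] by (intro sum.neutral) auto
  finally show ?thesis by (simp add: v_def Suc)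
qed simp

end

section \<open>Rearranging unconditional sums\<close>

abbreviation double_summable :: "('a \<Rightarrow> 'b \<Rightarrow> 'c::real_normed_vector) \<Rightarrow> bool" where
  "double_summable F \<equiv> (\<lambda>z. norm (case_prod F z)) summable_on UNIV \<times> UNIV"

lemma double_summableI:
  fixes F :: "'a \<Rightarrow> 'b \<Rightarrow> 'c::banach"
  assumes B: "\<And>x. B x summable_on UNIV" "\<And>x. (\<Sum>\<^sub>\<infinity>y. B x y) \<le> a x"
    and a: "a summable_on UNIV"
    and F: "\<And>x y. norm (F x y) \<le> B x y"
  shows "double_summable F"
proof -
  have nB: "0 \<le> B x y" for x y using F[of x y] norm_ge_zero order_trans by blast
  have inner: "(\<lambda>y. norm (F x y)) summable_on UNIV" for x
    by (rule summable_on_comparison_test[OF B(1)[of x]]) (use F in auto)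
  have "norm (\<Sum>\<^sub>\<infinity>y. norm (F x y)) \<le> a x" for x
  proof -
    have "(\<Sum>\<^sub>\<infinity>y. norm (F x y)) \<le> (\<Sum>\<^sub>\<infinity>y. B x y)"
      by (intro infsum_mono inner B F)
    then show ?thesis using B(2)[of x] by (simp add: infsum_nonneg)
  qed
  then have "(\<lambda>x. norm (\<Sum>\<^sub>\<infinity>y. norm (F x y))) summable_on UNIV"
    by (intro summable_on_comparison_test[OF a]) auto
  then show ?thesis
    using inner by (subst Infinite_Sum.abs_summable_on_Sigma_iff) auto
qed

lemma double_summable_bound:
  fixes F :: "'a \<Rightarrow> 'b \<Rightarrow> 'c::banach"
  assumes a: "a summable_on UNIV" "\<And>x. 0 \<le> a x"
    and b: "\<And>x. b x summable_on UNIV" "\<And>x. (\<Sum>\<^sub>\<infinity>y. b x y) \<le> C"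
    and F: "\<And>x y. norm (F x y) \<le> a x * b x y"
  shows "double_summable F"
proof (rule double_summableI[OF _ _ _ F])
  show "(\<lambda>y. a x * b x y) summable_on UNIV" for x by (intro summable_on_cmult_right b)
  show "(\<Sum>\<^sub>\<infinity>y. a x * b x y) \<le> a x * C" for x
    unfolding infsum_cmult_right' by (intro mult_left_mono a b)
  show "(\<lambda>x. a x * C) summable_on UNIV" by (intro summable_on_cmult_left a)
qed

lemma double_summable_product:
  fixes F :: "'a \<Rightarrow> 'b \<Rightarrow> 'c::banach"
  assumes "a summable_on UNIV" "b summable_on UNIV" "\<And>x. 0 \<le> a x"
    and "\<And>x y. norm (F x y) \<le> a x * b y"
  shows "double_summable F"
  by (rule double_summable_bound[where b = "\<lambda>_. b"]) (use assms in auto)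

lemma double_summable_swap:
  fixes F :: "'a \<Rightarrow> 'b \<Rightarrow> 'c::banach"
  assumes "double_summable F"
  shows "double_summable (\<lambda>y x. F x y)"
proof -
  have "bij_betw prod.swap (UNIV \<times> UNIV :: ('b \<times> 'a) set) (UNIV \<times> UNIV)" by auto
  from summable_on_reindex_bij_betw[OF this, of "\<lambda>z. norm (case z of (x, y) \<Rightarrow> F x y)"] assms
  show ?thesis by (simp add: case_prod_unfold)
qed

lemma Fubini_infsum:
  fixes F :: "'a \<Rightarrow> 'b \<Rightarrow> 'c::banach"
  assumes "double_summable F"
  shows "(\<Sum>\<^sub>\<infinity>x. \<Sum>\<^sub>\<infinity>y. F x y) = (\<Sum>\<^sub>\<infinity>y. \<Sum>\<^sub>\<infinity>x. F x y)"
  using infsum_swap_banach[of F UNIV UNIV] abs_summable_summable[OF assms] by simp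

lemma double_summableD:
  fixes F :: "'a \<Rightarrow> 'b \<Rightarrow> 'c::banach"
  assumes "double_summable F"
  shows "(\<lambda>y. norm (F x y)) summable_on UNIV" "(\<lambda>x. norm (\<Sum>\<^sub>\<infinity>y. F x y)) summable_on UNIV"
proof -
  show inner: "(\<lambda>y. norm (F x y)) summable_on UNIV" for x
    using assms by (subst (asm) Infinite_Sum.abs_summable_on_Sigma_iff) auto
  have outer: "(\<lambda>x. norm (\<Sum>\<^sub>\<infinity>y. norm (F x y))) summable_on UNIV"
    using assms by (subst (asm) Infinite_Sum.abs_summable_on_Sigma_iff) auto
  show "(\<lambda>x. norm (\<Sum>\<^sub>\<infinity>y. F x y)) summable_on UNIV"
  proof (rule summable_on_comparison_test[OF outer])
    show "norm (\<Sum>\<^sub>\<infinity>y. F x y) \<le> norm (\<Sum>\<^sub>\<infinity>y. norm (F x y))" for x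
      using norm_infsum_bound[OF inner[of x]] by (simp add: infsum_nonneg)
  qed auto
qed

lemma infsum_int_shift: "(\<Sum>\<^sub>\<infinity>n::int. f (n + k)) = (\<Sum>\<^sub>\<infinity>n. f n)"
  by (rule infsum_reindex_bij_witness[of _ "\<lambda>n. n - k" "\<lambda>n. n + k"]) auto

lemma summable_on_int_shift: "(\<lambda>n::int. f (n + k)) summable_on UNIV \<longleftrightarrow> f summable_on UNIV"
  by (rule summable_on_reindex_bij_witness[of _ "\<lambda>n. n - k" "\<lambda>n. n + k"]) auto

lemma double_summable_shear:
  fixes G :: "int \<Rightarrow> nat \<Rightarrow> 'c::banach"
  assumes "double_summable (\<lambda>M n. G (M + h n) n)"
  shows "double_summable G"
proof -
  have "bij_betw (\<lambda>(N, n). (N - h n, n)) (UNIV \<times> UNIV) (UNIV \<times> UNIV)"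
    by (rule bij_betwI[where g = "\<lambda>(N, n). (N + h n, n)"]) auto
  from summable_on_reindex_bij_betw[OF this, of "\<lambda>z. norm (case z of (M, n) \<Rightarrow> G (M + h n) n)"] assms
  show ?thesis by (simp add: case_prod_unfold)
qed

text \<open>The change of variables \<open>N = M + h n\<close> under a double sum; it moves dilations from one factor of an
  integrand to the other.\<close>

lemma Fubini_infsum_shear:
  fixes G :: "int \<Rightarrow> nat \<Rightarrow> 'c::banach"
  assumes "double_summable (\<lambda>M n. G (M + h n) n)"
  shows "(\<Sum>\<^sub>\<infinity>N. \<Sum>\<^sub>\<infinity>n. G N n) = (\<Sum>\<^sub>\<infinity>M. \<Sum>\<^sub>\<infinity>n. G (M + h n) n)"
proof -
  have "(\<Sum>\<^sub>\<infinity>N. \<Sum>\<^sub>\<infinity>n. G N n) = (\<Sum>\<^sub>\<infinity>n. \<Sum>\<^sub>\<infinity>N. G N n)"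
    by (rule Fubini_infsum[OF double_summable_shear[OF assms]])
  also have "\<dots> = (\<Sum>\<^sub>\<infinity>n. \<Sum>\<^sub>\<infinity>M. G (M + h n) n)"
    by (intro infsum_cong infsum_int_shift[symmetric])
  also have "\<dots> = (\<Sum>\<^sub>\<infinity>M. \<Sum>\<^sub>\<infinity>n. G (M + h n) n)"
    by (rule Fubini_infsum[OF assms, symmetric])
  finally show ?thesis .
qed

lemma infsum_complex_of_real: "(\<Sum>\<^sub>\<infinity>x\<in>A. complex_of_real (f x)) = complex_of_real (infsum f A)"
proof (rule infsum_bounded_linear_strong)
  show "(\<lambda>x. complex_of_real (f x)) summable_on A \<longleftrightarrow> f summable_on A"
    using summable_on_Re[of "\<lambda>x. complex_of_real (f x)" A] summable_on_of_real[of f A, where 'a = complex]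
    by auto
qed (rule bounded_linear_of_real)

lemma infsum_scaleR_left_complex: "(\<Sum>\<^sub>\<infinity>x\<in>A. f x *\<^sub>R (c::complex)) = infsum f A *\<^sub>R c"
  by (simp add: scaleR_conv_of_real infsum_cmult_left' infsum_complex_of_real)

lemma nat_section:
  fixes g :: "int \<Rightarrow> real"
  assumes "g summable_on UNIV" "\<And>m. 0 \<le> g m" "inj h"
  shows "(\<lambda>n::nat. g (h n)) summable_on UNIV" "(\<Sum>\<^sub>\<infinity>n. g (h n)) \<le> infsum g UNIV"
proof -
  have s: "g summable_on range h"
    using assms(1) by (rule summable_on_subset) auto
  then show "(\<lambda>n::nat. g (h n)) summable_on UNIV"
    using summable_on_reindex[OF assms(3), of g] by (simp add: o_def)
  show "(\<Sum>\<^sub>\<infinity>n. g (h n)) \<le> infsum g UNIV"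
    using infsum_reindex[OF assms(3), of g] infsum_mono2[OF s assms(1)] assms(2) by (simp add: o_def)
qed

lemma inj_int_add [simp]: "inj (\<lambda>n. M + int n)" and inj_int_diff [simp]: "inj (\<lambda>n. M - int n)"
  by (auto simp: inj_on_def)

lemma abs_summable_on_bounded_mult:
  fixes f :: "'a \<Rightarrow> 'b::banach"
  assumes "(\<lambda>x. a x * norm (f x)) summable_on UNIV" "\<And>x. 0 \<le> a x" "\<And>x. \<bar>b x\<bar> \<le> C * a x"
  shows "(\<lambda>x. norm (b x *\<^sub>R f x)) summable_on UNIV" "(\<lambda>x. b x *\<^sub>R f x) summable_on UNIV"
proof -
  show *: "(\<lambda>x. norm (b x *\<^sub>R f x)) summable_on UNIV"
  proof (rule summable_on_comparison_test)
    show "(\<lambda>x. C * (a x * norm (f x))) summable_on UNIV"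
      using assms(1) by (rule summable_on_cmult_right)
    show "norm (b x *\<^sub>R f x) \<le> C * (a x * norm (f x))" for x
      using mult_right_mono[OF assms(3)[of x], of "norm (f x)"] by (simp add: mult_ac)
  qed auto
  then show "(\<lambda>x. b x *\<^sub>R f x) summable_on UNIV" by (rule abs_summable_summable)
qed

section \<open>The lattice Bessel function\<close>

text \<open>Jackson's third \<open>q\<close>-Bessel function without its normalising denominator: with \<open>p = q\<^sup>2\<close> and
  \<open>w = q powr (2 * \<beta> + 2)\<close>, the value at \<open>(1 - q)\<^sup>2 * z\<^sup>2\<close> is \<open>j3 q \<beta> z * qpoch_inf w p\<close> (lemma
  \<open>j3_qJ\<close>).  In this normalisation the function is symmetric in \<open>w\<close> and \<open>Z\<close>.\<close>

definition qJ :: "real \<Rightarrow> real \<Rightarrow> real \<Rightarrow> real" where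
  "qJ p w Z = (\<Sum>\<^sub>\<infinity>n. qexp_coeff p n * Z ^ n * qpoch_inf (w * p ^ n) p)"

context q_base
begin

abbreviation e :: "nat \<Rightarrow> real" where "e \<equiv> qexp_coeff p"
abbreviation trunc :: "int \<Rightarrow> real" where "trunc m \<equiv> qpoch_inf (p powi m) p"

lemma qexp_has_sum: "((\<lambda>n. e n * x ^ n) has_sum qpoch_inf x p) UNIV"
proof (rule norm_summable_imp_has_sum)
  show "summable (\<lambda>n. norm (e n * x ^ n))"
    using summable_abs_qexp_coeff[of "\<bar>x\<bar>"] by (simp add: abs_mult power_abs)
  show "(\<lambda>n. e n * x ^ n) sums qpoch_inf x p"
    using summable_sums[OF summable_qexp] by (simp add: qexp_series)
qed

lemma qbinom_has_sum:
  assumes "0 \<le> a" "a \<le> 1" "0 \<le> z" "z < 1"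
  shows "((\<lambda>n. qbinom_coeff p a n * z ^ n) has_sum qpoch_inf (a * z) p / qpoch_inf z p) UNIV"
proof (rule norm_summable_imp_has_sum)
  show "summable (\<lambda>n. norm (qbinom_coeff p a n * z ^ n))"
    using summable_qbinom(1)[OF assms(1,2), of z] qbinom_coeff_bounds(1)[OF assms(1,2)] assms
    by (simp add: abs_mult)
  show "(\<lambda>n. qbinom_coeff p a n * z ^ n) sums (qpoch_inf (a * z) p / qpoch_inf z p)"
    using summable_sums[OF summable_qbinom(2)[OF assms(1,2), of z]] q_binomial[OF assms(1,2), of z] assms
    by simp
qed

lemma summable_on_abs_qexp: "0 \<le> x \<Longrightarrow> (\<lambda>n. \<bar>e n\<bar> * x ^ n) summable_on UNIV"
  using summable_abs_qexp_coeff[of x] by (subst summable_on_UNIV_nonneg_real_iff) auto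

lemma qJ_summable:
  assumes "0 \<le> w" "w \<le> 1"
  shows "(\<lambda>n. e n * Z ^ n * qpoch_inf (w * p ^ n) p) summable_on UNIV"
proof (rule abs_summable_summable, rule summable_on_comparison_test)
  show "(\<lambda>n. \<bar>e n\<bar> * \<bar>Z\<bar> ^ n) summable_on UNIV" by (rule summable_on_abs_qexp) simp
  show "norm (e n * Z ^ n * qpoch_inf (w * p ^ n) p) \<le> \<bar>e n\<bar> * \<bar>Z\<bar> ^ n" for n
    using qpoch_inf_bounds[of "w * p ^ n"] assms mult_pow_le_1[of w n]
    by (simp add: abs_mult power_abs mult_left_le)
qed auto

text \<open>Expanding the infinite product by Euler's series turns the defining series into a double
  series that is symmetric in \<open>w\<close> and \<open>Z\<close>.\<close>

theorem qJ_symmetric: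
  assumes "0 \<le> w" "w \<le> 1" "0 \<le> Z"
  shows "qJ p w Z = (\<Sum>\<^sub>\<infinity>k. e k * w ^ k * qpoch_inf (Z * p ^ k) p)"
proof -
  define F where "F n k = (e n * Z ^ n) * (e k * w ^ k) * p ^ (n * k)" for n k
  have F1: "(F n has_sum e n * Z ^ n * qpoch_inf (w * p ^ n) p) UNIV" for n
    using has_sum_cmult_right[OF qexp_has_sum[of "w * p ^ n"], of "e n * Z ^ n"]
    by (simp add: F_def[abs_def] mult_ac power_mult_distrib flip: power_mult)
  have F2: "((\<lambda>n. F n k) has_sum e k * w ^ k * qpoch_inf (Z * p ^ k) p) UNIV" for k
    using has_sum_cmult_right[OF qexp_has_sum[of "Z * p ^ k"], of "e k * w ^ k"]
    by (simp add: F_def[abs_def] mult_ac power_mult_distrib flip: power_mult)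
  have "double_summable F"
  proof (rule double_summable_product)
    show "(\<lambda>n. \<bar>e n\<bar> * Z ^ n) summable_on UNIV" "(\<lambda>k. \<bar>e k\<bar> * w ^ k) summable_on UNIV"
      by (intro summable_on_abs_qexp assms)+
    show "0 \<le> \<bar>e n\<bar> * Z ^ n" for n using assms by simp
    show "norm (F n k) \<le> (\<bar>e n\<bar> * Z ^ n) * (\<bar>e k\<bar> * w ^ k)" for n k
      using assms unfolding F_def by (simp add: abs_mult mult_left_le power_le_one)
  qed
  from Fubini_infsum[OF this] show ?thesis
    by (simp add: qJ_def infsumI[OF F1] infsumI[OF F2])
qed

lemma qJ_lattice:
  assumes "0 \<le> w" "w \<le> 1"
  shows "qJ p w (p powi N) = (\<Sum>\<^sub>\<infinity>k. e k * w ^ k * trunc (N + int k))"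
  using assms by (simp add: qJ_symmetric power_int_add)

lemma qJ_0: "qJ p w 0 = qpoch_inf w p"
proof -
  have "qJ p w 0 = (\<Sum>\<^sub>\<infinity>n\<in>{0}. qexp_coeff p n * 0 ^ n * qpoch_inf (w * p ^ n) p)"
    unfolding qJ_def by (intro infsum_cong_neutral) auto
  then show ?thesis by simp
qed

lemma trunc_abs [simp]: "\<bar>trunc m\<bar> = trunc m" "0 \<le> trunc m" "trunc m \<le> 1"
  using qpoch_inf_powi_bounds[of m] by auto

lemma qJ_lattice_bounded:
  assumes "0 \<le> w" "w \<le> 1"
  shows "\<bar>qJ p w (p powi N)\<bar> \<le> (\<Sum>\<^sub>\<infinity>k. \<bar>e k\<bar> * w ^ k)"
proof -
  have b: "norm (e k * w ^ k * trunc (N + int k)) \<le> \<bar>e k\<bar> * w ^ k" for k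
    using assms by (simp add: abs_mult mult_left_le)
  have s: "(\<lambda>k. norm (e k * w ^ k * trunc (N + int k))) summable_on UNIV"
    by (rule summable_on_comparison_test[OF summable_on_abs_qexp[OF assms(1)]]) (use b in auto)
  have "\<bar>qJ p w (p powi N)\<bar> \<le> (\<Sum>\<^sub>\<infinity>k. norm (e k * w ^ k * trunc (N + int k)))"
    unfolding qJ_lattice[OF assms] using norm_infsum_bound[OF s] by simp
  also have "\<dots> \<le> (\<Sum>\<^sub>\<infinity>k. \<bar>e k\<bar> * w ^ k)"
    by (intro infsum_mono s summable_on_abs_qexp assms b)
  finally show ?thesis .
qed

lemma trunc_has_sum:
  assumes "0 < r" "r < 1"
  shows "((\<lambda>m. r powi m * trunc m) has_sum r * qpoch_inf p p / qpoch_inf r p) UNIV"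
proof -
  have "((\<lambda>j. r * qpoch_inf p p * (qbinom_coeff p 0 j * r ^ j)) has_sum
      r * qpoch_inf p p * (qpoch_inf (0 * r) p / qpoch_inf r p)) UNIV"
    using assms by (intro has_sum_cmult_right qbinom_has_sum) auto
  then have "((\<lambda>j. r powi (1 + int j) * trunc (1 + int j)) has_sum r * qpoch_inf p p / qpoch_inf r p) UNIV"
    using assms qpoch_inf_powi_Suc
    by (simp add: qbinom_coeff_def qpoch_def power_int_add mult_ac add.commute)
  then have "((\<lambda>m. r powi m * trunc m) has_sum r * qpoch_inf p p / qpoch_inf r p) (range (\<lambda>j. 1 + int j))"
    by (subst has_sum_reindex) (auto simp: o_def)
  moreover have "trunc m = 0" if "m \<notin> range (\<lambda>j. 1 + int j)" for m
  proof (rule qpoch_inf_powi_nonpos, rule ccontr)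
    assume "\<not> m \<le> 0"
    then have "m = 1 + int (nat (m - 1))" by simp
    with that show False by blast
  qed
  ultimately show ?thesis
    by (subst has_sum_cong_neutral[where T = "range (\<lambda>j. 1 + int j)"]) auto
qed

lemma trunc_summable: "\<lbrakk>0 < r; r < 1\<rbrakk> \<Longrightarrow> (\<lambda>m. r powi m * trunc m) summable_on UNIV"
  using trunc_has_sum summable_on_def by blast

text \<open>In the series in \<open>w\<close> only the terms with \<open>N + k > 0\<close> survive.  Since the coefficients decay
  superexponentially, the function decays faster than every power as its argument grows along the
  lattice.\<close>

lemma qJ_lattice_summable:
  assumes "0 \<le> w" "w \<le> 1" "0 < r" "r < 1"
  shows "(\<lambda>N. r powi N * \<bar>qJ p w (p powi N)\<bar>) summable_on UNIV"
proof -
  define G where "G N k = (\<bar>e k\<bar> * (w / r) ^ k) * (r powi (N + int k) * trunc (N + int k))" for N k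
  have nn: "0 \<le> G N k" for N k using assms by (simp add: G_def)
  have "double_summable (\<lambda>k N. G N k)"
  proof (rule double_summable_bound)
    show "(\<lambda>k. \<bar>e k\<bar> * (w / r) ^ k) summable_on UNIV" "0 \<le> \<bar>e k\<bar> * (w / r) ^ k" for k
      using assms by (auto intro!: summable_on_abs_qexp)
    show "(\<lambda>N. r powi (N + int k) * trunc (N + int k)) summable_on UNIV"
      "(\<Sum>\<^sub>\<infinity>N. r powi (N + int k) * trunc (N + int k)) \<le> (\<Sum>\<^sub>\<infinity>m. r powi m * trunc m)" for k
      using trunc_summable[OF assms(3,4)]
      by (simp_all add: summable_on_int_shift[of "\<lambda>m. r powi m * trunc m"] infsum_int_shift[of "\<lambda>m. r powi m * trunc m"])
    show "norm (G N k) \<le> (\<bar>e k\<bar> * (w / r) ^ k) * (r powi (N + int k) * trunc (N + int k))" for N k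
      using nn[of N k] by (simp add: G_def)
  qed
  from double_summable_swap[OF this]
  have GS: "double_summable G" .
  have inner: "(\<lambda>k. G N k) summable_on UNIV" for N
    using double_summableD(1)[OF GS, of N] nn by simp
  have outer: "(\<lambda>N. \<Sum>\<^sub>\<infinity>k. G N k) summable_on UNIV"
    using abs_summable_summable[OF double_summableD(2)[OF GS]] .
  show ?thesis
  proof (rule summable_on_comparison_test[OF outer])
    fix N :: int
    have eq: "r powi N * norm (e k * w ^ k * trunc (N + int k)) = G N k" for k
      using assms by (simp add: G_def abs_mult power_int_add[of r] power_divide)
    have s: "(\<lambda>k. norm (e k * w ^ k * trunc (N + int k))) summable_on UNIV"
      using summable_on_cmult_right[OF inner[of N, folded eq], of "inverse (r powi N)"] assms
      by (simp add: mult.assoc[symmetric])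
    have "r powi N * \<bar>qJ p w (p powi N)\<bar> \<le> r powi N * (\<Sum>\<^sub>\<infinity>k. norm (e k * w ^ k * trunc (N + int k)))"
      unfolding qJ_lattice[OF assms(1,2)] using norm_infsum_bound[OF s] assms
      by (intro mult_left_mono) auto
    also have "\<dots> = (\<Sum>\<^sub>\<infinity>k. G N k)"
      by (subst infsum_cmult_right[symmetric]) (simp_all only: s eq)
    finally show "r powi N * \<bar>qJ p w (p powi N)\<bar> \<le> (\<Sum>\<^sub>\<infinity>k. G N k)" .
  qed (use assms in auto)
qed

end

context q_base
begin

lemma qJ_has_sum:
  "\<lbrakk>0 \<le> w; w \<le> 1\<rbrakk> \<Longrightarrow> ((\<lambda>n. e n * Z ^ n * qpoch_inf (w * p ^ n) p) has_sum qJ p w Z) UNIV"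
  unfolding qJ_def by (intro has_sum_infsum qJ_summable)

text \<open>The recursions of the coefficients \<open>e\<close> and of the infinite product give two first-order relations;
  together they contain the second-order difference equation of the kernel.\<close>

lemma qJ_diff:
  assumes "0 \<le> w" "w \<le> 1"
  shows "qJ p w Z - qJ p w (p * Z) = - Z * qJ p (w * p) (p * Z)"
proof -
  define P where "P n = qpoch_inf (w * p ^ n) p" for n
  have wp: "0 \<le> w * p" "w * p \<le> 1" using assms mult_pow_le_1[of w 1] by auto
  have "(\<lambda>n. e n * Z ^ n * P n - e n * (p * Z) ^ n * P n) sums (qJ p w Z - qJ p w (p * Z))"
    unfolding P_def by (intro sums_diff has_sum_imp_sums qJ_has_sum assms)
  then have "(\<lambda>n. e (Suc n) * Z ^ Suc n * P (Suc n) - e (Suc n) * (p * Z) ^ Suc n * P (Suc n))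
      sums (qJ p w Z - qJ p w (p * Z))"
    by (subst sums_Suc_iff[of "\<lambda>n. e n * Z ^ n * P n - e n * (p * Z) ^ n * P n"]) simp
  moreover have "e (Suc n) * Z ^ Suc n * P (Suc n) - e (Suc n) * (p * Z) ^ Suc n * P (Suc n)
      = - Z * (e n * (p * Z) ^ n * qpoch_inf (w * p * p ^ n) p)" for n
  proof -
    have "e (Suc n) * Z ^ Suc n * P (Suc n) - e (Suc n) * (p * Z) ^ Suc n * P (Suc n)
        = Z ^ Suc n * P (Suc n) * (e (Suc n) * (1 - p ^ Suc n))"
      by (simp add: algebra_simps power_mult_distrib)
    then show ?thesis
      unfolding qexp_coeff_Suc by (simp add: P_def power_mult_distrib mult_ac)
  qed
  moreover have "(\<lambda>n. - Z * (e n * (p * Z) ^ n * qpoch_inf (w * p * p ^ n) p))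
      sums (- Z * qJ p (w * p) (p * Z))"
    by (intro sums_mult has_sum_imp_sums qJ_has_sum wp)
  ultimately show ?thesis using sums_unique2 by simp
qed

lemma qJ_contiguous:
  assumes "0 \<le> w" "w \<le> 1"
  shows "qJ p w Z = qJ p (w * p) Z - w * qJ p (w * p) (p * Z)"
proof -
  have wp: "0 \<le> w * p" "w * p \<le> 1" using assms mult_pow_le_1[of w 1] by auto
  have "((\<lambda>n. e n * Z ^ n * qpoch_inf (w * p * p ^ n) p + - w * (e n * (p * Z) ^ n * qpoch_inf (w * p * p ^ n) p))
      has_sum (qJ p (w * p) Z + - w * qJ p (w * p) (p * Z))) UNIV"
    by (intro has_sum_add has_sum_cmult_right qJ_has_sum wp)
  moreover have "e n * Z ^ n * qpoch_inf (w * p * p ^ n) p + - w * (e n * (p * Z) ^ n * qpoch_inf (w * p * p ^ n) p)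
      = e n * Z ^ n * qpoch_inf (w * p ^ n) p" for n
    by (subst (3) qpoch_inf_step) (simp add: algebra_simps power_mult_distrib)
  ultimately show ?thesis
    using has_sum_unique[OF qJ_has_sum[OF assms]] by simp
qed

lemma qJ_bounded:
  assumes "0 \<le> w" "w \<le> 1" "Z \<in> Rq_pos0 p"
  shows "\<bar>qJ p w Z\<bar> \<le> (\<Sum>\<^sub>\<infinity>k. \<bar>e k\<bar> * w ^ k)"
proof (cases "Z = 0")
  case True
  have "1 \<le> (\<Sum>\<^sub>\<infinity>k. \<bar>e k\<bar> * w ^ k)"
    using finite_sum_le_infsum[OF summable_on_abs_qexp[OF assms(1)], of "{0}"] assms by simp
  then show ?thesis
    using qpoch_inf_bounds[OF assms(1,2)] by (simp add: True qJ_0)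
next
  case False
  then obtain N where "Z = p powi N" using assms(3) by (auto simp: Rq_pos0_def Rq_pos_def)
  then show ?thesis using qJ_lattice_bounded[OF assms(1,2)] by simp
qed

text \<open>For \<open>Z \<le> 1\<close> the tail of the power series is estimated termwise.  For \<open>Z > 1\<close> every term on the left is
  already bounded by a multiple of \<open>Z ^ k\<close>, because the function is bounded on the lattice.\<close>

lemma qJ_taylor:
  assumes "0 \<le> w" "w \<le> 1"
  obtains C where "0 \<le> C"
    "\<And>N. \<bar>qJ p w (p powi N) - (\<Sum>n<k. e n * qpoch_inf (w * p ^ n) p * (p powi N) ^ n)\<bar> \<le> C * (p powi N) ^ k"
proof -
  define P where "P n = qpoch_inf (w * p ^ n) p" for n
  have P: "0 \<le> P n" "P n \<le> 1" for n
    unfolding P_def using qpoch_inf_bounds[of "w * p ^ n"] assms mult_pow_le_1[of w n] by auto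
  define B where "B = (\<Sum>\<^sub>\<infinity>k. \<bar>e k\<bar> * w ^ k)"
  define T where "T = (\<Sum>n. \<bar>e (n + k)\<bar>)"
  have sT: "summable (\<lambda>n. \<bar>e (n + k)\<bar>)"
    using summable_ignore_initial_segment[OF summable_abs_qexp_coeff[of 1], of k] by simp
  have T0: "0 \<le> T" unfolding T_def by (intro suminf_nonneg sT) simp
  have B0: "0 \<le> B" unfolding B_def using assms by (intro infsum_nonneg) simp
  define C where "C = B + (\<Sum>n<k. \<bar>e n\<bar>) + T"
  have C: "B \<le> C" "T \<le> C" "0 \<le> C" "B + (\<Sum>n<k. \<bar>e n\<bar>) \<le> C"
    using T0 B0 sum_nonneg[of "{..<k}" "\<lambda>n. \<bar>e n\<bar>"] by (auto simp: C_def)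
  have "\<bar>qJ p w Z - (\<Sum>n<k. e n * P n * Z ^ n)\<bar> \<le> C * Z ^ k" if Z: "Z = p powi N" for Z N
  proof (cases "Z \<le> 1")
    case True
    have Z0: "0 < Z" using Z by simp
    have s: "(\<lambda>n. e n * P n * Z ^ n) sums qJ p w Z"
      using has_sum_imp_sums[OF qJ_has_sum[OF assms], of Z] by (simp add: P_def mult_ac)
    have tail: "(\<lambda>n. e (n + k) * P (n + k) * Z ^ (n + k)) sums (qJ p w Z - (\<Sum>n<k. e n * P n * Z ^ n))"
      using s by (rule sums_split_initial_segment)
    have le: "norm (e (n + k) * P (n + k) * Z ^ (n + k)) \<le> \<bar>e (n + k)\<bar> * Z ^ k" for n
    proof -
      have "P (n + k) * Z ^ (n + k) \<le> 1 * (1 * Z ^ k)"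
        unfolding power_add using P Z0 True
        by (intro mult_mono) (auto simp: power_le_one)
      then have "\<bar>e (n + k)\<bar> * (P (n + k) * Z ^ (n + k)) \<le> \<bar>e (n + k)\<bar> * Z ^ k"
        by (intro mult_left_mono) auto
      then show ?thesis using P Z0 by (simp add: abs_mult mult_ac)
    qed
    have "norm (qJ p w Z - (\<Sum>n<k. e n * P n * Z ^ n)) \<le> (\<Sum>n. \<bar>e (n + k)\<bar> * Z ^ k)"
      unfolding sums_unique[OF tail] by (rule norm_suminf_le[OF le summable_mult2[OF sT]])
    also have "\<dots> = T * Z ^ k" unfolding T_def by (rule suminf_mult2[OF sT, symmetric])
    also have "\<dots> \<le> C * Z ^ k" using C Z0 by (intro mult_right_mono) auto
    finally show ?thesis by simp
  next
    case False
    have Zk: "1 \<le> Z ^ k" using False by simp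
    have "\<bar>qJ p w Z\<bar> \<le> B" using qJ_bounded[OF assms, of Z] by (simp add: B_def Z Rq_pos0_def Rq_pos_def)
    also have "B \<le> B * Z ^ k" using mult_left_mono[OF Zk B0] by simp
    finally have 1: "\<bar>qJ p w Z\<bar> \<le> B * Z ^ k" .
    have "\<bar>\<Sum>n<k. e n * P n * Z ^ n\<bar> \<le> (\<Sum>n<k. \<bar>e n\<bar> * Z ^ k)"
    proof (rule sum_abs[THEN order_trans], rule sum_mono)
      fix n assume "n \<in> {..<k}"
      then have "P n * Z ^ n \<le> 1 * Z ^ k"
        using P False by (intro mult_mono power_increasing) auto
      then have "\<bar>e n\<bar> * (P n * Z ^ n) \<le> \<bar>e n\<bar> * Z ^ k" by (intro mult_left_mono) auto
      then show "\<bar>e n * P n * Z ^ n\<bar> \<le> \<bar>e n\<bar> * Z ^ k" using P False by (simp add: abs_mult mult_ac)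
    qed
    then have "\<bar>qJ p w Z - (\<Sum>n<k. e n * P n * Z ^ n)\<bar> \<le> (B + (\<Sum>n<k. \<bar>e n\<bar>)) * Z ^ k"
      using 1 by (simp add: algebra_simps sum_distrib_left)
    also have "\<dots> \<le> C * Z ^ k" using C Zk by (intro mult_right_mono) auto
    finally show ?thesis .
  qed
  then show ?thesis using that[OF C(3)] by (simp add: P_def)
qed

section \<open>Sonine formulas\<close>

text \<open>Summing the \<open>q\<close>-binomial series under the power series replaces the factor
  \<open>qpoch_inf (w * p ^ k) p\<close> by \<open>qpoch_inf (w * r * p ^ k) p\<close>: a fractional integral over \<open>[0, x]\<close>
  raises the order of a Bessel function.  This is the action of \<open>q_RL\<close> on the cosine kernel.\<close>

theorem qJ_sonine_contract:
  assumes "0 < w" "w < 1" "0 \<le> r" "r \<le> 1"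
  shows "(\<Sum>\<^sub>\<infinity>n. qbinom_coeff p r n * w ^ n * qJ p w (Z * p ^ n)) = qJ p (w * r) Z"
proof -
  define F where "F n k = (qbinom_coeff p r n * w ^ n) * (e k * (Z * p ^ n) ^ k * qpoch_inf (w * p ^ k) p)" for n k
  have cs: "(\<lambda>n. qbinom_coeff p r n * w ^ n) summable_on UNIV"
    using qbinom_has_sum[of r w] assms summable_on_def by auto
  have c0: "0 \<le> qbinom_coeff p r n" for n using qbinom_coeff_bounds assms by auto
  have F1: "(F n has_sum qbinom_coeff p r n * w ^ n * qJ p w (Z * p ^ n)) UNIV" for n
    unfolding F_def[abs_def] using assms by (intro has_sum_cmult_right qJ_has_sum) auto
  have F2: "((\<lambda>n. F n k) has_sum e k * Z ^ k * qpoch_inf (w * r * p ^ k) p) UNIV" for k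
  proof -
    have wk: "0 \<le> w * p ^ k" "w * p ^ k < 1" using assms mult_pow_less_1[of w k] by auto
    from has_sum_cmult_right[OF qbinom_has_sum[OF assms(3,4) this], of "e k * Z ^ k * qpoch_inf (w * p ^ k) p"]
    show ?thesis
      using qpoch_inf_pos[OF wk]
      by (simp add: F_def[abs_def] mult_ac power_mult_distrib flip: power_mult)
  qed
  have "double_summable F"
  proof (rule double_summable_product)
    show "(\<lambda>n. qbinom_coeff p r n * w ^ n) summable_on UNIV" by (rule cs)
    show "(\<lambda>k. \<bar>e k\<bar> * \<bar>Z\<bar> ^ k) summable_on UNIV" by (rule summable_on_abs_qexp) simp
    show "0 \<le> qbinom_coeff p r n * w ^ n" for n using assms c0 by simp
    show "norm (F n k) \<le> (qbinom_coeff p r n * w ^ n) * (\<bar>e k\<bar> * \<bar>Z\<bar> ^ k)" for n k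
    proof -
      have P: "0 \<le> qpoch_inf (w * p ^ k) p" "qpoch_inf (w * p ^ k) p \<le> 1"
        using qpoch_inf_bounds[of "w * p ^ k"] assms mult_pow_le_1[of w k] by auto
      have "\<bar>Z * p ^ n\<bar> ^ k * qpoch_inf (w * p ^ k) p \<le> \<bar>Z\<bar> ^ k * 1"
        using P mult_left_le[of "p ^ n" "\<bar>Z\<bar>"]
        by (intro mult_mono power_mono) (auto simp: abs_mult power_le_one)
      then have "\<bar>e k\<bar> * (\<bar>Z * p ^ n\<bar> ^ k * qpoch_inf (w * p ^ k) p) \<le> \<bar>e k\<bar> * \<bar>Z\<bar> ^ k"
        by (intro mult_left_mono) auto
      then have "(qbinom_coeff p r n * w ^ n) * (\<bar>e k\<bar> * (\<bar>Z * p ^ n\<bar> ^ k * qpoch_inf (w * p ^ k) p))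
          \<le> (qbinom_coeff p r n * w ^ n) * (\<bar>e k\<bar> * \<bar>Z\<bar> ^ k)"
        using c0 assms by (intro mult_left_mono) auto
      moreover have "norm (F n k) = (qbinom_coeff p r n * w ^ n) * (\<bar>e k\<bar> * (\<bar>Z * p ^ n\<bar> ^ k * qpoch_inf (w * p ^ k) p))"
        using P c0 assms unfolding F_def by (simp add: abs_mult power_abs)
      ultimately show ?thesis by simp
    qed
  qed
  from Fubini_infsum[OF this] show ?thesis
    by (simp add: qJ_def[of p "w * r"] infsumI[OF F1] infsumI[OF F2])
qed

text \<open>The generating function of \<open>trunc\<close> is \<open>z * qpoch_inf p p / qpoch_inf z p\<close>, so \<open>qbinom_convolution\<close>
  applies.\<close>

lemma trunc_sonine:
  assumes "0 < r" "r \<le> 1"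
  shows "(\<Sum>\<^sub>\<infinity>n. qbinom_coeff p r n * (r powi (M - int n) * trunc (M - int n))) = r * trunc M"
proof (cases "M \<le> 0")
  case True
  then have "trunc (M - int n) = 0" for n by (intro qpoch_inf_powi_nonpos) simp
  then show ?thesis using True by (simp add: qpoch_inf_powi_nonpos)
next
  case False
  define m where "m = nat (M - 1)"
  have M: "M = int m + 1" using False by (simp add: m_def)
  have "(\<Sum>\<^sub>\<infinity>n. qbinom_coeff p r n * (r powi (M - int n) * trunc (M - int n)))
      = (\<Sum>\<^sub>\<infinity>n\<in>{..m}. r * qpoch_inf p p * (qbinom_coeff p r n * (r ^ (m - n) / qpoch p p (m - n))))"
  proof (intro infsum_cong_neutral)
    fix n assume "n \<in> UNIV - {..m}"
    then have "trunc (M - int n) = 0" by (intro qpoch_inf_powi_nonpos) (simp add: M)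
    then show "qbinom_coeff p r n * (r powi (M - int n) * trunc (M - int n)) = 0" by simp
  next
    fix n assume "n \<in> UNIV \<inter> {..m}"
    then have "M - int n = int (m - n) + 1" by (simp add: M of_nat_diff)
    then show "qbinom_coeff p r n * (r powi (M - int n) * trunc (M - int n))
        = r * qpoch_inf p p * (qbinom_coeff p r n * (r ^ (m - n) / qpoch p p (m - n)))"
      using assms by (simp only: qpoch_inf_powi_Suc) (simp add: power_int_add)
  qed auto
  also have "\<dots> = r * qpoch_inf p p * (1 / qpoch p p m)"
    by (simp only: infsum_finite finite_atMost flip: sum_distrib_left) (simp only: qbinom_convolution)
  also have "\<dots> = r * trunc M" by (simp add: M qpoch_inf_powi_Suc)
  finally show ?thesis .
qed

lemma qbinom_section_bound:
  fixes g :: "int \<Rightarrow> real"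
  assumes "g summable_on UNIV" "\<And>m. 0 \<le> g m" "inj h" "0 \<le> r" "r \<le> 1"
  shows "(\<lambda>n. qbinom_coeff p r n * g (h n)) summable_on UNIV"
    "(\<Sum>\<^sub>\<infinity>n. qbinom_coeff p r n * g (h n)) \<le> (1 / qpoch_inf p p) * infsum g UNIV"
proof -
  note s = nat_section[OF assms(1-3)]
  note c = qbinom_coeff_bounds[OF assms(4,5)]
  have le: "qbinom_coeff p r n * g (h n) \<le> (1 / qpoch_inf p p) * g (h n)" for n
    by (intro mult_right_mono c assms)
  show *: "(\<lambda>n. qbinom_coeff p r n * g (h n)) summable_on UNIV"
    by (rule summable_on_comparison_test[OF summable_on_cmult_right[OF s(1), of "1 / qpoch_inf p p"]])
       (use le assms c in auto)
  have "(\<Sum>\<^sub>\<infinity>n. qbinom_coeff p r n * g (h n)) \<le> (\<Sum>\<^sub>\<infinity>n. (1 / qpoch_inf p p) * g (h n))"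
    by (intro infsum_mono * summable_on_cmult_right s le)
  also have "\<dots> = (1 / qpoch_inf p p) * (\<Sum>\<^sub>\<infinity>n. g (h n))"
    by (rule infsum_cmult_right[OF s(1)])
  also have "\<dots> \<le> (1 / qpoch_inf p p) * infsum g UNIV"
    using s(2) qpoch_inf_pos[of p] p_less_1 by (intro mult_left_mono) auto
  finally show "(\<Sum>\<^sub>\<infinity>n. qbinom_coeff p r n * g (h n)) \<le> (1 / qpoch_inf p p) * infsum g UNIV" .
qed

text \<open>Here the argument runs to infinity, where the power series is of no use; the series in \<open>w\<close> reduces
  the formula to \<open>trunc_sonine\<close>, term by term.  It expresses that a fractional integral over
  \<open>[x, \<infinity>[\<close> lowers the order, and is the action of \<open>q_Weyl\<close> on the Bessel kernel.\<close>

theorem qJ_sonine_dilate: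
  assumes "0 \<le> w" "w \<le> 1" "0 < r" "r < 1"
  shows "(\<Sum>\<^sub>\<infinity>n. qbinom_coeff p r n * (r powi (N - int n) * qJ p (w * r) (p powi (N - int n))))
    = r * qJ p w (p powi N)"
proof -
  define F where "F k n = (e k * w ^ k) * (qbinom_coeff p r n * (r powi (N + int k - int n) * trunc (N + int k - int n)))"
    for k n
  have wr: "0 \<le> w * r" "w * r \<le> 1" using assms mult_le_one[of w r] by auto
  have F1: "(\<Sum>\<^sub>\<infinity>n. F k n) = r * (e k * w ^ k * trunc (N + int k))" for k
    using assms trunc_sonine[of r "N + int k"]
    by (simp add: F_def infsum_cmult_right' mult_ac)
  have F2: "(\<Sum>\<^sub>\<infinity>k. F k n) = qbinom_coeff p r n * (r powi (N - int n) * qJ p (w * r) (p powi (N - int n)))" for n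
  proof -
    have "F k n = (qbinom_coeff p r n * r powi (N - int n)) * (e k * (w * r) ^ k * trunc (N - int n + int k))" for k
    proof -
      have eq: "N + int k - int n = N - int n + int k" by simp
      have "r powi (N - int n + int k) = r powi (N - int n) * r ^ k"
        using assms by (simp add: power_int_add)
      then show ?thesis unfolding F_def eq power_mult_distrib by (simp only: mult_ac)
    qed
    then show ?thesis
      by (simp add: infsum_cmult_right' qJ_lattice[OF wr] mult.assoc)
  qed
  note tr = trunc_summable[OF assms(3,4)]
  have g0: "0 \<le> r powi m * trunc m" for m using assms by simp
  have "double_summable F"
  proof (rule double_summable_bound)
    note b = qbinom_section_bound[OF tr g0, of "\<lambda>n. N + int k - int n" r for k]
    show "(\<lambda>k. \<bar>e k\<bar> * w ^ k) summable_on UNIV" "0 \<le> \<bar>e k\<bar> * w ^ k" for k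
      using assms by (auto intro!: summable_on_abs_qexp)
    show "(\<lambda>n. qbinom_coeff p r n * (r powi (N + int k - int n) * trunc (N + int k - int n))) summable_on UNIV"
      "(\<Sum>\<^sub>\<infinity>n. qbinom_coeff p r n * (r powi (N + int k - int n) * trunc (N + int k - int n)))
        \<le> (1 / qpoch_inf p p) * (\<Sum>\<^sub>\<infinity>m. r powi m * trunc m)" for k
      using assms by (intro b; simp)+
    show "norm (F k n) \<le> (\<bar>e k\<bar> * w ^ k) * (qbinom_coeff p r n * (r powi (N + int k - int n) * trunc (N + int k - int n)))" for k n
      using assms qbinom_coeff_bounds(1)[of r n] unfolding F_def by (simp add: abs_mult)
  qed
  from Fubini_infsum[OF this] show ?thesis
    by (simp add: F1 F2 infsum_cmult_right' qJ_lattice[OF assms(1,2)])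
qed

text \<open>The limit \<open>N \<rightarrow> \<infinity>\<close> of the previous formula, needed for the position \<open>b = 0\<close>.\<close>

theorem qJ_mellin:
  assumes "0 \<le> w" "w \<le> 1" "0 < r" "r < 1"
  shows "(\<Sum>\<^sub>\<infinity>N. r powi N * qJ p (w * r) (p powi N)) = r * qpoch_inf p p / qpoch_inf r p * qpoch_inf w p"
proof -
  define F where "F k N = (e k * w ^ k) * (r powi (N + int k) * trunc (N + int k))" for k N
  have wr: "0 \<le> w * r" "w * r \<le> 1" using assms mult_le_one[of w r] by auto
  have sh: "(\<Sum>\<^sub>\<infinity>N. r powi (N + int k) * trunc (N + int k)) = r * qpoch_inf p p / qpoch_inf r p" for k
    using infsum_int_shift[of "\<lambda>m. r powi m * trunc m" "int k"] infsumI[OF trunc_has_sum[OF assms(3,4)]] by simp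
  have shs: "(\<lambda>N. r powi (N + int k) * trunc (N + int k)) summable_on UNIV" for k
    using summable_on_int_shift[of "\<lambda>m. r powi m * trunc m" "int k"] trunc_summable[OF assms(3,4)] by simp
  have F1: "(\<Sum>\<^sub>\<infinity>N. F k N) = r * qpoch_inf p p / qpoch_inf r p * (e k * w ^ k)" for k
    by (simp add: F_def infsum_cmult_right' sh)
  have F2: "(\<Sum>\<^sub>\<infinity>k. F k N) = r powi N * qJ p (w * r) (p powi N)" for N
  proof -
    have "F k N = r powi N * (e k * (w * r) ^ k * trunc (N + int k))" for k
      using assms by (simp add: F_def power_int_add[of r] power_mult_distrib)
    then show ?thesis by (simp add: infsum_cmult_right' qJ_lattice[OF wr])
  qed
  have "double_summable F"
  proof (rule double_summable_bound)
    show "(\<lambda>k. \<bar>e k\<bar> * w ^ k) summable_on UNIV" "0 \<le> \<bar>e k\<bar> * w ^ k" for k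
      using assms by (auto intro!: summable_on_abs_qexp)
    show "(\<lambda>N. r powi (N + int k) * trunc (N + int k)) summable_on UNIV"
      "(\<Sum>\<^sub>\<infinity>N. r powi (N + int k) * trunc (N + int k)) \<le> r * qpoch_inf p p / qpoch_inf r p" for k
      by (simp_all only: sh shs order_refl)
    show "norm (F k N) \<le> (\<bar>e k\<bar> * w ^ k) * (r powi (N + int k) * trunc (N + int k))" for k N
      using assms by (simp only: F_def norm_mult real_norm_def abs_mult trunc_abs) (simp add: power_abs)
  qed
  from Fubini_infsum[OF this]
  have "(\<Sum>\<^sub>\<infinity>k. r * qpoch_inf p p / qpoch_inf r p * (e k * w ^ k))
      = (\<Sum>\<^sub>\<infinity>N. r powi N * qJ p (w * r) (p powi N))"
    by (simp only: F1 F2)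
  then show ?thesis
    unfolding infsum_cmult_right' infsumI[OF qexp_has_sum] by simp
qed

section \<open>Orthogonality on the lattice\<close>

text \<open>The generating functions \<open>z * qpoch_inf p p / qpoch_inf z p\<close> of \<open>trunc\<close> and \<open>qpoch_inf z p\<close> of \<open>e\<close>
  multiply to \<open>z * qpoch_inf p p\<close>, whence a point mass.\<close>

lemma trunc_qexp_delta: "(\<Sum>\<^sub>\<infinity>n. e n * trunc (M - int n)) = (if M = 1 then qpoch_inf p p else 0)"
proof (cases "M \<le> 0")
  case True
  then have "trunc (M - int n) = 0" for n by (intro qpoch_inf_powi_nonpos) simp
  then show ?thesis using True by simp
next
  case False
  define m where "m = nat (M - 1)"
  have M: "M = int m + 1" using False by (simp add: m_def)
  have "(\<Sum>\<^sub>\<infinity>n. e n * trunc (M - int n)) = (\<Sum>\<^sub>\<infinity>n\<in>{..m}. qpoch_inf p p * (e n / qpoch p p (m - n)))"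
  proof (intro infsum_cong_neutral)
    fix n assume "n \<in> UNIV - {..m}"
    then have "trunc (M - int n) = 0" by (intro qpoch_inf_powi_nonpos) (simp add: M)
    then show "e n * trunc (M - int n) = 0" by simp
  next
    fix n assume "n \<in> UNIV \<inter> {..m}"
    then have "M - int n = int (m - n) + 1" by (simp add: M of_nat_diff)
    then show "e n * trunc (M - int n) = qpoch_inf p p * (e n / qpoch p p (m - n))"
      by (simp only: qpoch_inf_powi_Suc) simp
  qed auto
  also have "\<dots> = qpoch_inf p p * (if m = 0 then 1 else 0)"
    by (simp only: infsum_finite finite_atMost flip: sum_distrib_left) (simp only: qexp_convolution)
  finally show ?thesis by (simp add: M)
qed

lemma summable_abs_e: "(\<lambda>n. \<bar>e n\<bar>) summable_on UNIV"
  using summable_on_abs_qexp[of 1] by simp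

lemma qJ_qexp_convolution:
  assumes "0 \<le> w" "w \<le> 1"
  shows "(\<Sum>\<^sub>\<infinity>n. e n * qJ p w (p powi (M - int n)))
    = (\<Sum>\<^sub>\<infinity>k. e k * w ^ k * (if M + int k = 1 then qpoch_inf p p else 0))"
proof -
  define F where "F k n = (e k * w ^ k) * (e n * trunc (M + int k - int n))" for k n
  have F1: "(\<Sum>\<^sub>\<infinity>n. F k n) = e k * w ^ k * (if M + int k = 1 then qpoch_inf p p else 0)" for k
    by (simp only: F_def infsum_cmult_right' trunc_qexp_delta)
  have F2: "(\<Sum>\<^sub>\<infinity>k. F k n) = e n * qJ p w (p powi (M - int n))" for n
  proof -
    have "F k n = e n * (e k * w ^ k * trunc (M - int n + int k))" for k
      by (simp add: F_def algebra_simps)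
    then show ?thesis by (simp only: infsum_cmult_right' qJ_lattice[OF assms])
  qed
  have "double_summable F"
  proof (rule double_summable_product)
    show "(\<lambda>k. \<bar>e k\<bar> * w ^ k) summable_on UNIV" by (intro summable_on_abs_qexp assms)
    show "(\<lambda>n. \<bar>e n\<bar>) summable_on UNIV" by (rule summable_abs_e)
    show "0 \<le> \<bar>e k\<bar> * w ^ k" for k using assms by simp
    show "norm (F k n) \<le> (\<bar>e k\<bar> * w ^ k) * \<bar>e n\<bar>" for k n
      unfolding F_def real_norm_def abs_mult trunc_abs using assms
      by (auto simp: power_abs intro!: mult_mono mult_left_le)
  qed
  from Fubini_infsum[OF this] show ?thesis by (simp only: F1 F2)
qed

text \<open>Expanding the second factor in powers of \<open>w\<close> and shifting \<open>L\<close> exposes the first factor summed against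
  \<open>e\<close>.  By \<open>trunc_qexp_delta\<close> this sum collapses to a single power of \<open>w\<close>, and the remaining sum is
  again of the form of \<open>trunc_qexp_delta\<close>.\<close>

theorem qJ_orthogonal_shift:
  assumes "0 < w" "w < 1"
  shows "(\<Sum>\<^sub>\<infinity>L. w powi L * qJ p w (p powi (L + m)) * qJ p w (p powi L))
    = (if m = 0 then w * (qpoch_inf p p)\<^sup>2 else 0)"
proof -
  have w: "0 \<le> w" "w \<le> 1" using assms by auto
  define B where "B = (\<Sum>\<^sub>\<infinity>k. \<bar>e k\<bar> * w ^ k)"
  have B: "\<bar>qJ p w (p powi N)\<bar> \<le> B" for N unfolding B_def by (rule qJ_lattice_bounded[OF w])
  define G where "G L n = w powi L * qJ p w (p powi (L + m)) * (e n * w ^ n * trunc (L + int n))" for L n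
  have G1: "(\<Sum>\<^sub>\<infinity>n. G L n) = w powi L * qJ p w (p powi (L + m)) * qJ p w (p powi L)" for L
    unfolding G_def infsum_cmult_right' by (simp only: qJ_lattice[OF w, of L])
  define H where "H A n = (w powi A * trunc A) * (e n * qJ p w (p powi (A + m - int n)))" for A n
  have GH: "G (A + - int n) n = H A n" for A n
    using assms unfolding G_def H_def by (simp add: power_int_diff algebra_simps)
  have "double_summable H"
  proof (rule double_summable_product)
    show "(\<lambda>A. w powi A * trunc A) summable_on UNIV" by (intro trunc_summable assms)
    show "(\<lambda>n. \<bar>e n\<bar> * B) summable_on UNIV" by (intro summable_on_cmult_left summable_abs_e)
    show "0 \<le> w powi A * trunc A" for A using assms by simp
    show "norm (H A n) \<le> (w powi A * trunc A) * (\<bar>e n\<bar> * B)" for A n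
      using assms unfolding H_def by (simp add: abs_mult mult_left_mono B)
  qed
  then have "(\<Sum>\<^sub>\<infinity>L. \<Sum>\<^sub>\<infinity>n. G L n) = (\<Sum>\<^sub>\<infinity>A. \<Sum>\<^sub>\<infinity>n. H A n)"
    using Fubini_infsum_shear[of G "\<lambda>n. - int n"] by (simp only: GH)
  also have "\<dots> = (\<Sum>\<^sub>\<infinity>A. (w powi A * trunc A) * (\<Sum>\<^sub>\<infinity>k. e k * w ^ k * (if A + m + int k = 1 then qpoch_inf p p else 0)))"
    unfolding H_def infsum_cmult_right' qJ_qexp_convolution[OF w] ..
  also have "\<dots> = (\<Sum>\<^sub>\<infinity>A. \<Sum>\<^sub>\<infinity>k. (w powi A * trunc A) * (e k * w ^ k * (if A + m + int k = 1 then qpoch_inf p p else 0)))"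
    unfolding infsum_cmult_right' ..
  also have "\<dots> = (\<Sum>\<^sub>\<infinity>k. \<Sum>\<^sub>\<infinity>A. (w powi A * trunc A) * (e k * w ^ k * (if A + m + int k = 1 then qpoch_inf p p else 0)))"
  proof (rule Fubini_infsum, rule double_summable_product)
    show "(\<lambda>A. w powi A * trunc A) summable_on UNIV" by (intro trunc_summable assms)
    show "(\<lambda>k. \<bar>e k\<bar> * w ^ k) summable_on UNIV" by (intro summable_on_abs_qexp w)
    show "0 \<le> w powi A * trunc A" for A using assms by simp
    show "norm ((w powi A * trunc A) * (e k * w ^ k * (if A + m + int k = 1 then qpoch_inf p p else 0)))
        \<le> (w powi A * trunc A) * (\<bar>e k\<bar> * w ^ k)" for A k
      using assms w qpoch_inf_bounds[of p]
      by (auto simp: abs_mult intro!: mult_left_mono mult_left_le)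
  qed
  also have "\<dots> = (\<Sum>\<^sub>\<infinity>k. qpoch_inf p p * w powi (1 - m) * (e k * trunc (1 - m - int k)))"
  proof (rule infsum_cong)
    fix k :: nat
    have "(\<Sum>\<^sub>\<infinity>A. (w powi A * trunc A) * (e k * w ^ k * (if A + m + int k = 1 then qpoch_inf p p else 0)))
        = (\<Sum>\<^sub>\<infinity>A\<in>{1 - m - int k}. (w powi A * trunc A) * (e k * w ^ k * qpoch_inf p p))"
      by (intro infsum_cong_neutral) auto
    also have "\<dots> = qpoch_inf p p * w powi (1 - m) * (e k * trunc (1 - m - int k))"
      using assms by (simp add: power_int_diff)
    finally show "(\<Sum>\<^sub>\<infinity>A. (w powi A * trunc A) * (e k * w ^ k * (if A + m + int k = 1 then qpoch_inf p p else 0)))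
        = qpoch_inf p p * w powi (1 - m) * (e k * trunc (1 - m - int k))" .
  qed
  also have "\<dots> = (if m = 0 then w * (qpoch_inf p p)\<^sup>2 else 0)"
    unfolding infsum_cmult_right' trunc_qexp_delta by (simp add: power2_eq_square)
  finally show ?thesis by (simp only: G1)
qed

theorem qJ_orthogonal:
  assumes "0 < w" "w < 1"
  shows "(\<Sum>\<^sub>\<infinity>L. w powi L * qJ p w (p powi (L + M)) * qJ p w (p powi (L + N)))
    = (if M = N then w powi (1 - N) * (qpoch_inf p p)\<^sup>2 else 0)"
proof -
  have "(\<Sum>\<^sub>\<infinity>L. w powi L * qJ p w (p powi (L + M)) * qJ p w (p powi (L + N)))
      = (\<Sum>\<^sub>\<infinity>L. w powi (L + - N) * qJ p w (p powi (L + - N + M)) * qJ p w (p powi (L + - N + N)))"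
    by (rule infsum_int_shift[symmetric])
  also have "\<dots> = (\<Sum>\<^sub>\<infinity>L. w powi (- N) * (w powi L * qJ p w (p powi (L + (M - N))) * qJ p w (p powi L)))"
    using assms by (intro infsum_cong) (simp add: power_int_diff power_int_minus divide_inverse algebra_simps)
  also have "\<dots> = w powi (- N) * (if M - N = 0 then w * (qpoch_inf p p)\<^sup>2 else 0)"
    unfolding infsum_cmult_right' qJ_orthogonal_shift[OF assms] ..
  also have "\<dots> = (if M = N then w powi (1 - N) * (qpoch_inf p p)\<^sup>2 else 0)"
    using assms by (simp add: power_int_diff power_int_minus divide_inverse)
  finally show ?thesis .
qed

end

section \<open>The lattice Hankel transform\<close>

text \<open>A function on the lattice of the points \<open>p powi N\<close> is represented by its sequence of values; the
  square root of \<open>p\<close> plays the role of \<open>q\<close>, and \<open>w\<close> that of \<open>q powr (2 * \<beta> + 2)\<close>.\<close>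

definition qH :: "real \<Rightarrow> real \<Rightarrow> (int \<Rightarrow> complex) \<Rightarrow> real \<Rightarrow> complex" where
  "qH p w f Z = (\<Sum>\<^sub>\<infinity>N. (w powi N * qJ p w (p powi N * Z)) *\<^sub>R f N)"

definition wsummable :: "real \<Rightarrow> (int \<Rightarrow> complex) \<Rightarrow> bool" where
  "wsummable w f \<longleftrightarrow> (\<lambda>N. w powi N * norm (f N)) summable_on UNIV"

text \<open>The transforms \<open>q_RL\<close> and \<open>q_Weyl\<close> on the lattice, without their normalising constants.  The
  parameters \<open>w\<close> and \<open>w * r\<close> belong to the cosine transform and to the Bessel transform.\<close>

definition RL_seq :: "real \<Rightarrow> real \<Rightarrow> real \<Rightarrow> (int \<Rightarrow> complex) \<Rightarrow> int \<Rightarrow> complex" where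
  "RL_seq p w r f N = (\<Sum>\<^sub>\<infinity>n. (qbinom_coeff p r n * w ^ n) *\<^sub>R f (N + int n))"

definition Weyl_seq :: "real \<Rightarrow> real \<Rightarrow> (int \<Rightarrow> complex) \<Rightarrow> int \<Rightarrow> complex" where
  "Weyl_seq p r f N = (\<Sum>\<^sub>\<infinity>n. (qbinom_coeff p r n * r powi (N - int n)) *\<^sub>R f (N - int n))"

lemma wsummable_shift:
  assumes "0 < w"
  shows "wsummable w (\<lambda>N. f (N + k)) \<longleftrightarrow> wsummable w f"
proof -
  have "wsummable w (\<lambda>N. f (N + k)) \<longleftrightarrow> (\<lambda>N. w powi k * (w powi N * norm (f (N + k)))) summable_on UNIV"
    using assms unfolding wsummable_def by (subst summable_on_cmult_right') auto
  also have "\<dots> \<longleftrightarrow> (\<lambda>N. w powi (N + k) * norm (f (N + k))) summable_on UNIV"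
    using assms by (simp add: power_int_add mult_ac)
  also have "\<dots> \<longleftrightarrow> wsummable w f"
    unfolding wsummable_def by (rule summable_on_int_shift)
  finally show ?thesis .
qed

lemma wsummable_comparison:
  assumes "wsummable w f" "0 < w" "\<And>N. norm (g N) \<le> C * norm (f N)"
  shows "wsummable w g"
  unfolding wsummable_def
proof (rule summable_on_comparison_test)
  show "(\<lambda>N. C * (w powi N * norm (f N))) summable_on UNIV"
    using assms(1) unfolding wsummable_def by (rule summable_on_cmult_right)
  show "w powi N * norm (g N) \<le> C * (w powi N * norm (f N))" for N
    using mult_left_mono[OF assms(3)[of N], of "w powi N"] assms(2) by (simp add: mult_ac)
qed (use assms in auto)

context q_base
begin

lemma Rq_pos0_powi_mult: "Z \<in> Rq_pos0 p \<Longrightarrow> p powi N * Z \<in> Rq_pos0 p"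
  by (auto simp: Rq_pos0_def Rq_pos_def power_int_add[symmetric])

lemma Rq_pos0_mult_pow: "Z \<in> Rq_pos0 p \<Longrightarrow> Z * p ^ n \<in> Rq_pos0 p"
  using Rq_pos0_powi_mult[of Z "int n"] by (simp add: mult.commute)

lemma powi_Rq_pos0 [simp]: "p powi N \<in> Rq_pos0 p" and zero_Rq_pos0 [simp]: "0 \<in> Rq_pos0 p"
  by (auto simp: Rq_pos0_def Rq_pos_def)

definition qJ_bound :: "real \<Rightarrow> real" where "qJ_bound w = (\<Sum>\<^sub>\<infinity>k. \<bar>e k\<bar> * w ^ k)"

lemma qJ_le: "\<lbrakk>0 < w; w < 1; Z \<in> Rq_pos0 p\<rbrakk> \<Longrightarrow> \<bar>qJ p w Z\<bar> \<le> qJ_bound w"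
  unfolding qJ_bound_def by (intro qJ_bounded) auto

lemma qJ_le_lattice [simp]: "\<lbrakk>0 < w; w < 1; Z \<in> Rq_pos0 p\<rbrakk> \<Longrightarrow> \<bar>qJ p w (p powi N * Z)\<bar> \<le> qJ_bound w"
  by (intro qJ_le Rq_pos0_powi_mult)

lemma qJ_bound_nonneg [simp]: "0 < w \<Longrightarrow> 0 \<le> qJ_bound w"
  unfolding qJ_bound_def by (intro infsum_nonneg) simp

lemma qH_term_bound:
  assumes "0 < w" "w < 1" "Z \<in> Rq_pos0 p"
  shows "norm ((w powi N * qJ p w (p powi N * Z)) *\<^sub>R f N) \<le> qJ_bound w * (w powi N * norm (f N))"
proof -
  have "\<bar>qJ p w (p powi N * Z)\<bar> * (w powi N * norm (f N)) \<le> qJ_bound w * (w powi N * norm (f N))"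
    using assms by (intro mult_right_mono) auto
  then show ?thesis using assms by (simp add: abs_mult mult_ac)
qed

lemma qH_abs_summable:
  assumes "0 < w" "w < 1" "Z \<in> Rq_pos0 p" "wsummable w f"
  shows "(\<lambda>N. norm ((w powi N * qJ p w (p powi N * Z)) *\<^sub>R f N)) summable_on UNIV"
    "(\<lambda>N. (w powi N * qJ p w (p powi N * Z)) *\<^sub>R f N) summable_on UNIV"
proof -
  show *: "(\<lambda>N. norm ((w powi N * qJ p w (p powi N * Z)) *\<^sub>R f N)) summable_on UNIV"
  proof (rule summable_on_comparison_test)
    show "(\<lambda>N. qJ_bound w * (w powi N * norm (f N))) summable_on UNIV"
      using assms(4) unfolding wsummable_def by (rule summable_on_cmult_right)
  qed (use qH_term_bound[OF assms(1-3)] in auto)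
  then show "(\<lambda>N. (w powi N * qJ p w (p powi N * Z)) *\<^sub>R f N) summable_on UNIV"
    by (rule abs_summable_summable)
qed

lemma qH_bounded:
  assumes "0 < w" "w < 1" "Z \<in> Rq_pos0 p" "wsummable w f"
  shows "norm (qH p w f Z) \<le> qJ_bound w * (\<Sum>\<^sub>\<infinity>N. w powi N * norm (f N))"
proof -
  note s = qH_abs_summable[OF assms]
  have "norm (qH p w f Z) \<le> (\<Sum>\<^sub>\<infinity>N. norm ((w powi N * qJ p w (p powi N * Z)) *\<^sub>R f N))"
    unfolding qH_def by (rule norm_infsum_bound[OF s(1)])
  also have "\<dots> \<le> (\<Sum>\<^sub>\<infinity>N. qJ_bound w * (w powi N * norm (f N)))"
    using assms(4) unfolding wsummable_def
    by (intro infsum_mono s summable_on_cmult_right qH_term_bound assms)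
  finally show ?thesis by (simp add: infsum_cmult_right')
qed

lemma qH_shift:
  assumes "0 < w"
  shows "qH p w (\<lambda>N. f (N + k)) Z = w powi (- k) *\<^sub>R qH p w f (p powi (- k) * Z)"
proof -
  have "qH p w f (p powi (- k) * Z) = (\<Sum>\<^sub>\<infinity>N. (w powi (N + k) * qJ p w (p powi (N + k) * (p powi (- k) * Z))) *\<^sub>R f (N + k))"
    unfolding qH_def by (rule infsum_int_shift[symmetric])
  also have "\<dots> = (\<Sum>\<^sub>\<infinity>N. w powi k *\<^sub>R ((w powi N * qJ p w (p powi N * Z)) *\<^sub>R f (N + k)))"
    using assms by (intro infsum_cong) (simp add: power_int_add power_int_minus mult_ac)
  also have "\<dots> = w powi k *\<^sub>R qH p w (\<lambda>N. f (N + k)) Z"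
    unfolding qH_def by (rule infsum_scaleR_right)
  finally show ?thesis using assms by (simp add: power_int_minus)
qed

text \<open>The kernel is symmetric in its two lattice indices.\<close>

theorem qH_selfadjoint:
  assumes "0 < w" "w < 1" "Z \<in> Rq_pos0 p" "wsummable w f" "wsummable w k"
  shows "(\<Sum>\<^sub>\<infinity>N. w powi N *\<^sub>R (f N * qH p w k (p powi N * Z)))
    = (\<Sum>\<^sub>\<infinity>L. w powi L *\<^sub>R (k L * qH p w f (p powi L * Z)))"
proof -
  define F where "F N L = (w powi N *\<^sub>R f N) * ((w powi L * qJ p w (p powi L * (p powi N * Z))) *\<^sub>R k L)" for N L
  have F1: "(\<Sum>\<^sub>\<infinity>L. F N L) = w powi N *\<^sub>R (f N * qH p w k (p powi N * Z))" for N
    unfolding F_def infsum_cmult_right' by (simp add: qH_def)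
  have F2: "(\<Sum>\<^sub>\<infinity>N. F N L) = w powi L *\<^sub>R (k L * qH p w f (p powi L * Z))" for L
  proof -
    have "F N L = (w powi L *\<^sub>R k L) * ((w powi N * qJ p w (p powi N * (p powi L * Z))) *\<^sub>R f N)" for N
      by (simp add: F_def mult_ac)
    then have "(\<Sum>\<^sub>\<infinity>N. F N L) = (w powi L *\<^sub>R k L) * qH p w f (p powi L * Z)"
      by (simp only: infsum_cmult_right' qH_def)
    then show ?thesis by simp
  qed
  have "double_summable F"
  proof (rule double_summable_product)
    show "(\<lambda>N. w powi N * norm (f N)) summable_on UNIV" "(\<lambda>L. qJ_bound w * (w powi L * norm (k L))) summable_on UNIV"
      using assms(4,5) unfolding wsummable_def by (auto intro: summable_on_cmult_right)
    show "0 \<le> w powi N * norm (f N)" for N using assms by simp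
    show "norm (F N L) \<le> (w powi N * norm (f N)) * (qJ_bound w * (w powi L * norm (k L)))" for N L
      using assms qH_term_bound[OF assms(1,2) Rq_pos0_powi_mult[OF assms(3)], of L N k] unfolding F_def norm_mult[of "w powi N *\<^sub>R f N"]
      by (intro mult_mono) (auto simp: abs_mult)
  qed
  from Fubini_infsum[OF this] show ?thesis by (simp only: F1 F2)
qed

lemma wsummable_qJ:
  assumes "0 < w" "w < 1"
  shows "wsummable w (\<lambda>L. complex_of_real (qJ p w (p powi (L + M))))"
  using qJ_lattice_summable[of w w] assms
    wsummable_shift[of w "\<lambda>L. complex_of_real (qJ p w (p powi L))" M]
  by (simp add: wsummable_def)

text \<open>Selfadjointness moves the outer transform onto a lattice translate of the kernel, whose transform is
  a point mass by orthogonality.\<close>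

theorem qH_inversion:
  assumes "0 < w" "w < 1" "wsummable w f"
  shows "qH p w (\<lambda>L. qH p w f (p powi L)) (p powi M) = (w * (qpoch_inf p p)\<^sup>2) *\<^sub>R f M"
proof -
  define k where "k L = complex_of_real (qJ p w (p powi (L + M)))" for L
  have k: "wsummable w k" unfolding k_def by (rule wsummable_qJ[OF assms(1,2)])
  have Hk: "qH p w k (p powi N) = complex_of_real (if N = M then w powi (1 - M) * (qpoch_inf p p)\<^sup>2 else 0)" for N
  proof -
    have "qH p w k (p powi N) = (\<Sum>\<^sub>\<infinity>L. complex_of_real (w powi L * qJ p w (p powi (L + N)) * qJ p w (p powi (L + M))))"
      unfolding qH_def k_def by (intro infsum_cong) (simp add: scaleR_conv_of_real power_int_add)
    then show ?thesis by (simp only: infsum_complex_of_real qJ_orthogonal[OF assms(1,2)])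
  qed
  have "qH p w (\<lambda>L. qH p w f (p powi L)) (p powi M) = (\<Sum>\<^sub>\<infinity>L. w powi L *\<^sub>R (k L * qH p w f (p powi L * 1)))"
    unfolding qH_def[of p w "\<lambda>L. qH p w f (p powi L)"] k_def
    by (intro infsum_cong) (simp add: scaleR_conv_of_real power_int_add)
  also have "\<dots> = (\<Sum>\<^sub>\<infinity>N. w powi N *\<^sub>R (f N * qH p w k (p powi N * 1)))"
    using powi_Rq_pos0[of 0] assms k by (intro qH_selfadjoint[symmetric]) auto
  also have "\<dots> = (\<Sum>\<^sub>\<infinity>N\<in>{M}. w powi N *\<^sub>R (f N * complex_of_real (w powi (1 - M) * (qpoch_inf p p)\<^sup>2)))"
    by (intro infsum_cong_neutral) (auto simp: Hk)
  also have "\<dots> = (w * (qpoch_inf p p)\<^sup>2) *\<^sub>R f M"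
    using assms by (simp add: scaleR_conv_of_real power_int_diff)
  finally show ?thesis .
qed

section \<open>Transmutation of Hankel transforms\<close>

lemma qbinom_pow_summable:
  "\<lbrakk>0 < w; w < 1; 0 \<le> r; r \<le> 1\<rbrakk> \<Longrightarrow> (\<lambda>n. qbinom_coeff p r n * w ^ n) summable_on UNIV"
  using qbinom_has_sum[of r w] summable_on_def by auto

text \<open>The contraction acts on the kernel only.  Written with the weight of the new order, the density
  acquires the factor \<open>r powi (- L)\<close>.\<close>

theorem RL_qH:
  assumes "0 < w" "w < 1" "0 < r" "r < 1" "wsummable w u" "Z \<in> Rq_pos0 p"
  shows "(\<Sum>\<^sub>\<infinity>n. (qbinom_coeff p r n * w ^ n) *\<^sub>R qH p w u (Z * p ^ n))
    = qH p (w * r) (\<lambda>L. r powi (- L) *\<^sub>R u L) Z"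
proof -
  define F where "F n L = (qbinom_coeff p r n * w ^ n) *\<^sub>R ((w powi L * qJ p w (p powi L * (Z * p ^ n))) *\<^sub>R u L)" for n L
  have c0: "0 \<le> qbinom_coeff p r n" for n using qbinom_coeff_bounds assms by auto
  have F1: "(\<Sum>\<^sub>\<infinity>L. F n L) = (qbinom_coeff p r n * w ^ n) *\<^sub>R qH p w u (Z * p ^ n)" for n
    unfolding F_def infsum_scaleR_right qH_def ..
  have F2: "(\<Sum>\<^sub>\<infinity>n. F n L) = ((w * r) powi L * qJ p (w * r) (p powi L * Z)) *\<^sub>R (r powi (- L) *\<^sub>R u L)" for L
  proof -
    have "F n L = (qbinom_coeff p r n * w ^ n * qJ p w (p powi L * Z * p ^ n)) *\<^sub>R (w powi L *\<^sub>R u L)" for n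
      by (simp add: F_def mult_ac)
    then have "(\<Sum>\<^sub>\<infinity>n. F n L) = qJ p (w * r) (p powi L * Z) *\<^sub>R (w powi L *\<^sub>R u L)"
      using assms by (simp only: infsum_scaleR_left_complex qJ_sonine_contract less_imp_le)
    then show ?thesis using assms by (simp add: power_int_mult_distrib power_int_minus)
  qed
  have "double_summable F"
  proof (rule double_summable_product)
    show "(\<lambda>n. qbinom_coeff p r n * w ^ n) summable_on UNIV" using assms by (intro qbinom_pow_summable) auto
    show "(\<lambda>L. qJ_bound w * (w powi L * norm (u L))) summable_on UNIV"
      using assms(5) unfolding wsummable_def by (rule summable_on_cmult_right)
    show "0 \<le> qbinom_coeff p r n * w ^ n" for n using assms c0 by simp
    show "norm (F n L) \<le> (qbinom_coeff p r n * w ^ n) * (qJ_bound w * (w powi L * norm (u L)))" for n L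
      using assms c0[of n] qH_term_bound[OF assms(1,2) Rq_pos0_mult_pow[OF assms(6)], of L n u]
      unfolding F_def norm_scaleR[of "qbinom_coeff p r n * w ^ n"]
      by (intro mult_mono) (auto simp: abs_mult)
  qed
  from Fubini_infsum[OF this] show ?thesis by (simp add: F1 F2 qH_def[of p "w * r"])
qed

lemma qJ_weighted_summable:
  assumes "0 < w" "w < 1" "0 < r" "r < 1"
  shows "(\<lambda>m. r powi m * \<bar>qJ p (w * r) (p powi m)\<bar>) summable_on UNIV"
  using assms mult_le_one[of w r] by (intro qJ_lattice_summable) auto

lemma qJ_section_bound:
  assumes "0 < w" "w < 1" "0 < r" "r < 1"
  defines "D \<equiv> (1 / qpoch_inf p p) * (\<Sum>\<^sub>\<infinity>m. r powi m * \<bar>qJ p (w * r) (p powi m)\<bar>)"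
  shows "(\<lambda>n. qbinom_coeff p r n * (r powi (M - int n) * \<bar>qJ p (w * r) (p powi (M - int n))\<bar>)) summable_on UNIV"
    "(\<Sum>\<^sub>\<infinity>n. qbinom_coeff p r n * (r powi (M - int n) * \<bar>qJ p (w * r) (p powi (M - int n))\<bar>)) \<le> D"
  unfolding D_def using assms
  by (intro qbinom_section_bound[OF qJ_weighted_summable[OF assms(1-4)]]; simp)+

theorem Weyl_qH:
  assumes "0 < w" "w < 1" "0 < r" "r < 1" "wsummable w u"
  shows "Weyl_seq p r (\<lambda>N. qH p (w * r) u (p powi N)) N = r *\<^sub>R qH p w u (p powi N)"
proof -
  define F where "F L n = (qbinom_coeff p r n * r powi (N - int n)) *\<^sub>R
    (((w * r) powi L * qJ p (w * r) (p powi L * p powi (N - int n))) *\<^sub>R u L)" for L n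
  have c0: "0 \<le> qbinom_coeff p r n" for n using qbinom_coeff_bounds assms by auto
  have F1: "(\<Sum>\<^sub>\<infinity>L. F L n) = (qbinom_coeff p r n * r powi (N - int n)) *\<^sub>R qH p (w * r) u (p powi (N - int n))" for n
    unfolding F_def infsum_scaleR_right qH_def ..
  have F_eq: "F L n = (qbinom_coeff p r n * (r powi (N + L - int n) * qJ p (w * r) (p powi (N + L - int n)))) *\<^sub>R
    (w powi L *\<^sub>R u L)" for L n
  proof -
    have "r powi (N + L - int n) = r powi (N - int n) * r powi L"
      using assms by (simp add: power_int_diff power_int_add)
    moreover have "p powi (N + L - int n) = p powi L * p powi (N - int n)"
      by (simp add: power_int_diff power_int_add)
    ultimately show ?thesis
      unfolding F_def by (simp only: power_int_mult_distrib scaleR_scaleR mult_ac)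
  qed
  have F2: "(\<Sum>\<^sub>\<infinity>n. F L n) = r *\<^sub>R ((w powi L * qJ p w (p powi L * p powi N)) *\<^sub>R u L)" for L
    unfolding F_eq infsum_scaleR_left_complex
    using assms qJ_sonine_dilate[of w r "N + L"] by (simp add: power_int_add mult_ac)
  note b = qJ_section_bound[OF assms(1-4), of "N + L" for L]
  define D where "D = (1 / qpoch_inf p p) * (\<Sum>\<^sub>\<infinity>m. r powi m * \<bar>qJ p (w * r) (p powi m)\<bar>)"
  have "double_summable F"
  proof (rule double_summable_bound)
    show "(\<lambda>L. w powi L * norm (u L)) summable_on UNIV" "0 \<le> w powi L * norm (u L)" for L
      using assms unfolding wsummable_def by auto
    show "(\<lambda>n. qbinom_coeff p r n * (r powi (N + L - int n) * \<bar>qJ p (w * r) (p powi (N + L - int n))\<bar>)) summable_on UNIV"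
      "(\<Sum>\<^sub>\<infinity>n. qbinom_coeff p r n * (r powi (N + L - int n) * \<bar>qJ p (w * r) (p powi (N + L - int n))\<bar>)) \<le> D" for L
      unfolding D_def by (rule b)+
    show "norm (F L n) \<le> (w powi L * norm (u L)) * (qbinom_coeff p r n * (r powi (N + L - int n) * \<bar>qJ p (w * r) (p powi (N + L - int n))\<bar>))" for L n
      unfolding F_eq using assms c0[of n] by (simp add: abs_mult mult_ac)
  qed
  from Fubini_infsum[OF this]
  have "(\<Sum>\<^sub>\<infinity>n. (qbinom_coeff p r n * r powi (N - int n)) *\<^sub>R qH p (w * r) u (p powi (N - int n)))
      = r *\<^sub>R (\<Sum>\<^sub>\<infinity>L. (w powi L * qJ p w (p powi L * p powi N)) *\<^sub>R u L)"
    by (simp only: F1 F2 infsum_scaleR_right)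
  then show ?thesis by (simp add: Weyl_seq_def qH_def[of p w])
qed

theorem Weyl_qH_at_0:
  assumes "0 < w" "w < 1" "0 < r" "r < 1" "wsummable w u"
  shows "(\<Sum>\<^sub>\<infinity>N. r powi N *\<^sub>R qH p (w * r) u (p powi N)) = (r * qpoch_inf p p / qpoch_inf r p) *\<^sub>R qH p w u 0"
proof -
  define g where "g m = r powi m * qJ p (w * r) (p powi m)" for m
  define F where "F L N = r powi N *\<^sub>R (((w * r) powi L * qJ p (w * r) (p powi L * p powi N)) *\<^sub>R u L)" for L N
  have F1: "(\<Sum>\<^sub>\<infinity>L. F L N) = r powi N *\<^sub>R qH p (w * r) u (p powi N)" for N
    unfolding F_def infsum_scaleR_right qH_def ..
  have F_eq: "F L N = g (N + L) *\<^sub>R (w powi L *\<^sub>R u L)" for L N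
    using assms by (simp add: F_def g_def power_int_add power_int_mult_distrib mult_ac)
  have F2: "(\<Sum>\<^sub>\<infinity>N. F L N) = (r * qpoch_inf p p / qpoch_inf r p) *\<^sub>R ((w powi L * qJ p w (p powi L * 0)) *\<^sub>R u L)" for L
    unfolding F_eq infsum_scaleR_left_complex infsum_int_shift
    using assms unfolding g_def by (subst qJ_mellin) (auto simp: qJ_0)
  have g: "(\<lambda>m. norm (g m)) summable_on UNIV"
    using qJ_weighted_summable[OF assms(1-4)] assms by (simp add: g_def abs_mult)
  have "double_summable F"
  proof (rule double_summable_bound)
    show "(\<lambda>L. w powi L * norm (u L)) summable_on UNIV" "0 \<le> w powi L * norm (u L)" for L
      using assms unfolding wsummable_def by auto
    show "(\<lambda>N. norm (g (N + L))) summable_on UNIV" "(\<Sum>\<^sub>\<infinity>N. norm (g (N + L))) \<le> (\<Sum>\<^sub>\<infinity>m. norm (g m))" for L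
      using g by (simp_all add: summable_on_int_shift[of "\<lambda>m. \<bar>g m\<bar>"] infsum_int_shift[of "\<lambda>m. \<bar>g m\<bar>"])
    show "norm (F L N) \<le> (w powi L * norm (u L)) * norm (g (N + L))" for L N
      unfolding F_eq using assms by (simp add: abs_mult mult_ac)
  qed
  from Fubini_infsum[OF this] show ?thesis
    by (simp only: F1 F2 infsum_scaleR_right qH_def[of p w])
qed

text \<open>The substitution \<open>M = N - n\<close> moves the dilations from \<open>g\<close> to the kernel, where they form the
  contracting Sonine sum: the two transforms are adjoint to each other.\<close>

theorem qH_Weyl:
  assumes "0 < w" "w < 1" "0 < r" "r < 1" "wsummable (w * r) g" "Z \<in> Rq_pos0 p"
  shows "qH p w (Weyl_seq p r g) Z = qH p (w * r) g Z"
proof -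
  define G where "G N n = (w powi N * qJ p w (p powi N * Z)) *\<^sub>R ((qbinom_coeff p r n * r powi (N - int n)) *\<^sub>R g (N - int n))" for N n
  have c0: "0 \<le> qbinom_coeff p r n" for n using qbinom_coeff_bounds assms by auto
  have G1: "(\<Sum>\<^sub>\<infinity>n. G N n) = (w powi N * qJ p w (p powi N * Z)) *\<^sub>R Weyl_seq p r g N" for N
    unfolding G_def infsum_scaleR_right Weyl_seq_def ..
  have G_eq: "G (M + int n) n = (qbinom_coeff p r n * w ^ n * qJ p w (p powi M * Z * p ^ n)) *\<^sub>R ((w * r) powi M *\<^sub>R g M)" for M n
    using assms by (simp add: G_def power_int_add power_int_mult_distrib mult_ac)
  have G2: "(\<Sum>\<^sub>\<infinity>n. G (M + int n) n) = ((w * r) powi M * qJ p (w * r) (p powi M * Z)) *\<^sub>R g M" for M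
    unfolding G_eq infsum_scaleR_left_complex using assms by (subst qJ_sonine_contract) (auto simp: mult_ac)
  have "double_summable (\<lambda>M n. G (M + int n) n)"
  proof (rule double_summable_product)
    show "(\<lambda>M. (w * r) powi M * norm (g M)) summable_on UNIV" using assms(5) by (simp add: wsummable_def)
    show "(\<lambda>n. qbinom_coeff p r n * w ^ n * qJ_bound w) summable_on UNIV"
      using assms by (intro summable_on_cmult_left qbinom_pow_summable) auto
    show "0 \<le> (w * r) powi M * norm (g M)" for M using assms by simp
    show "norm (G (M + int n) n) \<le> ((w * r) powi M * norm (g M)) * (qbinom_coeff p r n * w ^ n * qJ_bound w)" for M n
    proof -
      have "\<bar>qJ p w (p powi M * (Z * p ^ n))\<bar> \<le> qJ_bound w"
        using assms Rq_pos0_mult_pow by simp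
      then have "(qbinom_coeff p r n * w ^ n) * \<bar>qJ p w (p powi M * Z * p ^ n)\<bar> * ((w * r) powi M * norm (g M))
          \<le> (qbinom_coeff p r n * w ^ n) * qJ_bound w * ((w * r) powi M * norm (g M))"
        using assms c0[of n] by (intro mult_right_mono mult_left_mono) (auto simp: mult.assoc)
      then show ?thesis using assms c0[of n] unfolding G_eq by (simp add: abs_mult mult_ac)
    qed
  qed
  from Fubini_infsum_shear[OF this] show ?thesis
    by (simp only: G1 G2 qH_def[of p])
qed

text \<open>The same adjointness, with the dilating Sonine sum acting on the kernel.\<close>

theorem qH_RL:
  assumes "0 < w" "w < 1" "0 < r" "r < 1" "wsummable w f"
  shows "qH p (w * r) (RL_seq p w r f) (p powi L) = r powi (1 - L) *\<^sub>R qH p w f (p powi L)"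
proof -
  define G where "G N n = ((w * r) powi N * qJ p (w * r) (p powi N * p powi L)) *\<^sub>R ((qbinom_coeff p r n * w ^ n) *\<^sub>R f (N + int n))" for N n
  have c0: "0 \<le> qbinom_coeff p r n" for n using qbinom_coeff_bounds assms by auto
  have G1: "(\<Sum>\<^sub>\<infinity>n. G N n) = ((w * r) powi N * qJ p (w * r) (p powi N * p powi L)) *\<^sub>R RL_seq p w r f N" for N
    unfolding G_def infsum_scaleR_right RL_seq_def ..
  have G_eq: "G (M + - int n) n = (qbinom_coeff p r n * (r powi (M + L - int n) * qJ p (w * r) (p powi (M + L - int n))))
     *\<^sub>R (r powi (- L) *\<^sub>R w powi M *\<^sub>R f M)" for M n
    using assms by (simp add: G_def power_int_add power_int_diff power_int_mult_distrib power_int_minus field_simps)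
  have G2: "(\<Sum>\<^sub>\<infinity>n. G (M + - int n) n) = r powi (1 - L) *\<^sub>R ((w powi M * qJ p w (p powi M * p powi L)) *\<^sub>R f M)" for M
    unfolding G_eq infsum_scaleR_left_complex using assms qJ_sonine_dilate[of w r "M + L"]
    by (simp add: power_int_add power_int_diff power_int_minus field_simps)
  note b = qJ_section_bound[OF assms(1-4), of "M + L" for M]
  define D where "D = (1 / qpoch_inf p p) * (\<Sum>\<^sub>\<infinity>m. r powi m * \<bar>qJ p (w * r) (p powi m)\<bar>)"
  have "double_summable (\<lambda>M n. G (M + - int n) n)"
  proof (rule double_summable_bound)
    show "(\<lambda>M. r powi (- L) * (w powi M * norm (f M))) summable_on UNIV" "0 \<le> r powi (- L) * (w powi M * norm (f M))" for M
      using assms unfolding wsummable_def by (auto intro: summable_on_cmult_right)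
    show "(\<lambda>n. qbinom_coeff p r n * (r powi (M + L - int n) * \<bar>qJ p (w * r) (p powi (M + L - int n))\<bar>)) summable_on UNIV"
      "(\<Sum>\<^sub>\<infinity>n. qbinom_coeff p r n * (r powi (M + L - int n) * \<bar>qJ p (w * r) (p powi (M + L - int n))\<bar>)) \<le> D" for M
      unfolding D_def by (rule b)+
    show "norm (G (M + - int n) n) \<le> (r powi (- L) * (w powi M * norm (f M))) * (qbinom_coeff p r n * (r powi (M + L - int n) * \<bar>qJ p (w * r) (p powi (M + L - int n))\<bar>))" for M n
      unfolding G_eq using assms c0[of n] by (simp add: abs_mult mult_ac)
  qed
  from Fubini_infsum_shear[OF this] show ?thesis
    by (simp only: G1 G2 qH_def[of p] infsum_scaleR_right)
qed

end

section \<open>Rapidly decreasing lattice functions\<close>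

text \<open>If \<open>f N\<close> is the value at \<open>x\<close> and \<open>x\<^sup>2 = p powi N\<close>, then this is the difference of the values at \<open>x\<close> and
  at the next lattice point, divided by \<open>x\<^sup>2\<close>; unlike division by \<open>x\<close> it respects expansions in even
  powers.\<close>

definition qE :: "real \<Rightarrow> (int \<Rightarrow> complex) \<Rightarrow> int \<Rightarrow> complex" where
  "qE p f N = p powi (- N) *\<^sub>R (f N - f (N + 1))"

text \<open>The weight \<open>1 + p powi N\<close> is \<open>1 + x\<^sup>2\<close> at the lattice point \<open>x\<close>.\<close>

definition schwartz_seq :: "real \<Rightarrow> (int \<Rightarrow> complex) \<Rightarrow> bool" where
  "schwartz_seq p f \<longleftrightarrow> (\<forall>k m. \<exists>C. \<forall>N. (1 + p powi N) ^ m * norm ((qE p ^^ k) f N) \<le> C)"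

text \<open>The exponent may be negative, which means rapid decay at infinity; nonnegative exponents mean that
  \<open>f\<close> vanishes to infinite order at \<open>0\<close>.\<close>

definition flat_seq :: "real \<Rightarrow> (int \<Rightarrow> complex) \<Rightarrow> bool" where
  "flat_seq p f \<longleftrightarrow> (\<forall>m::int. \<exists>C. \<forall>N. norm (f N) \<le> C * (p powi N) powi m)"

definition moments_vanish :: "real \<Rightarrow> real \<Rightarrow> (int \<Rightarrow> complex) \<Rightarrow> bool" where
  "moments_vanish p w f \<longleftrightarrow> (\<forall>n. (\<Sum>\<^sub>\<infinity>N. (w * p ^ n) powi N *\<^sub>R f N) = 0)"

lemma has_sum_minus:
  fixes f g :: "'a \<Rightarrow> 'b::real_normed_vector"
  assumes "(f has_sum a) A" "(g has_sum b) A"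
  shows "((\<lambda>x. f x - g x) has_sum (a - b)) A"
  using has_sum_add[OF assms(1), of "\<lambda>x. - g x" "- b"] assms(2) by (simp add: has_sum_uminus)

lemma has_sum_finite_sum:
  fixes f :: "nat \<Rightarrow> 'a \<Rightarrow> 'b::real_normed_vector"
  assumes "\<And>n. n < k \<Longrightarrow> (f n has_sum s n) A"
  shows "((\<lambda>x. \<Sum>n<k. f n x) has_sum (\<Sum>n<k. s n)) A"
  using assms by (induction k) (auto intro!: has_sum_add)

lemma summable_on_geometric_int:
  fixes t :: real
  assumes "0 < t" "t < 1"
  shows "(\<lambda>N::int. t ^ nat \<bar>N\<bar>) summable_on UNIV"
proof -
  have g: "(\<lambda>n. t ^ n) summable_on UNIV"
    using assms by (subst summable_on_UNIV_nonneg_real_iff) (auto intro: summable_geometric)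
  have "(\<lambda>N::int. t ^ nat \<bar>N\<bar>) summable_on range int"
    using g by (subst summable_on_reindex) (auto simp: o_def)
  moreover have "(\<lambda>N::int. t ^ nat \<bar>N\<bar>) summable_on range (\<lambda>n. - int n)"
    using g by (subst summable_on_reindex) (auto simp: o_def inj_on_def)
  ultimately have "(\<lambda>N::int. t ^ nat \<bar>N\<bar>) summable_on (range int \<union> range (\<lambda>n. - int n))"
    by (rule summable_on_union)
  moreover have "range int \<union> range (\<lambda>n. - int n) = UNIV"
  proof (intro equalityI subsetI)
    fix N :: int
    show "N \<in> range int \<union> range (\<lambda>n. - int n)"
      by (cases N rule: int_cases2) auto
  qed auto
  ultimately show ?thesis by simp
qed

lemma qE_add: "qE p (\<lambda>N. f N + g N) = (\<lambda>N. qE p f N + qE p g N)"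
  by (simp add: qE_def algebra_simps fun_eq_iff)

lemma qE_scaleR: "qE p (\<lambda>N. c *\<^sub>R f N) = (\<lambda>N. c *\<^sub>R qE p f N)"
  by (simp add: qE_def algebra_simps fun_eq_iff)

lemma qE_iter_add: "(qE p ^^ k) (\<lambda>N. f N + g N) = (\<lambda>N. (qE p ^^ k) f N + (qE p ^^ k) g N)"
  by (induction k) (simp_all add: qE_add)

lemma qE_iter_scaleR: "(qE p ^^ k) (\<lambda>N. c *\<^sub>R f N) = (\<lambda>N. c *\<^sub>R (qE p ^^ k) f N)"
  by (induction k) (simp_all add: qE_scaleR)

context q_base
begin

lemma qE_shift: "qE p (\<lambda>N. f (N + j)) = (\<lambda>N. p powi j *\<^sub>R qE p f (N + j))"
proof
  fix N
  have "p powi (- N) = p powi j * p powi (- (N + j))"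
    by (simp flip: power_int_add)
  then show "qE p (\<lambda>N. f (N + j)) N = p powi j *\<^sub>R qE p f (N + j)"
    by (simp add: qE_def ac_simps)
qed

lemma qE_iter_shift: "(qE p ^^ k) (\<lambda>N. f (N + j)) = (\<lambda>N. (p powi j) ^ k *\<^sub>R (qE p ^^ k) f (N + j))"
proof (induction k)
  case (Suc k)
  then show ?case by (simp add: qE_scaleR qE_shift[of "(qE p ^^ k) f"] mult_ac)
qed simp

lemma one_plus_powi_shift: "1 + p powi N \<le> (1 + p powi (- j)) * (1 + p powi (N + j))"
proof -
  have "p powi (- j) * p powi (N + j) = p powi N"
    by (simp add: power_int_add power_int_minus)
  moreover have "0 < p powi (- j)" "0 < p powi (N + j)" by (rule powi_pos)+
  ultimately show ?thesis by (simp add: distrib_left distrib_right)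
qed

lemma schwartz_seqD:
  assumes "schwartz_seq p f"
  obtains C where "0 \<le> C" "\<And>N. (1 + p powi N) ^ m * norm ((qE p ^^ k) f N) \<le> C"
proof -
  obtain C where C: "(1 + p powi N) ^ m * norm ((qE p ^^ k) f N) \<le> C" for N
    using assms unfolding schwartz_seq_def by meson
  have "0 \<le> (1 + p powi 0) ^ m * norm ((qE p ^^ k) f 0)" by simp
  with C[of 0] have "0 \<le> C" by linarith
  then show ?thesis using that C by blast
qed

lemma schwartz_seq_qE: "schwartz_seq p f \<Longrightarrow> schwartz_seq p (qE p f)"
  unfolding schwartz_seq_def by (simp flip: funpow_swap1 funpow.simps(2)[unfolded o_def] add: o_def)
     (metis funpow.simps(2) funpow_swap1 o_apply)

lemma schwartz_seq_add:
  assumes "schwartz_seq p f" "schwartz_seq p g"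
  shows "schwartz_seq p (\<lambda>N. f N + g N)"
  unfolding schwartz_seq_def
proof (intro allI)
  fix k m
  obtain C where C: "\<And>N. (1 + p powi N) ^ m * norm ((qE p ^^ k) f N) \<le> C"
    using schwartz_seqD[OF assms(1), of m k] by blast
  obtain D where D: "\<And>N. (1 + p powi N) ^ m * norm ((qE p ^^ k) g N) \<le> D"
    using schwartz_seqD[OF assms(2), of m k] by blast
  have "(1 + p powi N) ^ m * norm ((qE p ^^ k) (\<lambda>N. f N + g N) N) \<le> C + D" for N
  proof -
    have "(1 + p powi N) ^ m * norm ((qE p ^^ k) f N + (qE p ^^ k) g N)
        \<le> (1 + p powi N) ^ m * (norm ((qE p ^^ k) f N) + norm ((qE p ^^ k) g N))"
      by (intro mult_left_mono norm_triangle_ineq) (simp add: add_nonneg_nonneg)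
    then show ?thesis using C[of N] D[of N] by (simp add: qE_iter_add distrib_left)
  qed
  then show "\<exists>C. \<forall>N. (1 + p powi N) ^ m * norm ((qE p ^^ k) (\<lambda>N. f N + g N) N) \<le> C" by blast
qed

lemma schwartz_seq_scaleR:
  assumes "schwartz_seq p f"
  shows "schwartz_seq p (\<lambda>N. c *\<^sub>R f N)"
  unfolding schwartz_seq_def
proof (intro allI)
  fix k m
  obtain C where C: "\<And>N. (1 + p powi N) ^ m * norm ((qE p ^^ k) f N) \<le> C"
    using schwartz_seqD[OF assms(1), of m k] by blast
  have "(1 + p powi N) ^ m * norm ((qE p ^^ k) (\<lambda>N. c *\<^sub>R f N) N) \<le> \<bar>c\<bar> * C" for N
    using mult_left_mono[OF C[of N], of "\<bar>c\<bar>"] by (simp add: qE_iter_scaleR mult_ac)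
  then show "\<exists>C. \<forall>N. (1 + p powi N) ^ m * norm ((qE p ^^ k) (\<lambda>N. c *\<^sub>R f N) N) \<le> C" by blast
qed

lemma schwartz_seq_shift:
  assumes "schwartz_seq p f"
  shows "schwartz_seq p (\<lambda>N. f (N + j))"
  unfolding schwartz_seq_def
proof (intro allI)
  fix k m
  obtain C where C: "\<And>N. (1 + p powi N) ^ m * norm ((qE p ^^ k) f N) \<le> C"
    using schwartz_seqD[OF assms(1), of m k] by blast
  have "(1 + p powi N) ^ m * norm ((qE p ^^ k) (\<lambda>N. f (N + j)) N) \<le> (1 + p powi (- j)) ^ m * (p powi j) ^ k * C" for N
  proof -
    have "(1 + p powi N) ^ m * norm ((qE p ^^ k) (\<lambda>N. f (N + j)) N)
        \<le> ((1 + p powi (- j)) * (1 + p powi (N + j))) ^ m * ((p powi j) ^ k * norm ((qE p ^^ k) f (N + j)))"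
      using one_plus_powi_shift[of N j]
      by (intro mult_mono power_mono) (auto simp: qE_iter_shift power_abs intro!: add_nonneg_nonneg)
    also have "\<dots> = (1 + p powi (- j)) ^ m * (p powi j) ^ k * ((1 + p powi (N + j)) ^ m * norm ((qE p ^^ k) f (N + j)))"
      by (simp add: power_mult_distrib mult_ac)
    also have "\<dots> \<le> (1 + p powi (- j)) ^ m * (p powi j) ^ k * C"
      by (intro mult_left_mono C) (simp add: add_nonneg_nonneg)
    finally show ?thesis .
  qed
  then show "\<exists>C. \<forall>N. (1 + p powi N) ^ m * norm ((qE p ^^ k) (\<lambda>N. f (N + j)) N) \<le> C" by blast
qed

text \<open>Towards \<open>0\<close> the sequence is bounded and the weight is summable; towards infinity the growth of the
  weight is beaten by a power of \<open>1 + p powi N\<close>.\<close>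

lemma schwartz_seq_wsummable:
  assumes "schwartz_seq p f" "0 < r" "r < 1"
  shows "wsummable r f"
proof -
  obtain m where m: "p ^ m < r" using real_arch_pow_inv[of r p] assms p_less_1 by auto
  obtain C where C: "0 \<le> C" "\<And>N. (1 + p powi N) ^ m * norm ((qE p ^^ 0) f N) \<le> C"
    using schwartz_seqD[OF assms(1), of m 0] by blast
  \<comment> \<open>the two ratios are those of the weighted terms towards \<open>0\<close> and towards infinity\<close>
  define t where "t = max r (p ^ m / r)"
  have t: "0 < t" "t < 1" using assms m by (auto simp: t_def)
  show ?thesis unfolding wsummable_def
  proof (rule summable_on_comparison_test)
    show "(\<lambda>N::int. C * t ^ nat \<bar>N\<bar>) summable_on UNIV"
      using t by (intro summable_on_cmult_right summable_on_geometric_int)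
    fix N :: int
    show "r powi N * norm (f N) \<le> C * t ^ nat \<bar>N\<bar>"
    proof (cases "0 \<le> N")
      case True
      have "1 * norm (f N) \<le> (1 + p powi N) ^ m * norm (f N)"
        by (intro mult_right_mono one_le_power) auto
      then have f: "norm (f N) \<le> C" using C(2)[of N] by simp
      have "r powi N = r ^ nat \<bar>N\<bar>" using True by (simp add: power_int_def)
      also have "\<dots> \<le> t ^ nat \<bar>N\<bar>" using assms by (intro power_mono) (auto simp: t_def)
      finally have "r powi N * norm (f N) \<le> t ^ nat \<bar>N\<bar> * C"
        using f t by (intro mult_mono) auto
      then show ?thesis by (simp add: mult.commute)
    next
      case False
      define j where "j = nat \<bar>N\<bar>"
      have N: "N = - int j" using False by (simp add: j_def)
      have "(p powi N) ^ m * norm (f N) \<le> (1 + p powi N) ^ m * norm (f N)"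
        by (intro mult_right_mono power_mono) auto
      then have "norm (f N) / (p ^ j) ^ m \<le> C" using C(2)[of N]
        by (simp add: N power_int_minus divide_inverse power_inverse mult.commute)
      then have f: "norm (f N) \<le> C * (p ^ m) ^ j"
        by (simp add: divide_simps power_mult[symmetric] mult.commute)
      have "r powi N * norm (f N) \<le> r powi N * (C * (p ^ m) ^ j)"
        using f assms by (intro mult_left_mono) auto
      also have "\<dots> = C * (p ^ m / r) ^ j"
        by (simp add: N power_int_minus divide_inverse power_mult_distrib power_inverse mult_ac)
      also have "\<dots> \<le> C * t ^ j"
        using C assms by (intro mult_left_mono power_mono) (auto simp: t_def)
      finally show ?thesis by (simp add: j_def)
    qed
  qed (use assms in auto)
qed

lemma qH_has_sum:
  assumes "0 < w" "w < 1" "Z \<in> Rq_pos0 p" "wsummable w f"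
  shows "((\<lambda>N. (w powi N * qJ p w (p powi N * Z)) *\<^sub>R f N) has_sum qH p w f Z) UNIV"
  unfolding qH_def by (intro has_sum_infsum qH_abs_summable assms)

lemma qH_add:
  assumes "0 < w" "w < 1" "Z \<in> Rq_pos0 p" "wsummable w f" "wsummable w g"
  shows "qH p w (\<lambda>N. f N + g N) Z = qH p w f Z + qH p w g Z"
  using has_sum_add[OF qH_has_sum[OF assms(1-4)] qH_has_sum[OF assms(1-3,5)]]
  unfolding qH_def[of p w "\<lambda>N. f N + g N"] by (intro infsumI) (simp add: scaleR_add_right)

lemma qH_scaleR: "qH p w (\<lambda>N. c *\<^sub>R f N) Z = c *\<^sub>R qH p w f Z"
  unfolding qH_def infsum_scaleR_right[symmetric] by (simp add: mult.commute)

lemma wp_bounds: "\<lbrakk>0 < w; w < 1\<rbrakk> \<Longrightarrow> 0 < w * p ^ n" "\<lbrakk>0 < w; w < 1\<rbrakk> \<Longrightarrow> w * p ^ n < 1"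
  using mult_pow_less_1[of w n] by auto

text \<open>By \<open>qJ_diff\<close>, a difference in the spectral variable is absorbed by a shift of the parameter.\<close>

lemma qE_qH:
  assumes "0 < w" "w < 1" "wsummable w f"
  shows "qE p (\<lambda>L. qH p w f (p powi L)) = (\<lambda>L. - qH p (w * p) f (p powi (L + 1)))"
proof
  fix L
  note w = less_imp_le[OF assms(1)] less_imp_le[OF assms(2)]
  have "((\<lambda>N. (w powi N * qJ p w (p powi N * p powi L)) *\<^sub>R f N - (w powi N * qJ p w (p powi N * p powi (L + 1))) *\<^sub>R f N)
    has_sum (qH p w f (p powi L) - qH p w f (p powi (L + 1)))) UNIV"
    by (intro has_sum_minus qH_has_sum assms powi_Rq_pos0)
  from has_sum_scaleR[OF this, of "p powi (- L)"]
  have "((\<lambda>N. p powi (- L) *\<^sub>R ((w powi N * qJ p w (p powi N * p powi L)) *\<^sub>R f N - (w powi N * qJ p w (p powi N * p powi (L + 1))) *\<^sub>R f N))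
    has_sum qE p (\<lambda>L. qH p w f (p powi L)) L) UNIV"
    by (simp add: qE_def)
  moreover have "p powi (- L) *\<^sub>R ((w powi N * qJ p w (p powi N * p powi L)) *\<^sub>R f N - (w powi N * qJ p w (p powi N * p powi (L + 1))) *\<^sub>R f N)
      = - (((w * p) powi N * qJ p (w * p) (p powi N * p powi (L + 1))) *\<^sub>R f N)" for N
  proof -
    define Z where "Z = p powi N * p powi L"
    have pZ: "p powi N * p powi (L + 1) = p * Z" by (simp add: Z_def power_int_add mult_ac)
    have "p powi (- L) * (w powi N * (qJ p w Z - qJ p w (p * Z))) = - ((w * p) powi N * qJ p (w * p) (p * Z))"
      unfolding qJ_diff[OF w] by (simp add: Z_def power_int_mult_distrib power_int_minus)
    then show ?thesis
      unfolding pZ Z_def[symmetric] scaleR_left_diff_distrib[symmetric] right_diff_distrib[symmetric]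
      by (simp flip: scaleR_minus_left)
  qed
  ultimately have "((\<lambda>N. - (((w * p) powi N * qJ p (w * p) (p powi N * p powi (L + 1))) *\<^sub>R f N))
    has_sum qE p (\<lambda>L. qH p w f (p powi L)) L) UNIV" by simp
  then show "qE p (\<lambda>L. qH p w f (p powi L)) L = - qH p (w * p) f (p powi (L + 1))"
    unfolding qH_def by (simp add: has_sum_uminus infsumI)
qed

lemma wsummable_pow:
  assumes "schwartz_seq p f" "0 < w" "w < 1"
  shows "wsummable (w * p ^ n) f"
  using assms wp_bounds[OF assms(2,3)] by (intro schwartz_seq_wsummable)

lemma qE_iter_qH:
  assumes "0 < w" "w < 1" "schwartz_seq p f"
  shows "\<exists>C. \<forall>L. (qE p ^^ k) (\<lambda>L. qH p w f (p powi L)) L = C *\<^sub>R qH p (w * p ^ k) f (p powi (L + int k))"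
proof (induction k)
  case (Suc k)
  then obtain C where C: "(qE p ^^ k) (\<lambda>L. qH p w f (p powi L)) = (\<lambda>L. C *\<^sub>R qH p (w * p ^ k) f (p powi (L + int k)))"
    by blast
  have "(qE p ^^ Suc k) (\<lambda>L. qH p w f (p powi L)) L
      = (- C * p ^ k) *\<^sub>R qH p (w * p ^ Suc k) f (p powi (L + int (Suc k)))" for L
  proof -
    have "qE p (\<lambda>L. qH p (w * p ^ k) f (p powi (L + int k))) L
      = p ^ k *\<^sub>R - qH p (w * p ^ k * p) f (p powi (L + int k + 1))"
      using assms wp_bounds[OF assms(1,2)] wsummable_pow
      by (subst qE_shift[of "\<lambda>L. qH p (w * p ^ k) f (p powi L)"], subst qE_qH) auto
    moreover have "L + int k + 1 = L + int (Suc k)" by simp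
    ultimately show ?thesis by (simp add: C qE_scaleR mult_ac del: of_nat_Suc)
  qed
  then show ?case by blast
qed (auto intro!: exI[of _ 1])

text \<open>The \<open>q\<close>-Bessel operator: multiplication by the spectral variable corresponds to a second
  order difference operator, obtained by summation by parts from the two contiguous relations.\<close>

lemma qH_spectral:
  assumes "0 < w" "w < 1" "schwartz_seq p f"
  defines "h \<equiv> \<lambda>N. (- 1 / p) *\<^sub>R qE p f (N + - 1)"
  shows "p powi L *\<^sub>R qH p w f (p powi L) = qH p w (\<lambda>N. p *\<^sub>R (h N + (- w) *\<^sub>R h (N + 1))) (p powi L)"
proof -
  define Z where "Z = p powi L"
  note w = less_imp_le[OF assms(1)] less_imp_le[OF assms(2)]
  have wp: "0 < w * p" "w * p < 1" using wp_bounds[of w 1] assms by auto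
  have Zin: "Z \<in> Rq_pos0 p" and Zin': "p powi (- 1) * Z \<in> Rq_pos0 p"
    unfolding Z_def by (rule powi_Rq_pos0, rule Rq_pos0_powi_mult[OF powi_Rq_pos0])
  have Sh: "schwartz_seq p h" unfolding h_def
    by (intro schwartz_seq_scaleR schwartz_seq_shift schwartz_seq_qE assms)
  have Sf': "schwartz_seq p (\<lambda>N. f (N + - 1))" by (intro schwartz_seq_shift assms)
  have ws: "wsummable w g" if "schwartz_seq p g" for g using that assms schwartz_seq_wsummable by blast
  have s: "(\<lambda>N. (w powi N * qJ p (w * p) (p powi N * Z)) *\<^sub>R g N) summable_on UNIV" if "schwartz_seq p g" for g
  proof (rule abs_summable_on_bounded_mult(2))
    show "(\<lambda>N. w powi N * norm (g N)) summable_on UNIV" using ws[OF that] by (simp add: wsummable_def)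
    show "\<bar>w powi N * qJ p (w * p) (p powi N * Z)\<bar> \<le> qJ_bound (w * p) * w powi N" for N
      using assms qJ_le_lattice[OF wp Zin] by (simp add: abs_mult mult.commute mult_left_mono)
  qed (use assms in auto)
  define S where "S g = (\<Sum>\<^sub>\<infinity>N. (w powi N * qJ p (w * p) (p powi N * Z)) *\<^sub>R g N)" for g :: "int \<Rightarrow> complex"
  have hs: "((\<lambda>N. (w powi N * qJ p (w * p) (p powi N * Z)) *\<^sub>R g N) has_sum S g) UNIV" if "schwartz_seq p g" for g
    unfolding S_def by (intro has_sum_infsum s that)
  have 1: "qH p w f Z = qH p (w * p) h Z"
  proof -
    have "((\<lambda>N. (w powi (N + 1) * qJ p (w * p) (p powi (N + 1) * Z)) *\<^sub>R f (N + 1 + - 1)) has_sum S (\<lambda>N. f (N + - 1))) UNIV"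
      using hs[OF Sf'] by (subst has_sum_reindex_bij_witness[of _ "\<lambda>n. n - 1" "\<lambda>n. n + 1"]) auto
    from has_sum_minus[OF hs[OF assms(3)] this]
    have "((\<lambda>N. (w powi N * qJ p w (p powi N * Z)) *\<^sub>R f N) has_sum (S f - S (\<lambda>N. f (N + - 1)))) UNIV"
    proof (rule has_sum_cong[THEN iffD1, rotated])
      fix N
      define Y where "Y = p powi N * Z"
      have pY: "p powi (N + 1) * Z = p * Y" by (simp add: Y_def power_int_add mult_ac)
      show "(w powi N * qJ p (w * p) (p powi N * Z)) *\<^sub>R f N -
         (w powi (N + 1) * qJ p (w * p) (p powi (N + 1) * Z)) *\<^sub>R f (N + 1 + - 1)
        = (w powi N * qJ p w (p powi N * Z)) *\<^sub>R f N"
        using assms unfolding pY Y_def[symmetric] qJ_contiguous[OF w, of Y]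
        by (simp add: power_int_add algebra_simps)
    qed
    then have "qH p w f Z = S f - S (\<lambda>N. f (N + - 1))"
      unfolding qH_def by (rule infsumI)
    moreover have "((\<lambda>N. ((w * p) powi N * qJ p (w * p) (p powi N * Z)) *\<^sub>R h N) has_sum (S f - S (\<lambda>N. f (N + - 1)))) UNIV"
    proof (rule has_sum_cong[THEN iffD1, OF _ has_sum_minus[OF hs[OF assms(3)] hs[OF Sf']]])
      fix N
      show "(w powi N * qJ p (w * p) (p powi N * Z)) *\<^sub>R f N - (w powi N * qJ p (w * p) (p powi N * Z)) *\<^sub>R f (N + - 1)
        = ((w * p) powi N * qJ p (w * p) (p powi N * Z)) *\<^sub>R h N"
        by (simp add: h_def qE_def power_int_mult_distrib power_int_diff power_int_minus divide_simps algebra_simps)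
    qed
    ultimately show ?thesis unfolding qH_def by (simp add: infsumI)
  qed
  have 2: "p powi L *\<^sub>R qH p (w * p) h Z = p *\<^sub>R (qH p w h Z - qH p w h (p powi (- 1) * Z))"
  proof -
    have "((\<lambda>N. p *\<^sub>R ((w powi N * qJ p w (p powi N * Z)) *\<^sub>R h N - (w powi N * qJ p w (p powi N * (p powi (- 1) * Z))) *\<^sub>R h N))
      has_sum p *\<^sub>R (qH p w h Z - qH p w h (p powi (- 1) * Z))) UNIV"
      by (intro has_sum_scaleR has_sum_minus qH_has_sum assms Zin Zin' ws Sh)
    moreover have "p *\<^sub>R ((w powi N * qJ p w (p powi N * Z)) *\<^sub>R h N - (w powi N * qJ p w (p powi N * (p powi (- 1) * Z))) *\<^sub>R h N)
      = p powi L *\<^sub>R (((w * p) powi N * qJ p (w * p) (p powi N * Z)) *\<^sub>R h N)" for N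
    proof -
      define Y where "Y = p powi N * (p powi (- 1) * Z)"
      have pY: "p powi N * Z = p * Y" by (simp add: Y_def power_int_minus)
      have "p * (w powi N * (qJ p w (p * Y) - qJ p w Y)) = p powi L * ((w * p) powi N * qJ p (w * p) (p * Y))"
      proof -
        have "qJ p w (p * Y) - qJ p w Y = Y * qJ p (w * p) (p * Y)" using qJ_diff[OF w, of Y] by simp
        then show ?thesis by (simp add: Y_def Z_def power_int_mult_distrib power_int_minus)
      qed
      then show ?thesis
        unfolding Y_def[symmetric] pY scaleR_left_diff_distrib[symmetric] right_diff_distrib[symmetric]
        by simp
    qed
    ultimately have "((\<lambda>N. p powi L *\<^sub>R (((w * p) powi N * qJ p (w * p) (p powi N * Z)) *\<^sub>R h N))
      has_sum p *\<^sub>R (qH p w h Z - qH p w h (p powi (- 1) * Z))) UNIV" by simp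
    then show ?thesis unfolding qH_def[of p "w * p"] infsum_scaleR_right[symmetric] by (rule infsumI)
  qed
  have 3: "qH p w h (p powi (- 1) * Z) = w *\<^sub>R qH p w (\<lambda>N. h (N + 1)) Z"
    using assms by (subst qH_shift) (simp_all add: power_int_minus)
  have "p powi L *\<^sub>R qH p w f Z = p *\<^sub>R (qH p w h Z + (- w) *\<^sub>R qH p w (\<lambda>N. h (N + 1)) Z)"
    unfolding 1 2 3 by simp
  also have "\<dots> = qH p w (\<lambda>N. p *\<^sub>R (h N + (- w) *\<^sub>R h (N + 1))) Z"
  proof -
    have "qH p w (\<lambda>N. h N + (- w) *\<^sub>R h (N + 1)) Z = qH p w h Z + qH p w (\<lambda>N. (- w) *\<^sub>R h (N + 1)) Z"
      by (intro qH_add assms(1,2) Zin ws Sh schwartz_seq_scaleR schwartz_seq_shift)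
    then show ?thesis by (simp only: qH_scaleR)
  qed
  finally show ?thesis by (simp add: Z_def)
qed

text \<open>By \<open>qH_spectral\<close> a factor \<open>1 + p powi L\<close> is absorbed into \<open>f\<close>, at the price of a difference operator
  that preserves rapid decrease.\<close>

lemma qH_rapid:
  assumes "0 < w" "w < 1" "schwartz_seq p f"
  shows "\<exists>C. \<forall>L. (1 + p powi L) ^ m * norm (qH p w f (p powi L)) \<le> C"
  using assms(3)
proof (induction m arbitrary: f)
  case 0
  then show ?case
    using qH_bounded[OF assms(1,2) powi_Rq_pos0 schwartz_seq_wsummable[OF _ assms(1,2)]] by auto
next
  case (Suc m)
  define h where "h N = (- 1 / p) *\<^sub>R qE p f (N + - 1)" for N
  define g where "g N = f N + p *\<^sub>R (h N + (- w) *\<^sub>R h (N + 1))" for N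
  have Sh: "schwartz_seq p h" unfolding h_def
    by (intro schwartz_seq_scaleR schwartz_seq_shift schwartz_seq_qE Suc.prems)
  have Sb: "schwartz_seq p (\<lambda>N. p *\<^sub>R (h N + (- w) *\<^sub>R h (N + 1)))"
    by (intro schwartz_seq_add schwartz_seq_scaleR schwartz_seq_shift Sh)
  have Sg: "schwartz_seq p g" unfolding g_def
    by (intro schwartz_seq_add Suc.prems Sb)
  obtain C where C: "\<And>L. (1 + p powi L) ^ m * norm (qH p w g (p powi L)) \<le> C"
    using Suc.IH[OF Sg] by blast
  have "(1 + p powi L) ^ Suc m * norm (qH p w f (p powi L)) \<le> C" for L
  proof -
    have "qH p w g (p powi L) = qH p w f (p powi L) + p powi L *\<^sub>R qH p w f (p powi L)"
      unfolding g_def using assms Suc.prems Sb qH_spectral[OF assms(1,2) Suc.prems, of L, folded h_def]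
      by (subst qH_add) (auto intro: schwartz_seq_wsummable)
    also have "\<dots> = (1 + p powi L) *\<^sub>R qH p w f (p powi L)" by (simp add: scaleR_add_left)
    finally have "norm (qH p w g (p powi L)) = (1 + p powi L) * norm (qH p w f (p powi L))"
      by (simp add: abs_of_pos add_pos_pos)
    then show ?thesis using C[of L] by (simp add: mult_ac)
  qed
  then show ?case by blast
qed

theorem schwartz_seq_qH:
  assumes "0 < w" "w < 1" "schwartz_seq p f"
  shows "schwartz_seq p (\<lambda>L. qH p w f (p powi L))"
  unfolding schwartz_seq_def
proof (intro allI)
  fix k m
  obtain A where A: "\<And>L. (qE p ^^ k) (\<lambda>L. qH p w f (p powi L)) L = A *\<^sub>R qH p (w * p ^ k) f (p powi (L + int k))"
    using qE_iter_qH[OF assms] by blast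
  obtain C where C: "\<And>L. (1 + p powi L) ^ m * norm (qH p (w * p ^ k) f (p powi L)) \<le> C"
    using qH_rapid[OF wp_bounds[OF assms(1,2)] assms(3)] by blast
  have "(1 + p powi L) ^ m * norm ((qE p ^^ k) (\<lambda>L. qH p w f (p powi L)) L) \<le> \<bar>A\<bar> * (1 + p powi (- int k)) ^ m * C" for L
  proof -
    have "(1 + p powi L) ^ m * norm ((qE p ^^ k) (\<lambda>L. qH p w f (p powi L)) L)
      \<le> ((1 + p powi (- int k)) * (1 + p powi (L + int k))) ^ m * (\<bar>A\<bar> * norm (qH p (w * p ^ k) f (p powi (L + int k))))"
      unfolding A norm_scaleR
      by (intro mult_mono power_mono one_plus_powi_shift) (auto intro!: add_nonneg_nonneg)
    also have "\<dots> = \<bar>A\<bar> * (1 + p powi (- int k)) ^ m * ((1 + p powi (L + int k)) ^ m * norm (qH p (w * p ^ k) f (p powi (L + int k))))"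
      by (simp add: power_mult_distrib mult_ac)
    also have "\<dots> \<le> \<bar>A\<bar> * (1 + p powi (- int k)) ^ m * C"
      by (intro mult_left_mono C) (simp add: add_nonneg_nonneg)
    finally show ?thesis .
  qed
  then show "\<exists>C. \<forall>L. (1 + p powi L) ^ m * norm ((qE p ^^ k) (\<lambda>L. qH p w f (p powi L)) L) \<le> C" by blast
qed

end

section \<open>Vanishing moments and flatness at the origin\<close>

context q_base
begin

text \<open>Integration of the Taylor expansion of the kernel: the coefficients are the moments of \<open>f\<close>.\<close>

lemma qH_taylor:
  assumes "0 < w" "w < 1" "\<And>n. wsummable (w * p ^ n) f"
  obtains C where "0 \<le> C"
    "\<And>L. norm (qH p w f (p powi L) -
        (\<Sum>n<k. (e n * qpoch_inf (w * p ^ n) p * (p powi L) ^ n) *\<^sub>R (\<Sum>\<^sub>\<infinity>N. (w * p ^ n) powi N *\<^sub>R f N)))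
      \<le> C * (p powi L) ^ k"
proof -
  define P where "P n = qpoch_inf (w * p ^ n) p" for n
  define M where "M n = (\<Sum>\<^sub>\<infinity>N. (w * p ^ n) powi N *\<^sub>R f N)" for n
  have ws: "wsummable w f" using assms(3)[of 0] by simp
  have M: "((\<lambda>N. (w * p ^ n) powi N *\<^sub>R f N) has_sum M n) UNIV" for n
    unfolding M_def
  proof (rule has_sum_infsum, rule abs_summable_summable)
    show "(\<lambda>N. norm ((w * p ^ n) powi N *\<^sub>R f N)) summable_on UNIV"
      using assms(3)[of n] assms(1) by (simp add: wsummable_def abs_mult)
  qed
  obtain C where C: "0 \<le> C" "\<And>N. \<bar>qJ p w (p powi N) - (\<Sum>n<k. e n * P n * (p powi N) ^ n)\<bar> \<le> C * (p powi N) ^ k"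
    using qJ_taylor[OF less_imp_le[OF assms(1)] less_imp_le[OF assms(2)], of k] unfolding P_def by blast
  define S where "S = (\<Sum>\<^sub>\<infinity>N. (w * p ^ k) powi N * norm (f N))"
  have "norm (qH p w f (p powi L) - (\<Sum>n<k. (e n * P n * (p powi L) ^ n) *\<^sub>R M n)) \<le> C * S * (p powi L) ^ k" for L
  proof -
    define T where "T N = (w powi N * (qJ p w (p powi (N + L)) - (\<Sum>n<k. e n * P n * (p powi (N + L)) ^ n))) *\<^sub>R f N" for N
    have "((\<lambda>N. (w powi N * qJ p w (p powi N * p powi L)) *\<^sub>R f N
        - (\<Sum>n<k. (e n * P n * (p powi L) ^ n) *\<^sub>R ((w * p ^ n) powi N *\<^sub>R f N)))
      has_sum (qH p w f (p powi L) - (\<Sum>n<k. (e n * P n * (p powi L) ^ n) *\<^sub>R M n))) UNIV"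
      by (intro has_sum_minus has_sum_finite_sum has_sum_scaleR M qH_has_sum assms ws powi_Rq_pos0)
    moreover have "(w powi N * qJ p w (p powi N * p powi L)) *\<^sub>R f N
        - (\<Sum>n<k. (e n * P n * (p powi L) ^ n) *\<^sub>R ((w * p ^ n) powi N *\<^sub>R f N)) = T N" for N
    proof -
      have "(p powi L) ^ n * (p ^ n) powi N = (p powi (N + L)) ^ n" for n
        by (simp add: power_int_add power_mult_distrib power_int_power power_int_power' mult.commute)
      then have "(e n * P n * (p powi L) ^ n) *\<^sub>R ((w * p ^ n) powi N *\<^sub>R f N)
          = (w powi N * (e n * P n * (p powi (N + L)) ^ n)) *\<^sub>R f N" for n
        by (simp add: power_int_mult_distrib mult_ac)
      then show ?thesis
        unfolding T_def by (simp only: right_diff_distrib scaleR_left_diff_distrib sum_distrib_left scaleR_sum_left power_int_add[of p N L]) (simp add: power_int_add)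
    qed
    ultimately have T: "(T has_sum (qH p w f (p powi L) - (\<Sum>n<k. (e n * P n * (p powi L) ^ n) *\<^sub>R M n))) UNIV"
      by simp
    have Tle: "norm (T N) \<le> (C * (p powi L) ^ k) * ((w * p ^ k) powi N * norm (f N))" for N
    proof -
      have "norm (T N) \<le> w powi N * (C * (p powi (N + L)) ^ k) * norm (f N)"
        unfolding T_def norm_scaleR abs_mult using assms C(2)[of "N + L"]
        by (intro mult_right_mono mult_mono) auto
      also have "\<dots> = (C * (p powi L) ^ k) * ((w * p ^ k) powi N * norm (f N))"
        by (simp add: power_int_add power_mult_distrib power_int_mult_distrib power_int_power power_int_power' mult_ac)
      finally show ?thesis .
    qed
    have s: "(\<lambda>N. (C * (p powi L) ^ k) * ((w * p ^ k) powi N * norm (f N))) summable_on UNIV"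
      using assms(3)[of k] unfolding wsummable_def by (rule summable_on_cmult_right)
    have sT: "(\<lambda>N. norm (T N)) summable_on UNIV"
      by (rule summable_on_comparison_test[OF s]) (use Tle in auto)
    have "norm (infsum T UNIV) \<le> (\<Sum>\<^sub>\<infinity>N. norm (T N))" by (rule norm_infsum_bound[OF sT])
    also have "\<dots> \<le> (\<Sum>\<^sub>\<infinity>N. (C * (p powi L) ^ k) * ((w * p ^ k) powi N * norm (f N)))"
      by (intro infsum_mono sT s Tle)
    also have "\<dots> = C * S * (p powi L) ^ k" by (simp add: infsum_cmult_right' S_def)
    finally show ?thesis using infsumI[OF T] by simp
  qed
  moreover have "0 \<le> C * S" unfolding S_def using C assms by (intro mult_nonneg_nonneg infsum_nonneg) auto
  ultimately show ?thesis using that[of "C * S"] by (simp add: P_def M_def)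
qed

lemma powi_nat_tendsto_0: "(\<lambda>n. p powi (int n)) \<longlonglongrightarrow> 0"
  using p_pos p_less_1 by (simp add: LIMSEQ_power_zero)

lemma qH_tendsto_0:
  assumes "0 < w" "w < 1" "schwartz_seq p f"
  shows "(\<lambda>n. qH p w f (p powi (int n))) \<longlonglongrightarrow> qH p w f 0"
proof -
  obtain C where C: "\<And>L. norm (qH p w f (p powi L) -
        (\<Sum>n<1. (e n * qpoch_inf (w * p ^ n) p * (p powi L) ^ n) *\<^sub>R (\<Sum>\<^sub>\<infinity>N. (w * p ^ n) powi N *\<^sub>R f N)))
      \<le> C * (p powi L) ^ 1"
    using qH_taylor[OF assms(1,2) wsummable_pow[OF assms(3,1,2)], of 1] by blast
  have H0: "qH p w f 0 = qpoch_inf w p *\<^sub>R (\<Sum>\<^sub>\<infinity>N. w powi N *\<^sub>R f N)"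
    unfolding qH_def infsum_scaleR_right[symmetric] by (simp add: qJ_0 mult.commute)
  have "norm (qH p w f (p powi (int n)) - qH p w f 0) \<le> C * p powi (int n)" for n
    using C[of "int n"] by (simp add: H0)
  moreover have "(\<lambda>n. C * p powi (int n)) \<longlonglongrightarrow> 0"
    using tendsto_mult_left[OF powi_nat_tendsto_0, of C] by simp
  ultimately have "(\<lambda>n. qH p w f (p powi (int n)) - qH p w f 0) \<longlonglongrightarrow> 0"
    by (rule Lim_null_comparison[OF always_eventually, OF allI])
  then show ?thesis by (rule LIM_zero_cancel)
qed

text \<open>The moments are the Taylor coefficients of the transform at the origin, up to nonzero
  factors.\<close>

theorem flat_qH_of_moments:
  assumes "0 < w" "w < 1" "schwartz_seq p f" "moments_vanish p w f"
  shows "flat_seq p (\<lambda>L. qH p w f (p powi L))"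
  unfolding flat_seq_def
proof
  fix m :: int
  show "\<exists>C. \<forall>L. norm (qH p w f (p powi L)) \<le> C * (p powi L) powi m"
  proof (cases m)
    case (nonneg k)
    obtain C where "\<And>L. norm (qH p w f (p powi L) -
        (\<Sum>n<k. (e n * qpoch_inf (w * p ^ n) p * (p powi L) ^ n) *\<^sub>R (\<Sum>\<^sub>\<infinity>N. (w * p ^ n) powi N *\<^sub>R f N)))
      \<le> C * (p powi L) ^ k"
      using qH_taylor[OF assms(1,2) wsummable_pow[OF assms(3,1,2)], of k] by blast
    then have "norm (qH p w f (p powi L)) \<le> C * (p powi L) ^ k" for L
      using assms(4) by (simp add: moments_vanish_def)
    then show ?thesis using nonneg by auto
  next
    case (neg k)
    obtain C where C: "\<And>L. (1 + p powi L) ^ Suc k * norm (qH p w f (p powi L)) \<le> C"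
      using qH_rapid[OF assms(1-3)] by blast
    have "norm (qH p w f (p powi L)) \<le> C * (p powi L) powi m" for L
    proof -
      have "(p powi L) ^ Suc k * norm (qH p w f (p powi L)) \<le> (1 + p powi L) ^ Suc k * norm (qH p w f (p powi L))"
        by (intro mult_right_mono power_mono) auto
      then have "norm (qH p w f (p powi L)) * (p powi L) ^ Suc k \<le> C"
        using C[of L] by (simp only: mult.commute)
      moreover have "(p powi L) powi m = inverse ((p powi L) ^ Suc k)"
        using neg by (simp add: power_int_minus del: of_nat_Suc power_Suc flip: power_int_of_nat)
      moreover have "0 < (p powi L) ^ Suc k" by simp
      ultimately show ?thesis by (simp add: pos_le_divide_eq divide_inverse[symmetric] del: power_Suc)
    qed
    then show ?thesis by blast
  qed
qed

text \<open>Inductively, once the lower moments vanish, the first remaining term of the expansion is dominated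
  by a higher power of \<open>p powi L\<close>, and \<open>L \<rightarrow> \<infinity>\<close> forces its coefficient to vanish.\<close>

theorem moments_of_flat_qH:
  assumes "0 < w" "w < 1" "schwartz_seq p f" "flat_seq p (\<lambda>L. qH p w f (p powi L))"
  shows "moments_vanish p w f"
  unfolding moments_vanish_def
proof
  fix n
  show "(\<Sum>\<^sub>\<infinity>N. (w * p ^ n) powi N *\<^sub>R f N) = 0"
  proof (induction n rule: less_induct)
    case (less n)
    define M where "M = (\<Sum>\<^sub>\<infinity>N. (w * p ^ n) powi N *\<^sub>R f N)"
    define a where "a = e n * qpoch_inf (w * p ^ n) p"
    have "qpoch_inf (w * p ^ n) p \<noteq> 0"
      using qpoch_inf_pos[of "w * p ^ n"] wp_bounds[OF assms(1,2), of n] by simp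
    then have a: "a \<noteq> 0" by (simp add: a_def)
    obtain C where C: "\<And>L. norm (qH p w f (p powi L) -
        (\<Sum>i<Suc n. (e i * qpoch_inf (w * p ^ i) p * (p powi L) ^ i) *\<^sub>R (\<Sum>\<^sub>\<infinity>N. (w * p ^ i) powi N *\<^sub>R f N)))
      \<le> C * (p powi L) ^ Suc n"
      using qH_taylor[OF assms(1,2) wsummable_pow[OF assms(3,1,2)], of "Suc n"] by blast
    have C': "norm (qH p w f (p powi L) - (a * (p powi L) ^ n) *\<^sub>R M) \<le> C * (p powi L) ^ Suc n" for L
      using C[of L] less by (simp add: a_def M_def)
    obtain D where D: "\<And>L. norm (qH p w f (p powi L)) \<le> D * (p powi L) powi (int (Suc n))"
      using assms(4) unfolding flat_seq_def by blast
    have bound: "\<bar>a\<bar> * norm M \<le> (C + D) * p powi (int L)" for L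
    proof -
      define x where "x = p powi (int L)"
      have x: "0 < x" by (simp add: x_def)
      have "norm ((a * x ^ n) *\<^sub>R M) \<le> norm (qH p w f x) + norm (qH p w f x - (a * x ^ n) *\<^sub>R M)"
        by (metis add.commute norm_minus_commute norm_triangle_sub)
      also have "\<dots> \<le> D * x ^ Suc n + C * x ^ Suc n"
        using C'[of "int L"] D[of "int L"] unfolding x_def power_int_of_nat by (intro add_mono)
      finally have "(\<bar>a\<bar> * norm M) * x ^ n \<le> ((C + D) * x) * x ^ n"
        using x by (simp add: abs_mult algebra_simps)
      then show ?thesis using x by (simp add: x_def)
    qed
    have "(\<lambda>L. (C + D) * p powi (int L)) \<longlonglongrightarrow> (C + D) * 0"
      by (intro tendsto_mult_left powi_nat_tendsto_0)
    then have "\<bar>a\<bar> * norm M \<le> (C + D) * 0"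
      by (rule LIMSEQ_le_const) (use bound in auto)
    then show ?case using a by (simp add: M_def mult_le_0_iff)
  qed
qed

lemma flat_seqD:
  assumes "flat_seq p f"
  obtains C where "0 \<le> C" "\<And>N. norm (f N) \<le> C * (p powi N) powi m"
proof -
  obtain C where C: "norm (f N) \<le> C * (p powi N) powi m" for N
    using assms unfolding flat_seq_def by meson
  from C[of 0] have "0 \<le> C" using norm_ge_zero[of "f 0"] by (simp del: norm_ge_zero)
  then show ?thesis using that C by blast
qed

lemma flat_seq_scaleR:
  assumes "flat_seq p f"
  shows "flat_seq p (\<lambda>N. c *\<^sub>R f N)"
  unfolding flat_seq_def
proof
  fix m
  obtain C where C: "\<And>N. norm (f N) \<le> C * (p powi N) powi m"
    using flat_seqD[OF assms, of m] by blast
  have "norm (c *\<^sub>R f N) \<le> (\<bar>c\<bar> * C) * (p powi N) powi m" for N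
    using mult_left_mono[OF C[of N], of "\<bar>c\<bar>"] by simp
  then show "\<exists>C. \<forall>N. norm (c *\<^sub>R f N) \<le> C * (p powi N) powi m" by blast
qed

text \<open>For \<open>r\<close> not a power of \<open>p\<close> this factor has no expansion at \<open>0\<close>, so it would destroy rapid
  decrease in the sense of \<open>schwartz_seq\<close>; flatness survives.\<close>

lemma flat_seq_powi:
  assumes "flat_seq p f" "0 < r" "r < 1"
  shows "flat_seq p (\<lambda>N. r powi N *\<^sub>R f N)"
  unfolding flat_seq_def
proof
  fix m
  obtain a where a: "p ^ a < r" using real_arch_pow_inv[of r p] assms p_less_1 by auto
  have r: "r powi N \<le> 1 + (p powi N) powi int a" for N
  proof (cases "0 \<le> N")
    case True
    then have "r powi N \<le> 1" using assms by (intro power_int_le_one) auto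
    moreover have "0 \<le> (p powi N) powi int a" by simp
    ultimately show ?thesis by linarith
  next
    case False
    define j where "j = nat (- N)"
    have N: "N = - int j" using False by (simp add: j_def)
    have "inverse r ^ j \<le> inverse (p ^ a) ^ j"
      using a assms by (intro power_mono le_imp_inverse_le) auto
    then have "r powi N \<le> (p powi N) powi int a"
      by (simp add: N power_int_minus power_inverse power_mult[symmetric] mult.commute)
    then show ?thesis by linarith
  qed
  obtain C where C: "\<And>N. norm (f N) \<le> C * (p powi N) powi m"
    using flat_seqD[OF assms(1), of m] by blast
  obtain D where D: "\<And>N. norm (f N) \<le> D * (p powi N) powi (m - int a)"
    using flat_seqD[OF assms(1), of "m - int a"] by blast
  have "norm (r powi N *\<^sub>R f N) \<le> (C + D) * (p powi N) powi m" for N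
  proof -
    have "norm (r powi N *\<^sub>R f N) \<le> (1 + (p powi N) powi int a) * norm (f N)"
      using assms r[of N] by (simp add: mult_right_mono)
    also have "\<dots> = norm (f N) + (p powi N) powi int a * norm (f N)" by (simp add: distrib_right)
    also have "\<dots> \<le> C * (p powi N) powi m + (p powi N) powi int a * (D * (p powi N) powi (m - int a))"
      by (intro add_mono C mult_left_mono D) simp
    also have "\<dots> = (C + D) * (p powi N) powi m"
      by (simp add: power_int_diff distrib_right)
    finally show ?thesis .
  qed
  then show "\<exists>C. \<forall>N. norm (r powi N *\<^sub>R f N) \<le> C * (p powi N) powi m" by blast
qed

lemma flat_seq_qE:
  assumes "flat_seq p f"
  shows "flat_seq p (qE p f)"
  unfolding flat_seq_def
proof
  fix m
  obtain C where C: "\<And>N. norm (f N) \<le> C * (p powi N) powi (m + 1)"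
    using flat_seqD[OF assms, of "m + 1"] by blast
  have "norm (qE p f N) \<le> (C + C * p powi (m + 1)) * (p powi N) powi m" for N
  proof -
    have "norm (qE p f N) \<le> p powi (- N) * (norm (f N) + norm (f (N + 1)))"
      unfolding qE_def norm_scaleR by (intro mult_mono norm_triangle_ineq4) auto
    also have "\<dots> \<le> p powi (- N) * (C * (p powi N) powi (m + 1) + C * (p powi (N + 1)) powi (m + 1))"
      by (intro mult_left_mono add_mono C) simp
    also have "\<dots> = (C + C * p powi (m + 1)) * (p powi N) powi m"
      by (simp add: power_int_add power_int_minus power_int_mult_distrib field_simps)
    finally show ?thesis .
  qed
  then show "\<exists>C. \<forall>N. norm (qE p f N) \<le> C * (p powi N) powi m" by blast
qed

lemma schwartz_seq_of_flat:
  assumes "flat_seq p f"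
  shows "schwartz_seq p f"
  unfolding schwartz_seq_def
proof (intro allI)
  fix k m
  have "flat_seq p ((qE p ^^ k) f)"
    by (induction k) (simp_all add: assms flat_seq_qE)
  note D = flat_seqD[OF this]
  obtain A where A: "0 \<le> A" "\<And>N. norm ((qE p ^^ k) f N) \<le> A * (p powi N) powi 0"
    using D[of 0] by blast
  obtain B where B: "0 \<le> B" "\<And>N. norm ((qE p ^^ k) f N) \<le> B * (p powi N) powi (- int m)"
    using D[of "- int m"] by blast
  have "(1 + p powi N) ^ m * norm ((qE p ^^ k) f N) \<le> 2 ^ m * (A + B)" for N
  proof (cases "p powi N \<le> 1")
    case True
    then have "(1 + p powi N) ^ m * norm ((qE p ^^ k) f N) \<le> 2 ^ m * (A * (p powi N) powi 0)"
      by (intro mult_mono power_mono A) (auto intro: add_nonneg_nonneg)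
    also have "\<dots> \<le> 2 ^ m * (A + B)" using B(1) by simp
    finally show ?thesis .
  next
    case False
    then have "(1 + p powi N) ^ m * norm ((qE p ^^ k) f N) \<le> (2 * p powi N) ^ m * (B * (p powi N) powi (- int m))"
      by (intro mult_mono power_mono B) (auto intro: add_nonneg_nonneg)
    also have "\<dots> = 2 ^ m * B" by (simp add: power_mult_distrib power_int_minus)
    also have "\<dots> \<le> 2 ^ m * (A + B)" using A(1) by simp
    finally show ?thesis .
  qed
  then show "\<exists>C. \<forall>N. (1 + p powi N) ^ m * norm ((qE p ^^ k) f N) \<le> C" by blast
qed

section \<open>Surjectivity of the two transforms on sequences\<close>

lemma qpoch_inf_p_nz [simp]: "qpoch_inf p p \<noteq> 0"
  using qpoch_inf_pos[of p] p_less_1 by simp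

text \<open>By \<open>RL_qH\<close> the density of the preimage must be \<open>r powi L\<close> times that of \<open>f\<close>.  The moments of \<open>f\<close>
  vanish, so its density is flat and remains so after multiplication; transforming back stays
  within the rapidly decreasing sequences, and the flat density makes the new moments vanish.\<close>

theorem RL_surjective_seq:
  assumes w: "0 < w" "w < 1" and r: "0 < r" "r < 1"
    and f: "schwartz_seq p f" "moments_vanish p (w * r) f"
  obtains F :: "real \<Rightarrow> complex" where
    "schwartz_seq p (\<lambda>N. F (p powi N))" "moments_vanish p w (\<lambda>N. F (p powi N))"
    "(\<lambda>n. F (p powi int n)) \<longlonglongrightarrow> F 0"
    "\<And>N. (\<Sum>\<^sub>\<infinity>n. (qbinom_coeff p r n * w ^ n) *\<^sub>R F (p powi N * p ^ n)) = f N"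
    "(\<lambda>n. f (int n)) \<longlonglongrightarrow> (\<Sum>\<^sub>\<infinity>n. (qbinom_coeff p r n * w ^ n) *\<^sub>R F 0)"
proof -
  have wr: "0 < w * r" "w * r < 1" using w r mult_strict_mono[of w 1 r 1] by auto
  \<comment> \<open>the inverse of the constant in \<open>qH_inversion\<close>\<close>
  define c where "c = inverse ((w * r) * (qpoch_inf p p)\<^sup>2)"
  define k where "k L = qH p (w * r) f (p powi L)" for L
  have k: "flat_seq p k" unfolding k_def by (rule flat_qH_of_moments[OF wr f])
  have Sk: "schwartz_seq p k" using k by (rule schwartz_seq_of_flat)
  have inv: "qH p (w * r) k (p powi N) = ((w * r) * (qpoch_inf p p)\<^sup>2) *\<^sub>R f N" for N
    unfolding k_def by (intro qH_inversion wr schwartz_seq_wsummable f)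
  define u where "u L = c *\<^sub>R (r powi L *\<^sub>R k L)" for L
  have fu: "flat_seq p u" unfolding u_def by (intro flat_seq_scaleR flat_seq_powi k r)
  have Su: "schwartz_seq p u" using fu by (rule schwartz_seq_of_flat)
  have wu: "wsummable w u" using Su w by (rule schwartz_seq_wsummable)
  define F where "F = qH p w u"
  have RL: "(\<Sum>\<^sub>\<infinity>n. (qbinom_coeff p r n * w ^ n) *\<^sub>R F (Z * p ^ n)) = c *\<^sub>R qH p (w * r) k Z"
    if "Z \<in> Rq_pos0 p" for Z
  proof -
    have "(\<lambda>L. r powi (- L) *\<^sub>R u L) = (\<lambda>L. c *\<^sub>R k L)"
      using r by (simp add: u_def fun_eq_iff power_int_minus)
    then show ?thesis unfolding F_def using RL_qH[OF w r wu that] by (simp add: qH_scaleR)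
  qed
  have SF: "schwartz_seq p (\<lambda>N. F (p powi N))" unfolding F_def by (rule schwartz_seq_qH[OF w Su])
  show ?thesis
  proof (rule that[of F])
    show "schwartz_seq p (\<lambda>N. F (p powi N))" by (rule SF)
    show "moments_vanish p w (\<lambda>N. F (p powi N))"
      by (rule moments_of_flat_qH[OF w SF])
         (simp add: F_def qH_inversion[OF w wu] flat_seq_scaleR fu)
    show "(\<lambda>n. F (p powi int n)) \<longlonglongrightarrow> F 0" unfolding F_def by (rule qH_tendsto_0[OF w Su])
    show RLf: "(\<Sum>\<^sub>\<infinity>n. (qbinom_coeff p r n * w ^ n) *\<^sub>R F (p powi N * p ^ n)) = f N" for N
    proof -
      have "c * ((w * r) * (qpoch_inf p p)\<^sup>2) = 1" using w r by (simp add: c_def field_simps)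
      then show ?thesis by (simp only: RL powi_Rq_pos0 inv scaleR_scaleR scaleR_one)
    qed
    have "(\<lambda>n. c *\<^sub>R qH p (w * r) k (p powi int n)) \<longlonglongrightarrow> c *\<^sub>R qH p (w * r) k 0"
      by (intro tendsto_scaleR tendsto_const qH_tendsto_0 wr Sk)
    moreover have "c *\<^sub>R qH p (w * r) k (p powi N) = f N" for N
      using RLf[of N] by (simp add: RL)
    ultimately show "(\<lambda>n. f (int n)) \<longlonglongrightarrow> (\<Sum>\<^sub>\<infinity>n. (qbinom_coeff p r n * w ^ n) *\<^sub>R F 0)"
      using RL[OF zero_Rq_pos0] by (simp only: mult_zero_left)
  qed
qed

text \<open>By \<open>Weyl_qH\<close> the preimage has the density of \<open>f\<close>, read with the other kernel.\<close>

theorem Weyl_surjective_seq: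
  assumes w: "0 < w" "w < 1" and r: "0 < r" "r < 1"
    and f: "schwartz_seq p f" "moments_vanish p w f"
  obtains F :: "real \<Rightarrow> complex" where
    "schwartz_seq p (\<lambda>N. F (p powi N))" "moments_vanish p (w * r) (\<lambda>N. F (p powi N))"
    "(\<lambda>n. F (p powi int n)) \<longlonglongrightarrow> F 0"
    "Weyl_seq p r (\<lambda>N. F (p powi N)) = f"
    "(\<lambda>n. f (int n)) \<longlonglongrightarrow> (qpoch_inf r p / qpoch_inf p p) *\<^sub>R (\<Sum>\<^sub>\<infinity>N. r powi N *\<^sub>R F (p powi N))"
proof -
  have wr: "0 < w * r" "w * r < 1" using w r mult_strict_mono[of w 1 r 1] by auto
  define c where "c = inverse (r * (w * (qpoch_inf p p)\<^sup>2))"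
  define k where "k L = qH p w f (p powi L)" for L
  have k: "flat_seq p k" unfolding k_def by (rule flat_qH_of_moments[OF w f])
  have inv: "qH p w k (p powi N) = (w * (qpoch_inf p p)\<^sup>2) *\<^sub>R f N" for N
    unfolding k_def by (intro qH_inversion w schwartz_seq_wsummable f)
  define u where "u L = c *\<^sub>R k L" for L
  have fu: "flat_seq p u" unfolding u_def by (intro flat_seq_scaleR k)
  have Su: "schwartz_seq p u" using fu by (rule schwartz_seq_of_flat)
  have wu: "wsummable w u" using Su w by (rule schwartz_seq_wsummable)
  have wru: "wsummable (w * r) u" using Su wr by (rule schwartz_seq_wsummable)
  define F where "F = qH p (w * r) u"
  have SF: "schwartz_seq p (\<lambda>N. F (p powi N))" unfolding F_def by (rule schwartz_seq_qH[OF wr Su])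
  have uf: "r *\<^sub>R qH p w u (p powi N) = f N" for N
  proof -
    have "r * (c * (w * (qpoch_inf p p)\<^sup>2)) = 1" using w r by (simp add: c_def field_simps)
    then show ?thesis unfolding u_def by (simp only: qH_scaleR inv scaleR_scaleR scaleR_one)
  qed
  show ?thesis
  proof (rule that[of F])
    show "schwartz_seq p (\<lambda>N. F (p powi N))" by (rule SF)
    show "moments_vanish p (w * r) (\<lambda>N. F (p powi N))"
      by (rule moments_of_flat_qH[OF wr SF])
         (simp add: F_def qH_inversion[OF wr wru] flat_seq_scaleR fu)
    show "(\<lambda>n. F (p powi int n)) \<longlonglongrightarrow> F 0" unfolding F_def by (rule qH_tendsto_0[OF wr Su])
    show "Weyl_seq p r (\<lambda>N. F (p powi N)) = f"
      unfolding F_def by (rule ext) (simp add: Weyl_qH[OF w r wu] uf)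
    have "(\<lambda>n. r *\<^sub>R qH p w u (p powi int n)) \<longlonglongrightarrow> r *\<^sub>R qH p w u 0"
      by (intro tendsto_scaleR tendsto_const qH_tendsto_0 w Su)
    moreover have "(qpoch_inf r p / qpoch_inf p p) *\<^sub>R (\<Sum>\<^sub>\<infinity>N. r powi N *\<^sub>R F (p powi N)) = r *\<^sub>R qH p w u 0"
      unfolding F_def Weyl_qH_at_0[OF w r wu]
      using qpoch_inf_pos[of p] qpoch_inf_pos[of r] p_less_1 r by simp
    ultimately show "(\<lambda>n. f (int n)) \<longlonglongrightarrow> (qpoch_inf r p / qpoch_inf p p) *\<^sub>R (\<Sum>\<^sub>\<infinity>N. r powi N *\<^sub>R F (p powi N))"
      by (simp only: uf)
  qed
qed

end

section \<open>Asymptotic expansions at the origin\<close>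

definition has_expansion :: "real \<Rightarrow> (int \<Rightarrow> complex) \<Rightarrow> bool" where
  "has_expansion p f \<longleftrightarrow>
     (\<forall>K. \<exists>c C. \<forall>n::nat. norm (f (int n) - (\<Sum>j<K. (p ^ n) ^ j *\<^sub>R c j)) \<le> C * (p ^ n) ^ K)"

context q_base
begin

text \<open>Telescope towards the limit \<open>0\<close> and sum a geometric series.\<close>

lemma tail_bound:
  fixes u :: "nat \<Rightarrow> complex"
  assumes "\<And>n. norm (u n - u (Suc n)) \<le> C * (p ^ n) ^ r" "0 < r" "u \<longlonglongrightarrow> 0"
  shows "norm (u n) \<le> C / (1 - p ^ r) * (p ^ n) ^ r"
proof -
  define t where "t = p ^ r"
  have t: "0 < t" "t < 1" using p_pow_less_1[OF assms(2)] by (auto simp: t_def)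
  have pt: "(p ^ n) ^ r = t ^ n" for n by (simp add: t_def power_mult[symmetric] mult.commute)
  have C: "0 \<le> C" using assms(1)[of 0] norm_ge_zero[of "u 0 - u (Suc 0)"] by (simp del: norm_ge_zero)
  have fin: "norm (u n - u (n + m)) \<le> C * t ^ n * ((1 - t ^ m) / (1 - t))" for m
  proof (induction m)
    case (Suc m)
    have "norm (u n - u (n + Suc m)) \<le> norm (u n - u (n + m)) + norm (u (n + m) - u (Suc (n + m)))"
      using norm_triangle_ineq[of "u n - u (n + m)" "u (n + m) - u (Suc (n + m))"] by simp
    also have "\<dots> \<le> C * t ^ n * ((1 - t ^ m) / (1 - t)) + C * t ^ (n + m)"
      using Suc assms(1)[of "n + m"] unfolding pt by (intro add_mono)
    also have "\<dots> = C * t ^ n * ((1 - t ^ Suc m) / (1 - t))"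
      using t by (simp add: field_simps power_add)
    finally show ?case .
  qed simp
  have "norm (u n - u (n + m)) \<le> C * t ^ n * (1 / (1 - t))" for m
  proof (rule order_trans[OF fin])
    show "C * t ^ n * ((1 - t ^ m) / (1 - t)) \<le> C * t ^ n * (1 / (1 - t))"
      using t C by (intro mult_left_mono divide_right_mono) auto
  qed
  moreover have "(\<lambda>m. norm (u n - u (n + m))) \<longlonglongrightarrow> norm (u n - 0)"
    using LIMSEQ_ignore_initial_segment[OF assms(3), of n]
    by (intro tendsto_norm tendsto_diff tendsto_const) (simp add: add.commute)
  ultimately have "norm (u n - 0) \<le> C * t ^ n * (1 / (1 - t))"
    by (intro LIMSEQ_le_const2) auto
  then show ?thesis by (simp add: pt t_def[symmetric])
qed

text \<open>Taylor's theorem for the difference operator: an expansion of \<open>qE p f\<close> is summed to one of \<open>f\<close>, the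
  power \<open>j\<close> acquiring the factor \<open>1 / (1 - p ^ Suc j)\<close>, and the remainder is controlled by
  \<open>tail_bound\<close>.\<close>

lemma expansion_of_qE_bounds:
  assumes "\<And>j. j \<le> K \<Longrightarrow> \<exists>B. \<forall>n. norm ((qE p ^^ j) f (int n)) \<le> B"
    and "\<And>j. j < K \<Longrightarrow> (\<lambda>n. (qE p ^^ j) f (int n)) \<longlonglongrightarrow> L j"
  shows "\<exists>C. \<forall>n. norm (f (int n) - (\<Sum>j<K. (p ^ n) ^ j *\<^sub>R ((1 / qpoch p p j) *\<^sub>R L j))) \<le> C * (p ^ n) ^ K"
  using assms
proof (induction K arbitrary: f L)
  case 0
  then show ?case using 0(1)[of 0] by auto
next
  case (Suc K)
  have shift: "(qE p ^^ j) (qE p f) = (qE p ^^ Suc j) f" for j by (simp add: funpow_swap1)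
  have "\<exists>C. \<forall>n. norm (qE p f (int n) - (\<Sum>j<K. (p ^ n) ^ j *\<^sub>R ((1 / qpoch p p j) *\<^sub>R L (Suc j)))) \<le> C * (p ^ n) ^ K"
  proof (rule Suc.IH)
    show "\<exists>B. \<forall>n. norm ((qE p ^^ j) (qE p f) (int n)) \<le> B" if "j \<le> K" for j
      using Suc.prems(1)[of "Suc j"] that unfolding shift by simp
    show "(\<lambda>n. (qE p ^^ j) (qE p f) (int n)) \<longlonglongrightarrow> L (Suc j)" if "j < K" for j
      using Suc.prems(2)[of "Suc j"] that unfolding shift by simp
  qed
  then obtain C where C: "\<And>n. norm (qE p f (int n) - (\<Sum>j<K. (p ^ n) ^ j *\<^sub>R ((1 / qpoch p p j) *\<^sub>R L (Suc j)))) \<le> C * (p ^ n) ^ K"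
    by blast
  define u where "u n = f (int n) - (\<Sum>j<Suc K. (p ^ n) ^ j *\<^sub>R ((1 / qpoch p p j) *\<^sub>R L j))" for n
  have u_eq: "u n = f (int n) - L 0 - (\<Sum>j<K. (p ^ n) ^ Suc j *\<^sub>R ((1 / qpoch p p (Suc j)) *\<^sub>R L (Suc j)))" for n
    unfolding u_def sum.lessThan_Suc_shift by simp
  have "u n - u (Suc n) = p ^ n *\<^sub>R (qE p f (int n) - (\<Sum>j<K. (p ^ n) ^ j *\<^sub>R ((1 / qpoch p p j) *\<^sub>R L (Suc j))))" for n
  proof -
    have 1: "f (int n) - f (int (Suc n)) = p ^ n *\<^sub>R qE p f (int n)"
      by (simp add: qE_def power_int_minus add.commute)
    have 2: "(p ^ n) ^ Suc j *\<^sub>R ((1 / qpoch p p (Suc j)) *\<^sub>R L (Suc j)) - (p ^ Suc n) ^ Suc j *\<^sub>R ((1 / qpoch p p (Suc j)) *\<^sub>R L (Suc j))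
      = p ^ n *\<^sub>R ((p ^ n) ^ j *\<^sub>R ((1 / qpoch p p j) *\<^sub>R L (Suc j)))" for j
    proof -
      have nz: "1 - p ^ Suc j \<noteq> 0" using p_pow_less_1[of "Suc j"] by simp
      have "((p ^ n) ^ Suc j - (p ^ Suc n) ^ Suc j) * (1 / qpoch p p (Suc j))
          = (p ^ n) ^ Suc j * (1 - p ^ Suc j) * (1 / (qpoch p p j * (1 - p ^ Suc j)))"
        by (simp add: qpoch_Suc power_mult_distrib algebra_simps)
      also have "\<dots> = p ^ n * ((p ^ n) ^ j * (1 / qpoch p p j))"
        using nz by (simp del: power_Suc add: power_Suc[of "p ^ n"])
      finally show ?thesis by (simp only: scaleR_scaleR scaleR_left_diff_distrib[symmetric] left_diff_distrib[symmetric])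
    qed
    have "u n - u (Suc n) = (f (int n) - f (int (Suc n)))
      - (\<Sum>j<K. (p ^ n) ^ Suc j *\<^sub>R ((1 / qpoch p p (Suc j)) *\<^sub>R L (Suc j)) - (p ^ Suc n) ^ Suc j *\<^sub>R ((1 / qpoch p p (Suc j)) *\<^sub>R L (Suc j)))"
      unfolding u_eq sum_subtractf by simp
    then show ?thesis unfolding 1 2 by (simp only: scaleR_diff_right scaleR_sum_right)
  qed
  then have "norm (u n - u (Suc n)) = p ^ n * norm (qE p f (int n) - (\<Sum>j<K. (p ^ n) ^ j *\<^sub>R ((1 / qpoch p p j) *\<^sub>R L (Suc j))))" for n
    by simp
  then have "norm (u n - u (Suc n)) \<le> C * (p ^ n) ^ Suc K" for n
    using mult_left_mono[OF C[of n], of "p ^ n"] by (simp add: mult_ac)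
  moreover have "u \<longlonglongrightarrow> L 0 - L 0 - (\<Sum>j<K. 0 ^ Suc j *\<^sub>R ((1 / qpoch p p (Suc j)) *\<^sub>R L (Suc j)))"
    unfolding u_eq[abs_def] using Suc.prems(2)[of 0] p_pos p_less_1
    by (intro tendsto_intros LIMSEQ_power_zero) auto
  ultimately have "norm (u n) \<le> C / (1 - p ^ Suc K) * (p ^ n) ^ Suc K" for n
    by (intro tail_bound) auto
  then show ?case unfolding u_def by blast
qed

lemma convergent_of_geometric_steps:
  fixes f :: "nat \<Rightarrow> complex"
  assumes "\<And>n. norm (f n - f (Suc n)) \<le> B * p ^ n"
  shows "convergent f"
proof -
  have "summable (\<lambda>n. f (Suc n) - f n)"
  proof (rule summable_comparison_test')
    show "summable (\<lambda>n. B * p ^ n)" using p_pos p_less_1 by (intro summable_mult summable_geometric) auto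
    show "norm (f (Suc n) - f n) \<le> B * p ^ n" for n using assms[of n] by (simp add: norm_minus_commute)
  qed
  then have "convergent (\<lambda>n. \<Sum>i<n. f (Suc i) - f i)" by (simp add: summable_iff_convergent)
  then have "convergent (\<lambda>n. f 0 + (\<Sum>i<n. f (Suc i) - f i))"
    by (intro convergent_add convergent_const)
  then show ?thesis by (simp add: sum_lessThan_telescope)
qed

lemma schwartz_seq_bounded:
  assumes "schwartz_seq p f"
  shows "\<exists>B. \<forall>N. norm ((qE p ^^ j) f N) \<le> B"
  using schwartz_seqD[OF assms, of 0 j] by auto

lemma schwartz_seq_expansion:
  assumes "schwartz_seq p f"
  obtains c where "\<And>K. \<exists>C. \<forall>n::nat. norm (f (int n) - (\<Sum>j<K. (p ^ n) ^ j *\<^sub>R c j)) \<le> C * (p ^ n) ^ K"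
    "(\<lambda>n. f (int n)) \<longlonglongrightarrow> c 0"
proof -
  define L where "L j = lim (\<lambda>n. (qE p ^^ j) f (int n))" for j
  have L: "(\<lambda>n. (qE p ^^ j) f (int n)) \<longlonglongrightarrow> L j" for j
  proof -
    obtain B where B: "\<And>N. norm ((qE p ^^ Suc j) f N) \<le> B"
      using schwartz_seq_bounded[OF assms, of "Suc j"] by blast
    have "norm ((qE p ^^ j) f (int n) - (qE p ^^ j) f (int (Suc n))) \<le> B * p ^ n" for n
    proof -
      have "(qE p ^^ j) f (int n) - (qE p ^^ j) f (int (Suc n)) = p ^ n *\<^sub>R (qE p ^^ Suc j) f (int n)"
        by (simp add: qE_def power_int_minus add.commute)
      then show ?thesis using mult_left_mono[OF B[of "int n"], of "p ^ n"] by (simp add: mult.commute)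
    qed
    then have "convergent (\<lambda>n. (qE p ^^ j) f (int n))" by (rule convergent_of_geometric_steps)
    then show ?thesis unfolding L_def by (simp add: convergent_LIMSEQ_iff)
  qed
  show ?thesis
  proof (rule that[of "\<lambda>j. (1 / qpoch p p j) *\<^sub>R L j"])
    show "\<exists>C. \<forall>n::nat. norm (f (int n) - (\<Sum>j<K. (p ^ n) ^ j *\<^sub>R ((1 / qpoch p p j) *\<^sub>R L j))) \<le> C * (p ^ n) ^ K" for K
      using schwartz_seq_bounded[OF assms] by (intro expansion_of_qE_bounds L) meson
    show "(\<lambda>n. f (int n)) \<longlonglongrightarrow> (1 / qpoch p p 0) *\<^sub>R L 0" using L[of 0] by simp
  qed
qed

lemma has_expansion_qE:
  assumes "has_expansion p f"
  shows "has_expansion p (qE p f)"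
  unfolding has_expansion_def
proof
  fix K
  obtain c C where C: "\<And>n. norm (f (int n) - (\<Sum>j<Suc K. (p ^ n) ^ j *\<^sub>R c j)) \<le> C * (p ^ n) ^ Suc K"
    using assms unfolding has_expansion_def by blast
  define R where "R n = f (int n) - (\<Sum>j<Suc K. (p ^ n) ^ j *\<^sub>R c j)" for n
  define d where "d j = (1 - p ^ Suc j) *\<^sub>R c (Suc j)" for j
  have "norm (qE p f (int n) - (\<Sum>j<K. (p ^ n) ^ j *\<^sub>R d j)) \<le> (C + C * p ^ Suc K) * (p ^ n) ^ K" for n
  proof -
    have "f (int n) - f (int (Suc n)) = p ^ n *\<^sub>R (\<Sum>j<K. (p ^ n) ^ j *\<^sub>R d j) + (R n - R (Suc n))"
    proof -
      have f_eq: "f (int n) = c 0 + (\<Sum>j<K. (p ^ n) ^ Suc j *\<^sub>R c (Suc j)) + R n" for n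
        unfolding R_def sum.lessThan_Suc_shift by simp
      have "f (int n) - f (int (Suc n)) = (\<Sum>j<K. (p ^ n) ^ Suc j *\<^sub>R c (Suc j) - (p ^ Suc n) ^ Suc j *\<^sub>R c (Suc j)) + (R n - R (Suc n))"
        unfolding f_eq[of n] f_eq[of "Suc n"] sum_subtractf by (simp only: algebra_simps)
      also have "(\<Sum>j<K. (p ^ n) ^ Suc j *\<^sub>R c (Suc j) - (p ^ Suc n) ^ Suc j *\<^sub>R c (Suc j)) = p ^ n *\<^sub>R (\<Sum>j<K. (p ^ n) ^ j *\<^sub>R d j)"
        unfolding scaleR_sum_right d_def
        by (intro sum.cong) (simp_all add: power_mult_distrib algebra_simps flip: scaleR_left_diff_distrib)
      finally show ?thesis .
    qed
    moreover have "qE p f (int n) = inverse (p ^ n) *\<^sub>R (f (int n) - f (int (Suc n)))"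
      by (simp add: qE_def power_int_minus add.commute)
    ultimately have "qE p f (int n) - (\<Sum>j<K. (p ^ n) ^ j *\<^sub>R d j) = inverse (p ^ n) *\<^sub>R (R n - R (Suc n))"
      by (simp add: scaleR_add_right)
    then have "norm (qE p f (int n) - (\<Sum>j<K. (p ^ n) ^ j *\<^sub>R d j)) = inverse (p ^ n) * norm (R n - R (Suc n))"
      by (simp add: power_inverse)
    also have "\<dots> \<le> inverse (p ^ n) * (C * (p ^ n) ^ Suc K + C * (p ^ Suc n) ^ Suc K)"
      using C[of n] C[of "Suc n"] unfolding R_def[symmetric]
      by (intro mult_left_mono order_trans[OF norm_triangle_ineq4] add_mono) auto
    also have "\<dots> = (C + C * p ^ Suc K) * (p ^ n) ^ K"
      by (simp add: power_mult_distrib field_simps)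
    finally show ?thesis .
  qed
  then show "\<exists>c C. \<forall>n. norm (qE p f (int n) - (\<Sum>j<K. (p ^ n) ^ j *\<^sub>R c j)) \<le> C * (p ^ n) ^ K" by blast
qed

text \<open>Near \<open>0\<close> the differences inherit expansions, hence are bounded; near infinity \<open>qE\<close> divides by
  something large and decay is inherited directly.\<close>

lemma schwartz_seqI:
  assumes "has_expansion p f" "\<And>m. \<exists>C. \<forall>N. (1 + p powi N) ^ m * norm (f N) \<le> C"
  shows "schwartz_seq p f"
proof -
  have ex: "has_expansion p ((qE p ^^ k) f)" for k
    by (induction k) (simp_all add: assms has_expansion_qE)
  have "\<forall>m. \<exists>C. \<forall>N. (1 + p powi N) ^ m * norm ((qE p ^^ k) f N) \<le> C" for k
  proof (induction k)
    case 0
    then show ?case using assms(2) by simp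
  next
    case (Suc k)
    define g where "g = (qE p ^^ k) f"
    show ?case
    proof
      fix m
      obtain C where C: "\<And>N. (1 + p powi N) ^ m * norm (g N) \<le> C" using Suc g_def by blast
      obtain c D where "\<And>n. norm ((qE p ^^ Suc k) f (int n) - (\<Sum>j<0. (p ^ n) ^ j *\<^sub>R c j)) \<le> D * (p ^ n) ^ 0"
        using ex[of "Suc k"] unfolding has_expansion_def by blast
      then have D: "norm (qE p g (int n)) \<le> D" for n by (simp add: g_def)
      have C0: "0 \<le> C" using C[of 0] by (meson norm_ge_zero mult_nonneg_nonneg order_trans powi_pos add_nonneg_nonneg zero_le_one less_imp_le zero_le_power)
      have D0: "0 \<le> D" using D[of 0] norm_ge_zero order_trans by blast
      have "(1 + p powi N) ^ m * norm (qE p g N) \<le> 2 ^ m * D + (C + (1 + inverse p) ^ m * C)" for N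
      proof (cases "0 \<le> N")
        case True
        then have N: "N = int (nat N)" by simp
        have "(1 + p powi N) ^ m * norm (qE p g N) \<le> 2 ^ m * D"
          using D[of "nat N"] N power_int_le_one[of p N] True
          by (intro mult_mono power_mono) (auto intro: add_nonneg_nonneg)
        moreover have "0 \<le> C + (1 + inverse p) ^ m * C" using C0 p_pos by (simp add: add_nonneg_nonneg)
        ultimately show ?thesis by linarith
      next
        case False
        have le1: "p powi (- N) \<le> 1" using False by (intro power_int_le_one) auto
        have "norm (qE p g N) \<le> 1 * (norm (g N) + norm (g (N + 1)))"
          unfolding qE_def norm_scaleR using le1
          by (intro mult_mono norm_triangle_ineq4) auto
        then have "(1 + p powi N) ^ m * norm (qE p g N)
            \<le> (1 + p powi N) ^ m * norm (g N) + (1 + p powi N) ^ m * norm (g (N + 1))"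
          using mult_left_mono[of "norm (qE p g N)" "norm (g N) + norm (g (N + 1))" "(1 + p powi N) ^ m"]
          by (simp add: distrib_left add_nonneg_nonneg)
        also have "(1 + p powi N) ^ m * norm (g (N + 1)) \<le> ((1 + inverse p) * (1 + p powi (N + 1))) ^ m * norm (g (N + 1))"
          using one_plus_powi_shift[of N 1]
          by (intro mult_right_mono power_mono) (auto simp: power_int_minus intro: add_nonneg_nonneg)
        also have "\<dots> = (1 + inverse p) ^ m * ((1 + p powi (N + 1)) ^ m * norm (g (N + 1)))"
          by (simp add: power_mult_distrib)
        also have "\<dots> \<le> (1 + inverse p) ^ m * C"
          using C p_pos by (intro mult_left_mono) (auto intro: add_nonneg_nonneg)
        finally have "(1 + p powi N) ^ m * norm (qE p g N) \<le> C + (1 + inverse p) ^ m * C"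
          using C[of N] by linarith
        moreover have "0 \<le> 2 ^ m * D" using D0 by simp
        ultimately show ?thesis by linarith
      qed
      then show "\<exists>C. \<forall>N. (1 + p powi N) ^ m * norm ((qE p ^^ Suc k) f N) \<le> C" by (auto simp: g_def)
    qed
  qed
  then show ?thesis unfolding schwartz_seq_def by blast
qed

end

section \<open>The function space on the real line\<close>

locale jackson = fixes q :: real assumes q_pos: "0 < q" and q_less_1: "q < 1"

sublocale jackson \<subseteq> Q: q_base q
  by unfold_locales (use q_pos q_less_1 in auto)

sublocale jackson \<subseteq> P: q_base "q\<^sup>2"
  using q_pos q_less_1 by unfold_locales (auto simp: power_less_one_iff)

context jackson
begin

lemma q2_powi: "(q\<^sup>2) powi N = (q powi N)\<^sup>2"
  by (simp add: power_int_power power_int_power' mult.commute)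

lemma qderiv_nz: "x \<noteq> 0 \<Longrightarrow> qderiv q f x = (f x - f (q * x)) /\<^sub>R ((1 - q) * x)"
  by (simp add: qderiv_def)

lemma qderiv_lattice:
  "(qderiv q ^^ k) F (q powi N) = (1 / (1 - q)) ^ k *\<^sub>R (qE q ^^ k) (\<lambda>N. F (q powi N)) N"
proof (induction k arbitrary: N)
  case (Suc k)
  have q: "q * q powi N = q powi (N + 1)" by (simp add: power_int_add mult.commute)
  have "(qderiv q ^^ Suc k) F (q powi N) = ((qderiv q ^^ k) F (q powi N) - (qderiv q ^^ k) F (q powi (N + 1))) /\<^sub>R ((1 - q) * q powi N)"
    by (simp add: qderiv_nz q)
  also have "\<dots> = (1 / (1 - q)) ^ Suc k *\<^sub>R (qE q ^^ Suc k) (\<lambda>N. F (q powi N)) N"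
    unfolding Suc
    by (simp add: qE_def power_int_minus scaleR_diff_right divide_inverse mult_ac)
  finally show ?case .
qed simp

lemma qderiv_parity:
  assumes "\<And>x. F (- x) = F x" "x \<noteq> 0"
  shows "(qderiv q ^^ k) F (- x) = (- 1) ^ k *\<^sub>R (qderiv q ^^ k) F x"
  using assms(2)
proof (induction k arbitrary: x)
  case (Suc k)
  have "(qderiv q ^^ Suc k) F (- x)
      = ((qderiv q ^^ k) F (- x) - (qderiv q ^^ k) F (- (q * x))) /\<^sub>R ((1 - q) * (- x))"
    using Suc.prems by (simp add: qderiv_nz del: inverse_minus_eq mult_minus_right)
  also have "\<dots> = (- 1) ^ Suc k *\<^sub>R (((qderiv q ^^ k) F x - (qderiv q ^^ k) F (q * x)) /\<^sub>R ((1 - q) * x))"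
  proof -
    have "(qderiv q ^^ k) F (- x) - (qderiv q ^^ k) F (- (q * x))
        = (- 1) ^ k *\<^sub>R ((qderiv q ^^ k) F x - (qderiv q ^^ k) F (q * x))"
      using Suc.prems q_pos Suc.IH[of x] Suc.IH[of "q * x"] by (simp add: scaleR_diff_right)
    moreover have "inverse ((1 - q) * - x) = - inverse ((1 - q) * x)"
      by (simp only: mult_minus_right inverse_minus_eq)
    ultimately show ?thesis
      by (simp add: mult.commute)
  qed
  finally show ?case using Suc.prems by (simp add: qderiv_nz)
qed (simp add: assms(1))

lemma Rq_mem [simp]: "q powi N \<in> Rq q" "- (q powi N) \<in> Rq q" "0 \<in> Rq q" "q ^ n \<in> Rq q"
proof -
  show "q ^ n \<in> Rq q" unfolding Rq_def Rq_pos_def by (metis UnCI power_int_of_nat rangeI)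
qed (auto simp: Rq_def Rq_pos_def)

lemma Rq_mult_pow: "x \<in> Rq q \<Longrightarrow> x * q ^ n \<in> Rq q"
proof -
  have "q powi N * q ^ n \<in> Rq_pos q" for N
    using rangeI[of "\<lambda>n. q powi n" "N + int n"] q_pos by (simp add: Rq_pos_def power_int_add)
  then show "x \<in> Rq q \<Longrightarrow> x * q ^ n \<in> Rq q" by (auto simp: Rq_def Rq_pos_def)
qed

lemma q_pow_tendsto_0: "(\<lambda>n. q ^ n) \<longlonglongrightarrow> 0"
  using q_pos q_less_1 by (intro LIMSEQ_power_zero) auto

lemma sum_even_terms:
  fixes a :: "nat \<Rightarrow> 'a::real_normed_vector"
  assumes "\<And>j. odd j \<Longrightarrow> a j = 0"
  shows "(\<Sum>j<2 * K. a j) = (\<Sum>j<K. a (2 * j))" "(\<Sum>j<2 * K + 1. a j) = (\<Sum>j<Suc K. a (2 * j))"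
proof -
  show "(\<Sum>j<2 * K. a j) = (\<Sum>j<K. a (2 * j))" by (induction K) (simp_all add: assms)
  then show "(\<Sum>j<2 * K + 1. a j) = (\<Sum>j<Suc K. a (2 * j))" by simp
qed

text \<open>On the lattice the \<open>q\<close>-derivatives are the iterates of \<open>qE q\<close>, so the function has a Taylor expansion
  in powers of \<open>q ^ n\<close>.  Continuity of an odd-order derivative at \<open>0\<close> together with its oddness
  removes the odd powers, leaving an expansion in powers of \<open>p ^ n\<close>.\<close>

theorem S_q_imp_schwartz_seq:
  assumes "f \<in> S_q q"
  shows "schwartz_seq (q\<^sup>2) (\<lambda>N. f (q powi N))" "(\<lambda>n. f (q ^ n)) \<longlonglongrightarrow> f 0"
    "x \<in> Rq q \<Longrightarrow> f (- x) = f x" "f \<in> extensional (Rq q)"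
proof -
  obtain F where F: "f = restrict F (Rq q)" "\<And>x. F (- x) = F x" "inf_q_differentiable q F"
    and bdd: "\<And>n m. bdd_above ((\<lambda>(x, k). cmod ((1 + x\<^sup>2) ^ m *\<^sub>R (qderiv q ^^ k) F x)) ` (UNIV \<times> {..n::nat}))"
    using assms unfolding S_q_def by blast
  have bd: "\<exists>B. \<forall>x. (1 + x\<^sup>2) ^ m * cmod ((qderiv q ^^ k) F x) \<le> B" for m k
  proof -
    obtain B where B: "\<And>y. y \<in> (\<lambda>(x, k). cmod ((1 + x\<^sup>2) ^ m *\<^sub>R (qderiv q ^^ k) F x)) ` (UNIV \<times> {..k}) \<Longrightarrow> y \<le> B"
      using bdd[of m k] unfolding bdd_above_def by blast
    have "(1 + x\<^sup>2) ^ m * cmod ((qderiv q ^^ k) F x) \<le> B" for x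
    proof -
      have "cmod ((1 + x\<^sup>2) ^ m *\<^sub>R (qderiv q ^^ k) F x) \<le> B"
        by (rule B) (rule image_eqI[of _ _ "(x, k)"], auto)
      then show ?thesis by (simp add: abs_of_nonneg add_nonneg_nonneg)
    qed
    then show ?thesis by blast
  qed
  have cont: "isCont ((qderiv q ^^ k) F) 0" for k
    using F(3) unfolding inf_q_differentiable_def
    by (metis differentiable_imp_continuous_within)
  define s where "s N = F (q powi N)" for N
  have fs: "(\<lambda>N. f (q powi N)) = s" by (simp add: F(1) s_def fun_eq_iff)
  define L where "L k = (1 - q) ^ k *\<^sub>R (qderiv q ^^ k) F 0" for k
  have sq: "(qE q ^^ k) s N = (1 - q) ^ k *\<^sub>R (qderiv q ^^ k) F (q powi N)" for k N
    using q_less_1 by (simp add: qderiv_lattice s_def[abs_def] power_divide)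
  have lim: "(\<lambda>n. (qderiv q ^^ k) F (q ^ n)) \<longlonglongrightarrow> (qderiv q ^^ k) F 0" for k
    by (rule isCont_tendsto_compose[OF cont q_pow_tendsto_0])
  have L: "(\<lambda>n. (qE q ^^ k) s (int n)) \<longlonglongrightarrow> L k" for k
    unfolding L_def sq power_int_of_nat by (intro tendsto_scaleR tendsto_const lim)
  have odd: "L k = 0" if "odd k" for k
  proof -
    have "(\<lambda>n. (qderiv q ^^ k) F (- (q ^ n))) \<longlonglongrightarrow> (qderiv q ^^ k) F 0"
      using tendsto_minus[OF q_pow_tendsto_0] by (intro isCont_tendsto_compose[OF cont]) simp
    moreover have "(qderiv q ^^ k) F (- (q ^ n)) = - (qderiv q ^^ k) F (q ^ n)" for n
      using that q_pos qderiv_parity[of F "q ^ n" k] F(2) by simp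
    ultimately have "(\<lambda>n. - (qderiv q ^^ k) F (q ^ n)) \<longlonglongrightarrow> (qderiv q ^^ k) F 0" by simp
    from LIMSEQ_unique[OF this tendsto_minus[OF lim]]
    have "(qderiv q ^^ k) F 0 = - (qderiv q ^^ k) F 0" .
    then have "(qderiv q ^^ k) F 0 = 0" by (simp add: equal_neg_zero)
    then show ?thesis by (simp add: L_def)
  qed
  have bE: "\<exists>B. \<forall>n. norm ((qE q ^^ k) s (int n)) \<le> B" for k
  proof -
    obtain B where B: "\<And>x. (1 + x\<^sup>2) ^ 0 * cmod ((qderiv q ^^ k) F x) \<le> B" using bd by blast
    have "norm ((qE q ^^ k) s (int n)) \<le> \<bar>1 - q\<bar> ^ k * B" for n
      unfolding sq norm_scaleR power_abs using B[of "q powi int n"] by (intro mult_left_mono) auto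
    then show ?thesis by blast
  qed
  have "has_expansion (q\<^sup>2) s"
    unfolding has_expansion_def
  proof
    fix K
    obtain C where C: "\<And>n. norm (s (int n) - (\<Sum>j<2 * K. (q ^ n) ^ j *\<^sub>R ((1 / qpoch q q j) *\<^sub>R L j))) \<le> C * (q ^ n) ^ (2 * K)"
      using Q.expansion_of_qE_bounds[of "2 * K" s L] bE L by blast
    have "(q ^ n) ^ (2 * j) = ((q\<^sup>2) ^ n) ^ j" for n j
      by (simp add: mult_ac flip: power_mult)
    then have "norm (s (int n) - (\<Sum>j<K. ((q\<^sup>2) ^ n) ^ j *\<^sub>R ((1 / qpoch q q (2 * j)) *\<^sub>R L (2 * j)))) \<le> C * ((q\<^sup>2) ^ n) ^ K" for n
      using C[of n] odd by (simp add: sum_even_terms(1))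
    then show "\<exists>c C. \<forall>n. norm (s (int n) - (\<Sum>j<K. ((q\<^sup>2) ^ n) ^ j *\<^sub>R c j)) \<le> C * ((q\<^sup>2) ^ n) ^ K"
      by (intro exI[of _ "\<lambda>j. (1 / qpoch q q (2 * j)) *\<^sub>R L (2 * j)"] exI[of _ C]) blast
  qed
  moreover have "\<exists>C. \<forall>N. (1 + (q\<^sup>2) powi N) ^ m * norm (s N) \<le> C" for m
    using bd[of m 0] unfolding s_def q2_powi by auto
  ultimately have "schwartz_seq (q\<^sup>2) s" by (rule P.schwartz_seqI)
  then show "schwartz_seq (q\<^sup>2) (\<lambda>N. f (q powi N))" by (simp add: fs)
  show "(\<lambda>n. f (q ^ n)) \<longlonglongrightarrow> f 0" using lim[of 0] by (simp add: F(1))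
  show "f (- x) = f x" if "x \<in> Rq q"
  proof -
    have "- x \<in> Rq q" using that by (auto simp: Rq_def)
    then show ?thesis using that by (simp add: F(1,2))
  qed
  show "f \<in> extensional (Rq q)" by (simp add: F(1))
qed

end

text \<open>A condition that is stable under \<open>qderiv\<close> and implies differentiability at \<open>0\<close>.  Choosing the
  coefficients anew for each \<open>K\<close> avoids any discussion of their uniqueness.\<close>

definition origin_expansion :: "(real \<Rightarrow> complex) \<Rightarrow> bool" where
  "origin_expansion F \<longleftrightarrow>
     (\<forall>K. \<exists>c C. \<forall>x. \<bar>x\<bar> \<le> 1 \<longrightarrow> norm (F x - (\<Sum>j<K. x ^ j *\<^sub>R c j)) \<le> C * \<bar>x\<bar> ^ K)"

definition rapid :: "(real \<Rightarrow> complex) \<Rightarrow> bool" where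
  "rapid F \<longleftrightarrow> (\<forall>m. \<exists>C. \<forall>x. (1 + x\<^sup>2) ^ m * norm (F x) \<le> C)"

lemma origin_expansion_lower:
  assumes "K \<le> K'" "\<forall>x. \<bar>x\<bar> \<le> 1 \<longrightarrow> norm (F x - (\<Sum>j<K'. x ^ j *\<^sub>R c j)) \<le> C * \<bar>x\<bar> ^ K'"
  shows "\<exists>C. \<forall>x. \<bar>x\<bar> \<le> 1 \<longrightarrow> norm (F x - (\<Sum>j<K. x ^ j *\<^sub>R c j)) \<le> C * \<bar>x\<bar> ^ K"
  using assms
proof (induction K' arbitrary: C rule: dec_induct)
  case base
  then show ?case by blast
next
  case (step K')
  have "\<forall>x. \<bar>x\<bar> \<le> 1 \<longrightarrow> norm (F x - (\<Sum>j<K'. x ^ j *\<^sub>R c j)) \<le> (\<bar>C\<bar> + norm (c K')) * \<bar>x\<bar> ^ K'"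
  proof (intro allI impI)
    fix x :: real assume x: "\<bar>x\<bar> \<le> 1"
    have "norm (F x - (\<Sum>j<K'. x ^ j *\<^sub>R c j)) \<le> norm (F x - (\<Sum>j<Suc K'. x ^ j *\<^sub>R c j)) + norm (x ^ K' *\<^sub>R c K')"
      using norm_triangle_ineq[of "F x - (\<Sum>j<Suc K'. x ^ j *\<^sub>R c j)" "x ^ K' *\<^sub>R c K'"] by simp
    also have "norm (F x - (\<Sum>j<Suc K'. x ^ j *\<^sub>R c j)) \<le> C * \<bar>x\<bar> ^ Suc K'" using step.prems x by blast
    also have "C * \<bar>x\<bar> ^ Suc K' \<le> \<bar>C\<bar> * (1 * \<bar>x\<bar> ^ K')"
      unfolding power_Suc using x by (intro mult_mono) auto
    finally show "norm (F x - (\<Sum>j<K'. x ^ j *\<^sub>R c j)) \<le> (\<bar>C\<bar> + norm (c K')) * \<bar>x\<bar> ^ K'"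
      by (simp add: power_abs algebra_simps)
  qed
  then show ?case by (rule step.IH)
qed

lemma origin_expansion_differentiable:
  assumes "\<forall>x. \<bar>x\<bar> \<le> 1 \<longrightarrow> norm (F x - (\<Sum>j<2. x ^ j *\<^sub>R c j)) \<le> C * \<bar>x\<bar> ^ 2"
  shows "(F has_vector_derivative c 1) (at 0)"
proof -
  have F: "norm (F x - c 0 - x *\<^sub>R c 1) \<le> C * \<bar>x\<bar> ^ 2" if "\<bar>x\<bar> \<le> 1" for x
  proof -
    have "F x - (\<Sum>j<2. x ^ j *\<^sub>R c j) = F x - c 0 - x *\<^sub>R c 1"
      by (simp add: eval_nat_numeral)
    then show ?thesis using assms that by (metis (no_types))
  qed
  have F0: "F 0 = c 0" using F[of 0] by simp
  have "((\<lambda>y. (1 / norm (y - 0)) *\<^sub>R (F y - (F 0 + (y - 0) *\<^sub>R c 1))) \<longlongrightarrow> 0) (at 0)"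
  proof (rule Lim_null_comparison)
    have "\<forall>\<^sub>F y in at (0::real). \<bar>y\<bar> < 1"
      using eventually_at_ball[of 1 "0::real" UNIV] by (auto elim!: eventually_mono simp: dist_real_def)
    moreover have "\<forall>\<^sub>F y in at (0::real). y \<noteq> 0" by (rule eventually_neq_at_within)
    ultimately show "\<forall>\<^sub>F y in at 0. norm ((1 / norm (y - 0)) *\<^sub>R (F y - (F 0 + (y - 0) *\<^sub>R c 1))) \<le> C * \<bar>y\<bar>"
    proof eventually_elim
      case (elim y)
      then show ?case using F[of y] by (simp add: F0 divide_le_eq power2_eq_square mult.assoc diff_diff_eq)
    qed
    have "((\<lambda>y::real. C * \<bar>y\<bar>) \<longlongrightarrow> C * \<bar>0\<bar>) (at 0)" by (intro tendsto_intros)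
    then show "((\<lambda>y::real. C * \<bar>y\<bar>) \<longlongrightarrow> 0) (at 0)" by simp
  qed
  then show ?thesis
    unfolding has_vector_derivative_def has_derivative_at2[of F] by (auto intro: bounded_linear_scaleR_left)
qed

context jackson
begin

lemma origin_expansion_imp_differentiable: "origin_expansion F \<Longrightarrow> F differentiable (at 0)"
  using origin_expansion_differentiable
  unfolding origin_expansion_def by (metis has_vector_derivative_def differentiable_def)

lemma origin_expansion_qderiv:
  assumes "origin_expansion F"
  shows "origin_expansion (qderiv q F)"
  unfolding origin_expansion_def
proof
  fix K
  obtain c C where C: "\<forall>x. \<bar>x\<bar> \<le> 1 \<longrightarrow> norm (F x - (\<Sum>j<Suc (Suc K). x ^ j *\<^sub>R c j)) \<le> C * \<bar>x\<bar> ^ Suc (Suc K)"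
    using assms unfolding origin_expansion_def by blast
  define d where "d j = ((1 - q ^ Suc j) / (1 - q)) *\<^sub>R c (Suc j)" for j
  define R where "R x = F x - (\<Sum>j<Suc (Suc K). x ^ j *\<^sub>R c j)" for x
  have R: "norm (R x) \<le> C * \<bar>x\<bar> ^ Suc (Suc K)" if "\<bar>x\<bar> \<le> 1" for x using C that by (simp add: R_def)
  have F_eq: "F x = c 0 + (\<Sum>j<Suc K. x ^ Suc j *\<^sub>R c (Suc j)) + R x" for x
    unfolding R_def sum.lessThan_Suc_shift[of _ "Suc K"] by simp
  define D where "D = (C + C * q ^ Suc (Suc K)) / (1 - q)"
  have nz: "norm (qderiv q F x - (\<Sum>j<Suc K. x ^ j *\<^sub>R d j)) \<le> D * \<bar>x\<bar> ^ Suc K" if x: "\<bar>x\<bar> \<le> 1" "x \<noteq> 0" for x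
  proof -
    have qx: "\<bar>q * x\<bar> \<le> 1" using x q_pos q_less_1 mult_le_one[of q "\<bar>x\<bar>"] by (simp add: abs_mult)
    have "F x - F (q * x) = (\<Sum>j<Suc K. x ^ Suc j *\<^sub>R c (Suc j) - (q * x) ^ Suc j *\<^sub>R c (Suc j)) + (R x - R (q * x))"
      unfolding F_eq[of x] F_eq[of "q * x"] sum_subtractf by (simp only: algebra_simps)
    also have "(\<Sum>j<Suc K. x ^ Suc j *\<^sub>R c (Suc j) - (q * x) ^ Suc j *\<^sub>R c (Suc j)) = ((1 - q) * x) *\<^sub>R (\<Sum>j<Suc K. x ^ j *\<^sub>R d j)"
      unfolding scaleR_sum_right d_def
    proof (rule sum.cong)
      fix j
      have "x ^ Suc j - (q * x) ^ Suc j = ((1 - q) * x) * (x ^ j * ((1 - q ^ Suc j) / (1 - q)))"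
        using q_less_1 by (simp add: power_mult_distrib field_simps)
      then show "x ^ Suc j *\<^sub>R c (Suc j) - (q * x) ^ Suc j *\<^sub>R c (Suc j)
          = ((1 - q) * x) *\<^sub>R x ^ j *\<^sub>R ((1 - q ^ Suc j) / (1 - q)) *\<^sub>R c (Suc j)"
        by (simp only: scaleR_scaleR scaleR_left_diff_distrib[symmetric])
    qed simp
    finally have "qderiv q F x - (\<Sum>j<Suc K. x ^ j *\<^sub>R d j) = inverse ((1 - q) * x) *\<^sub>R (R x - R (q * x))"
      using x q_less_1 by (simp add: qderiv_nz scaleR_add_right del: inverse_mult_distrib)
    then have "norm (qderiv q F x - (\<Sum>j<Suc K. x ^ j *\<^sub>R d j)) = inverse ((1 - q) * \<bar>x\<bar>) * norm (R x - R (q * x))"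
      using q_less_1 by (simp add: abs_mult)
    also have "\<dots> \<le> inverse ((1 - q) * \<bar>x\<bar>) * (C * \<bar>x\<bar> ^ Suc (Suc K) + C * \<bar>q * x\<bar> ^ Suc (Suc K))"
      using R[OF x(1)] R[OF qx] q_less_1
      by (intro mult_left_mono order_trans[OF norm_triangle_ineq4] add_mono) auto
    also have "\<dots> = D * \<bar>x\<bar> ^ Suc K"
      using x q_pos q_less_1 by (simp add: D_def abs_mult power_mult_distrib field_simps)
    finally show ?thesis .
  qed
  have at0: "qderiv q F 0 = d 0"
  proof -
    obtain C2 where "\<forall>x. \<bar>x\<bar> \<le> 1 \<longrightarrow> norm (F x - (\<Sum>j<2. x ^ j *\<^sub>R c j)) \<le> C2 * \<bar>x\<bar> ^ 2"
      using origin_expansion_lower[OF _ C, of 2] by auto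
    then have "vector_derivative F (at 0) = c 1"
      by (rule vector_derivative_at[OF origin_expansion_differentiable])
    then show ?thesis using q_less_1 by (simp add: qderiv_def d_def)
  qed
  have "\<forall>x. \<bar>x\<bar> \<le> 1 \<longrightarrow> norm (qderiv q F x - (\<Sum>j<Suc K. x ^ j *\<^sub>R d j)) \<le> D * \<bar>x\<bar> ^ Suc K"
  proof (intro allI impI)
    fix x :: real assume x: "\<bar>x\<bar> \<le> 1"
    show "norm (qderiv q F x - (\<Sum>j<Suc K. x ^ j *\<^sub>R d j)) \<le> D * \<bar>x\<bar> ^ Suc K"
    proof (cases "x = 0")
      case True
      have "(\<Sum>j<Suc K. (0::real) ^ j *\<^sub>R d j) = d 0" unfolding sum.lessThan_Suc_shift by simp
      then show ?thesis by (simp only: True at0) simp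
    qed (use nz x in blast)
  qed
  then show "\<exists>c C. \<forall>x. \<bar>x\<bar> \<le> 1 \<longrightarrow> norm (qderiv q F x - (\<Sum>j<K. x ^ j *\<^sub>R c j)) \<le> C * \<bar>x\<bar> ^ K"
    using origin_expansion_lower[of K "Suc K" "qderiv q F" d D] by auto
qed

lemma rapid_qderiv:
  assumes "rapid F" "origin_expansion (qderiv q F)"
  shows "rapid (qderiv q F)"
  unfolding rapid_def
proof
  fix m
  obtain C where C: "\<And>x. (1 + x\<^sup>2) ^ m * norm (F x) \<le> C" using assms(1) unfolding rapid_def by meson
  have C0: "0 \<le> C" using C[of 0] by (simp add: order_trans[OF norm_ge_zero])
  obtain c B where B: "\<And>x. \<bar>x\<bar> \<le> 1 \<Longrightarrow> norm (qderiv q F x - (\<Sum>j<0. x ^ j *\<^sub>R c j)) \<le> B * \<bar>x\<bar> ^ 0"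
    using assms(2) unfolding origin_expansion_def by meson
  have B0: "0 \<le> B" using B[of 0] by (simp add: order_trans[OF norm_ge_zero])
  define A where "A = inverse (q\<^sup>2)"
  have A: "1 + x\<^sup>2 \<le> A * (1 + (q * x)\<^sup>2)" for x
  proof -
    have "1 \<le> A" using q_pos q_less_1 by (simp add: A_def one_le_inverse_iff power_le_one)
    moreover have "A * (q * x)\<^sup>2 = x\<^sup>2" using q_pos by (simp add: A_def power_mult_distrib)
    ultimately show ?thesis by (simp add: distrib_left)
  qed
  have A0: "0 < A" using q_pos by (simp add: A_def)
  have "(1 + x\<^sup>2) ^ m * norm (qderiv q F x) \<le> 2 ^ m * B + inverse (1 - q) * (C + A ^ m * C)" for x
  proof (cases "\<bar>x\<bar> \<le> 1")
    case True
    then have "x\<^sup>2 \<le> 1" by (simp add: abs_square_le_1)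
    then have "(1 + x\<^sup>2) ^ m * norm (qderiv q F x) \<le> 2 ^ m * B"
      using B[OF True] by (intro mult_mono power_mono) auto
    moreover have "0 \<le> inverse (1 - q) * (C + A ^ m * C)" using q_less_1 C0 A0 by simp
    ultimately show ?thesis by linarith
  next
    case False
    have "inverse \<bar>x\<bar> \<le> 1" using False by (intro inverse_le_1_iff[THEN iffD2]) auto
    then have inv: "inverse ((1 - q) * \<bar>x\<bar>) \<le> inverse (1 - q)"
      using q_less_1 mult_left_mono[of "inverse \<bar>x\<bar>" 1 "inverse (1 - q)"] by simp
    have "norm (qderiv q F x) = inverse ((1 - q) * \<bar>x\<bar>) * norm (F x - F (q * x))"
      using False q_less_1 by (simp add: qderiv_nz abs_mult)
    also have "\<dots> \<le> inverse (1 - q) * (norm (F x) + norm (F (q * x)))"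
      using inv q_less_1 by (intro mult_mono norm_triangle_ineq4) auto
    finally have "(1 + x\<^sup>2) ^ m * norm (qderiv q F x) \<le> (1 + x\<^sup>2) ^ m * (inverse (1 - q) * (norm (F x) + norm (F (q * x))))"
      by (intro mult_left_mono) auto
    also have "\<dots> = inverse (1 - q) * ((1 + x\<^sup>2) ^ m * norm (F x) + (1 + x\<^sup>2) ^ m * norm (F (q * x)))"
      by (simp add: algebra_simps)
    also have "\<dots> \<le> inverse (1 - q) * (C + (A * (1 + (q * x)\<^sup>2)) ^ m * norm (F (q * x)))"
      using q_less_1 C[of x] A[of x] by (intro mult_left_mono add_mono mult_right_mono power_mono) auto
    also have "(A * (1 + (q * x)\<^sup>2)) ^ m * norm (F (q * x)) = A ^ m * ((1 + (q * x)\<^sup>2) ^ m * norm (F (q * x)))"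
      by (simp add: power_mult_distrib)
    also have "inverse (1 - q) * (C + A ^ m * ((1 + (q * x)\<^sup>2) ^ m * norm (F (q * x)))) \<le> inverse (1 - q) * (C + A ^ m * C)"
      using q_less_1 C[of "q * x"] A0 by (intro mult_left_mono add_mono) auto
    finally have "(1 + x\<^sup>2) ^ m * norm (qderiv q F x) \<le> inverse (1 - q) * (C + A ^ m * C)" .
    moreover have "0 \<le> 2 ^ m * B" using B0 by simp
    ultimately show ?thesis by linarith
  qed
  then show "\<exists>C. \<forall>x. (1 + x\<^sup>2) ^ m * norm (qderiv q F x) \<le> C" by blast
qed

lemma S_qI:
  assumes "\<And>x. F (- x) = F x" "origin_expansion F" "rapid F"
  shows "restrict F (Rq q) \<in> S_q q"
proof -
  have E: "origin_expansion ((qderiv q ^^ k) F)" for k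
    by (induction k) (simp_all add: assms origin_expansion_qderiv)
  have R: "rapid ((qderiv q ^^ k) F)" for k
  proof (induction k)
    case (Suc k)
    then show ?case using rapid_qderiv[of "(qderiv q ^^ k) F"] E[of "Suc k"] by simp
  qed (simp add: assms)
  have "bdd_above ((\<lambda>(x, k). cmod ((1 + x\<^sup>2) ^ m *\<^sub>R (qderiv q ^^ k) F x)) ` (UNIV \<times> {..n::nat}))" for n m
  proof -
    obtain C where C: "\<And>k x. (1 + x\<^sup>2) ^ m * norm ((qderiv q ^^ k) F x) \<le> C k"
      using choice[of "\<lambda>k C. \<forall>x. (1 + x\<^sup>2) ^ m * norm ((qderiv q ^^ k) F x) \<le> C"] R
      unfolding rapid_def by blast
    have "cmod ((1 + x\<^sup>2) ^ m *\<^sub>R (qderiv q ^^ k) F x) \<le> (\<Sum>k\<le>n. \<bar>C k\<bar>)" if "k \<le> n" for x k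
    proof -
      have "cmod ((1 + x\<^sup>2) ^ m *\<^sub>R (qderiv q ^^ k) F x) \<le> \<bar>C k\<bar>"
        using C[of x k] by (simp add: abs_of_nonneg add_nonneg_nonneg)
      also have "\<dots> \<le> (\<Sum>k\<le>n. \<bar>C k\<bar>)" using that by (intro member_le_sum) auto
      finally show ?thesis .
    qed
    then show ?thesis by (intro bdd_aboveI2) (auto intro: bdd_aboveI)
  qed
  moreover have "inf_q_differentiable q F"
    unfolding inf_q_differentiable_def using E origin_expansion_imp_differentiable by blast
  ultimately show ?thesis
    unfolding S_q_def mem_Collect_eq by (intro exI[of _ F] conjI allI refl assms(1))
qed

text \<open>A sequence with an asymptotic expansion is extended off the lattice, following Borel, by the
  sum of those terms of the formal power series that are not too large.  Away from \<open>0\<close> the operator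
  \<open>qderiv q\<close> only compares values on one orbit of the dilation by \<open>q\<close>, so the jumps of the truncated
  sum do no harm.\<close>

definition borel_sum :: "(nat \<Rightarrow> complex) \<Rightarrow> real \<Rightarrow> complex" where
  "borel_sum c x = (if \<bar>x\<bar> \<le> 1 / 2
     then \<Sum>j. if norm (c j) * \<bar>x\<bar> \<le> 1 then x ^ (2 * j) *\<^sub>R c j else 0 else 0)"

lemma borel_sum_minus [simp]: "borel_sum c (- x) = borel_sum c x"
proof -
  have "(- x) ^ (2 * j) = x ^ (2 * j)" for j by (simp only: power_mult power2_minus)
  then show ?thesis unfolding borel_sum_def abs_minus_cancel by (simp only:)
qed

text \<open>A term of the truncated series is at most \<open>\<bar>x\<bar> ^ (2 * j) / \<bar>x\<bar>\<close>, whatever the size of its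
  coefficient, so the tail is geometric.\<close>

lemma borel_sum_expansion:
  assumes x: "x \<noteq> 0" "\<bar>x\<bar> \<le> 1 / 2" and small: "\<And>j. j < K \<Longrightarrow> norm (c j) * \<bar>x\<bar> \<le> 1"
  shows "\<bar>x\<bar> * norm (borel_sum c x - (\<Sum>j<K. x ^ (2 * j) *\<^sub>R c j)) \<le> 2 * \<bar>x\<bar> ^ (2 * K)"
proof -
  define t where "t j = (if norm (c j) * \<bar>x\<bar> \<le> 1 then x ^ (2 * j) *\<^sub>R c j else 0)" for j
  have t: "norm (t j) \<le> \<bar>x\<bar> ^ (2 * j) / \<bar>x\<bar>" for j
  proof -
    have "norm (t j) * \<bar>x\<bar> \<le> \<bar>x\<bar> ^ (2 * j) * 1"
    proof (cases "norm (c j) * \<bar>x\<bar> \<le> 1")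
      case True
      then have "\<bar>x\<bar> ^ (2 * j) * (norm (c j) * \<bar>x\<bar>) \<le> \<bar>x\<bar> ^ (2 * j) * 1" by (intro mult_left_mono) auto
      then show ?thesis using True by (simp add: t_def power_abs mult.assoc)
    qed (simp add: t_def)
    then show ?thesis using x by (simp add: pos_le_divide_eq)
  qed
  define y where "y = x\<^sup>2"
  have y: "0 \<le> y" "y \<le> 1 / 4" "y < 1"
    using power_mono[OF x(2), of 2] by (auto simp: y_def power_divide)
  have xy: "\<bar>x\<bar> ^ (2 * j) = y ^ j" for j by (simp add: y_def power_mult)
  have sg: "summable (\<lambda>j. y ^ j / \<bar>x\<bar>)" using y by (intro summable_divide summable_geometric) auto
  have st: "summable t"
    by (rule summable_comparison_test'[OF sg]) (use t in \<open>auto simp: xy\<close>)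
  have sg': "summable (\<lambda>i. y ^ K / \<bar>x\<bar> * y ^ i)"
    using y by (intro summable_mult summable_geometric) auto
  have "borel_sum c x = suminf t" using x by (simp add: borel_sum_def t_def[abs_def])
  also have "\<dots> = (\<Sum>i. t (i + K)) + (\<Sum>j<K. t j)" by (rule suminf_split_initial_segment[OF st])
  also have "(\<Sum>j<K. t j) = (\<Sum>j<K. x ^ (2 * j) *\<^sub>R c j)"
    using small by (intro sum.cong) (auto simp: t_def)
  finally have "norm (borel_sum c x - (\<Sum>j<K. x ^ (2 * j) *\<^sub>R c j)) = norm (\<Sum>i. t (i + K))" by simp
  also have "\<dots> \<le> (\<Sum>i. y ^ K / \<bar>x\<bar> * y ^ i)"
  proof (rule norm_suminf_le[OF _ sg'])
    show "norm (t (i + K)) \<le> y ^ K / \<bar>x\<bar> * y ^ i" for i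
      using t[of "i + K"] unfolding xy by (simp add: power_add mult.commute)
  qed
  also have "\<dots> = y ^ K / \<bar>x\<bar> * (1 / (1 - y))"
    using y by (subst suminf_mult) (auto simp: suminf_geometric summable_geometric)
  also have "\<dots> \<le> y ^ K / \<bar>x\<bar> * 2" using y by (intro mult_left_mono) (auto simp: field_simps)
  finally have "\<bar>x\<bar> * norm (borel_sum c x - (\<Sum>j<K. x ^ (2 * j) *\<^sub>R c j)) \<le> \<bar>x\<bar> * (y ^ K / \<bar>x\<bar> * 2)"
    by (rule mult_left_mono) simp
  then show ?thesis unfolding xy using x by simp
qed

text \<open>Evenness accounts for the negative half of the lattice, and continuity along the lattice for the value at \<open>0\<close>.\<close>

lemma S_q_eqI:
  assumes f: "f \<in> S_q q" and h: "h \<in> extensional (Rq q)" "\<And>x. x \<in> Rq q \<Longrightarrow> h (- x) = h x"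
    and lattice: "\<And>N. h (q powi N) = f (q powi N)" and lim: "(\<lambda>n. f (q ^ n)) \<longlonglongrightarrow> h 0"
  shows "h = f"
proof
  fix x
  consider N where "x = q powi N" | N where "x = - (q powi N)" | "x = 0" | "x \<notin> Rq q"
    by (auto simp: Rq_def Rq_pos_def)
  then show "h x = f x"
  proof cases
    case (2 N)
    then show ?thesis using lattice h(2) S_q_imp_schwartz_seq(3)[OF f] by simp
  next
    case 3
    then show ?thesis using LIMSEQ_unique[OF lim S_q_imp_schwartz_seq(2)[OF f]] by simp
  next
    case 4
    then show ?thesis using h(1) S_q_imp_schwartz_seq(4)[OF f] by (simp add: extensional_def)
  qed (use lattice in simp)
qed

text \<open>Keep \<open>u\<close> on the lattice and use the Borel sum of its expansion elsewhere near \<open>0\<close>; both pieces share the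
  expansion, so the combined function has one on the whole line.\<close>

theorem S_q_extension:
  assumes u: "schwartz_seq (q\<^sup>2) u" "(\<lambda>n. u (int n)) \<longlonglongrightarrow> u0"
  obtains h where "h \<in> S_q q" "\<And>N. h (q powi N) = u N" "h 0 = u0"
proof -
  obtain c where c: "\<And>K. \<exists>C. \<forall>n::nat. norm (u (int n) - (\<Sum>j<K. ((q\<^sup>2) ^ n) ^ j *\<^sub>R c j)) \<le> C * ((q\<^sup>2) ^ n) ^ K"
    and c0: "(\<lambda>n. u (int n)) \<longlonglongrightarrow> c 0"
    using P.schwartz_seq_expansion[OF u(1)] by metis
  have u0: "u0 = c 0" using LIMSEQ_unique[OF u(2) c0] .
  define F where "F x = (if x = 0 then u0 else if \<bar>x\<bar> \<in> Rq_pos q then u (THE N. \<bar>x\<bar> = q powi N) else borel_sum c x)" for x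
  have inj: "q powi M = q powi N \<longleftrightarrow> M = N" for M N
    using q_pos q_less_1 power_int_strict_decreasing[of M N q] power_int_strict_decreasing[of N M q]
    by (metis less_irrefl linorder_less_linear)
  have F_lat: "F x = u N" if "\<bar>x\<bar> = q powi N" for x N
  proof -
    have "x \<noteq> 0" using that Q.powi_pos[of N] by (metis abs_zero less_irrefl)
    then show ?thesis using that by (auto simp: F_def Rq_pos_def inj)
  qed
  have F0: "F 0 = u0" by (simp add: F_def)
  have F_off: "F x = borel_sum c x" if "x \<noteq> 0" "\<bar>x\<bar> \<notin> Rq_pos q" for x using that by (simp add: F_def)
  obtain A where A: "\<And>N. norm (u N) \<le> A" using P.schwartz_seq_bounded[OF u(1), of 0] by auto
  \<comment> \<open>a radius within which the first \<open>K\<close> terms of the Borel sum are all present\<close>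
  define \<delta> where "\<delta> K = inverse (2 + (\<Sum>j<K. norm (c j)))" for K
  have \<delta>: "0 < \<delta> K" "\<delta> K \<le> 1 / 2" for K
    using sum_nonneg[of "{..<K}" "\<lambda>j. norm (c j)"] by (auto simp: \<delta>_def field_simps)
  have \<delta>_small: "norm (c j) * \<bar>x\<bar> \<le> 1" if "j < K" "\<bar>x\<bar> \<le> \<delta> K" for j K x
  proof -
    have "norm (c j) \<le> 2 + (\<Sum>j<K. norm (c j))"
      using that(1) member_le_sum[of j "{..<K}" "\<lambda>j. norm (c j)"] by simp
    then have "norm (c j) * \<bar>x\<bar> \<le> (2 + (\<Sum>j<K. norm (c j))) * \<delta> K"
      using that(2) sum_nonneg[of "{..<K}" "\<lambda>j. norm (c j)"] by (intro mult_mono) auto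
    also have "\<dots> = 1" using sum_nonneg[of "{..<K}" "\<lambda>j. norm (c j)"] by (simp add: \<delta>_def)
    finally show ?thesis .
  qed
  have borel_bounded: "\<exists>B. \<forall>x. x \<noteq> 0 \<longrightarrow> norm (borel_sum c x) \<le> B"
  proof -
    have "norm (borel_sum c x) \<le> 2 / \<delta> 1 + norm (c 0) + 2" if "x \<noteq> 0" for x
    proof (cases "\<bar>x\<bar> \<le> 1 / 2")
      case True
      show ?thesis
      proof (cases "\<bar>x\<bar> \<le> \<delta> 1")
        case small: True
        have "\<bar>x\<bar> * norm (borel_sum c x - (\<Sum>j<1. x ^ (2 * j) *\<^sub>R c j)) \<le> 2 * \<bar>x\<bar> ^ (2 * 1)"
          using that True \<delta>_small[of _ 1 x] small by (intro borel_sum_expansion) auto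
        moreover have "2 * \<bar>x\<bar> ^ (2 * 1) = \<bar>x\<bar> * (2 * \<bar>x\<bar>)"
          by (simp only: mult_1_right power2_eq_square mult.left_commute)
        moreover have "(\<Sum>j<1. x ^ (2 * j) *\<^sub>R c j) = c 0" by simp
        ultimately have "\<bar>x\<bar> * norm (borel_sum c x - c 0) \<le> \<bar>x\<bar> * (2 * \<bar>x\<bar>)"
          by (simp only:)
        then have "norm (borel_sum c x - c 0) \<le> 2 * \<bar>x\<bar>"
          by (rule mult_left_le_imp_le) (use that in simp)
        then have "norm (borel_sum c x) \<le> 2 * \<bar>x\<bar> + norm (c 0)"
          using norm_triangle_sub[of "borel_sum c x" "c 0"] by linarith
        moreover have "0 < 2 / \<delta> 1" using \<delta>(1) by simp
        ultimately show ?thesis using True by linarith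
      next
        case False
        have "\<bar>x\<bar> * norm (borel_sum c x) \<le> 2"
          using borel_sum_expansion[of x 0 c] that True by simp
        moreover have "\<delta> 1 * norm (borel_sum c x) \<le> \<bar>x\<bar> * norm (borel_sum c x)"
          using False by (intro mult_right_mono) auto
        ultimately have "norm (borel_sum c x) \<le> 2 / \<delta> 1" using \<delta>(1)[of 1] by (simp add: field_simps)
        then show ?thesis by (smt (verit) norm_ge_zero)
      qed
    next
      case False
      moreover have "0 < 2 / \<delta> 1" using \<delta>(1) by simp
      ultimately show ?thesis by (simp add: borel_sum_def add_nonneg_nonneg)
    qed
    then show ?thesis by blast
  qed
  then obtain B where B: "\<And>x. x \<noteq> 0 \<Longrightarrow> norm (borel_sum c x) \<le> B" by blast
  define Bd where "Bd = \<bar>A\<bar> + \<bar>B\<bar> + norm u0"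
  have Bd: "norm (F x) \<le> Bd" for x
  proof -
    consider "x = 0" | N where "\<bar>x\<bar> = q powi N" | "x \<noteq> 0" "\<bar>x\<bar> \<notin> Rq_pos q" by (auto simp: Rq_pos_def)
    then show ?thesis
    proof cases
      case 1 then show ?thesis by (simp add: F0 Bd_def)
    next
      case 2 show ?thesis
        using A[of N] norm_ge_zero[of u0] unfolding Bd_def F_lat[OF 2] by linarith
    next
      case 3 show ?thesis
        using B[OF 3(1)] norm_ge_zero[of u0] unfolding Bd_def F_off[OF 3] by linarith
    qed
  qed
  have even: "F (- x) = F x" for x by (simp add: F_def)
  have "origin_expansion F"
    unfolding origin_expansion_def
  proof
    fix K0 :: nat
    define K where "K = Suc K0"
    define d where "d j = (if even j then c (j div 2) else 0)" for j
    obtain C where C: "\<And>n::nat. norm (u (int n) - (\<Sum>j<K. ((q\<^sup>2) ^ n) ^ j *\<^sub>R c j)) \<le> C * ((q\<^sup>2) ^ n) ^ K"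
      using c[of K] by blast
    define P where "P x = (\<Sum>j<K. x ^ (2 * j) *\<^sub>R c j)" for x
    \<comment> \<open>off the lattice the Borel sum loses one power of \<open>x\<close>, so order \<open>2 * K\<close> becomes \<open>2 * K - 1\<close>\<close>
    define K' where "K' = 2 * K0 + 1"
    have Pd: "(\<Sum>j<K'. x ^ j *\<^sub>R d j) = P x" for x
      using sum_even_terms(2)[of "\<lambda>j. x ^ j *\<^sub>R d j" K0] by (simp add: K'_def P_def K_def d_def)
    \<comment> \<open>the summands of \<open>E\<close> serve lattice points, other points near \<open>0\<close>, and points beyond \<open>\<delta> K\<close>\<close>
    define E where "E = \<bar>C\<bar> + 2 + (Bd + (\<Sum>j<K. norm (c j))) / \<delta> K ^ K'"
    have Bd0: "0 \<le> Bd" by (simp add: Bd_def)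
    have E: "\<bar>C\<bar> \<le> E" "2 \<le> E" "(Bd + (\<Sum>j<K. norm (c j))) / \<delta> K ^ K' \<le> E" "0 \<le> E"
      using Bd0 \<delta>(1)[of K] by (auto simp: E_def intro!: add_nonneg_nonneg divide_nonneg_nonneg sum_nonneg)
    have "norm (F x - P x) \<le> E * \<bar>x\<bar> ^ K'" if x1: "\<bar>x\<bar> \<le> 1" for x
    proof -
      consider "x = 0" | N where "\<bar>x\<bar> = q powi N" | "x \<noteq> 0" "\<bar>x\<bar> \<notin> Rq_pos q" "\<bar>x\<bar> \<le> \<delta> K"
        | "\<delta> K < \<bar>x\<bar>" by (force simp: Rq_pos_def)
      then show ?thesis
      proof cases
        case 1
        have "P 0 = c 0" unfolding P_def K_def sum.lessThan_Suc_shift by simp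
        then show ?thesis by (simp add: 1 F0 u0 K'_def)
      next
        case (2 N)
        have "0 \<le> N"
        proof (rule ccontr)
          assume "\<not> 0 \<le> N"
          then have "q powi 0 < q powi N" using q_pos q_less_1 by (intro power_int_strict_decreasing) auto
          then show False using 2 x1 by simp
        qed
        then obtain n where n: "N = int n" using nonneg_int_cases by blast
        have xn: "\<bar>x\<bar> = q ^ n" using 2 n by simp
        have xp: "x ^ (2 * j) = ((q\<^sup>2) ^ n) ^ j" for j
        proof -
          have "x ^ (2 * j) = \<bar>x\<bar> ^ (2 * j)" by (simp add: power_mult)
          then show ?thesis by (simp add: xn mult_ac flip: power_mult)
        qed
        have "norm (F x - P x) \<le> C * x ^ (2 * K)"
          using C[of n] unfolding F_lat[OF 2] P_def xp n .
        also have "\<dots> = C * \<bar>x\<bar> * \<bar>x\<bar> ^ K'"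
        proof -
          have "x ^ (2 * K) = \<bar>x\<bar> ^ (2 * K)" by (simp add: power_even_abs)
          moreover have "2 * K = Suc K'" by (simp add: K_def K'_def)
          ultimately show ?thesis by (simp only: power_Suc mult.assoc)
        qed
        also have "\<dots> \<le> E * \<bar>x\<bar> ^ K'"
        proof (intro mult_right_mono)
          have "C * \<bar>x\<bar> \<le> \<bar>C\<bar> * 1" using x1 by (intro mult_mono) auto
          then show "C * \<bar>x\<bar> \<le> E" using E by simp
        qed simp
        finally show ?thesis .
      next
        case 3
        have "\<bar>x\<bar> * norm (borel_sum c x - P x) \<le> 2 * \<bar>x\<bar> ^ (2 * K)"
          unfolding P_def using 3 \<delta>(2)[of K] by (intro borel_sum_expansion \<delta>_small) auto
        also have "\<dots> = \<bar>x\<bar> * (2 * \<bar>x\<bar> ^ K')"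
          by (simp add: K_def K'_def)
        finally have "norm (borel_sum c x - P x) \<le> 2 * \<bar>x\<bar> ^ K'" using 3 by simp
        also have "\<dots> \<le> E * \<bar>x\<bar> ^ K'" using E by (intro mult_right_mono) auto
        finally show ?thesis using F_off[OF 3(1,2)] by simp
      next
        case 4
        have "norm (P x) \<le> (\<Sum>j<K. norm (c j))"
          unfolding P_def
        proof (rule sum_norm_le)
          fix j
          show "norm (x ^ (2 * j) *\<^sub>R c j) \<le> norm (c j)"
            using x1 power_le_one[of "\<bar>x\<bar>" "2 * j"] by (simp add: power_abs mult_left_le_one_le)
        qed
        then have "norm (F x - P x) \<le> (Bd + (\<Sum>j<K. norm (c j))) / \<delta> K ^ K' * \<delta> K ^ K'"
          using Bd[of x] norm_triangle_ineq4[of "F x" "P x"] \<delta>(1)[of K] by simp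
        also have "\<dots> \<le> E * \<bar>x\<bar> ^ K'"
          using 4 E \<delta>(1)[of K] by (intro mult_mono power_mono) auto
        finally show ?thesis .
      qed
    qed
    then have "\<forall>x. \<bar>x\<bar> \<le> 1 \<longrightarrow> norm (F x - (\<Sum>j<K'. x ^ j *\<^sub>R d j)) \<le> E * \<bar>x\<bar> ^ K'"
      unfolding Pd by blast
    moreover have "K0 \<le> K'" by (simp add: K'_def)
    ultimately show "\<exists>c C. \<forall>x. \<bar>x\<bar> \<le> 1 \<longrightarrow> norm (F x - (\<Sum>j<K0. x ^ j *\<^sub>R c j)) \<le> C * \<bar>x\<bar> ^ K0"
      using origin_expansion_lower by blast
  qed
  moreover have "rapid F"
    unfolding rapid_def
  proof
    fix m
    obtain C where C: "\<And>N. (1 + (q\<^sup>2) powi N) ^ m * norm ((qE (q\<^sup>2) ^^ 0) u N) \<le> C"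
      using P.schwartz_seqD[OF u(1), of m 0] by blast
    have Bd0: "0 \<le> Bd" by (simp add: Bd_def)
    have "(1 + x\<^sup>2) ^ m * norm (F x) \<le> \<bar>C\<bar> + 2 ^ m * Bd" for x
    proof (cases "\<exists>N. \<bar>x\<bar> = q powi N")
      case True
      then obtain N where N: "\<bar>x\<bar> = q powi N" by blast
      have "x\<^sup>2 = (q\<^sup>2) powi N" unfolding q2_powi by (simp flip: N)
      then have "(1 + x\<^sup>2) ^ m * norm (F x) \<le> C" using C[of N] F_lat[OF N] by simp
      then show ?thesis using Bd0 by (smt (verit) mult_nonneg_nonneg zero_le_power)
    next
      case off: False
      show ?thesis
      proof (cases "\<bar>x\<bar> \<le> 1")
        case True
        then have "x\<^sup>2 \<le> 1" by (simp add: abs_square_le_1)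
        then have "(1 + x\<^sup>2) ^ m * norm (F x) \<le> 2 ^ m * Bd"
          using Bd[of x] by (intro mult_mono power_mono) auto
        then show ?thesis by simp
      next
        case False
        then have "x \<noteq> 0" by auto
        moreover have "\<bar>x\<bar> \<notin> Rq_pos q" using off unfolding Rq_pos_def by blast
        ultimately have "F x = 0" using False F_off[of x] by (simp add: borel_sum_def)
        then show ?thesis using Bd0 by simp
      qed
    qed
    then show "\<exists>C. \<forall>x. (1 + x\<^sup>2) ^ m * norm (F x) \<le> C" by blast
  qed
  ultimately have "restrict F (Rq q) \<in> S_q q" using S_qI[of F] even by blast
  then show ?thesis
  proof (rule that)
    show "restrict F (Rq q) (q powi N) = u N" for N
      using F_lat[of "q powi N" N] by simp
  qed (simp add: F0)
qed

end

section \<open>The transforms in terms of lattice sums\<close>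

locale q_bessel = jackson +
  fixes \<alpha> :: real and \<kappa> :: int
  assumes alpha: "- 1 / 2 < \<alpha>" and kappa: "1 - q = q powi \<kappa>"
begin

abbreviation p :: real where "p \<equiv> q\<^sup>2"

text \<open>The parameter \<open>w\<close> of the kernel of order \<open>\<beta>\<close>; \<open>r\<close> below is the quotient of its values at \<open>\<alpha>\<close> and \<open>- 1 / 2\<close>.\<close>

definition wt :: "real \<Rightarrow> real" where "wt \<beta> = q powr (2 * \<beta> + 2)"

definition r :: real where "r = q powr (2 * \<alpha> + 1)"

text \<open>The closed form of the constant relating \<open>F_q q \<beta>\<close> to \<open>qH\<close> (lemma \<open>hankel_const_eq\<close>).\<close>

definition hankel_const :: "real \<Rightarrow> real" where
  "hankel_const \<beta> = (q * (1 - q)) powr \<beta> * (1 - q) / qpoch_inf p p"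

lemma q_pos' [simp]: "0 < q" "q < 1" "0 \<le> q" "q \<noteq> 0" "q \<noteq> 1" "0 < 1 + q" "1 + q \<noteq> 0"
  using q_pos q_less_1 by auto

lemma powr_less_1: "0 < s \<Longrightarrow> q powr s < 1"
  using powr_less_mono'[of q 0 s] by simp

lemma wt_bounds: "- 1 < \<beta> \<Longrightarrow> 0 < wt \<beta>" "- 1 < \<beta> \<Longrightarrow> wt \<beta> < 1"
  unfolding wt_def by (auto intro: powr_less_1)

lemma r_bounds [simp]: "0 < r" "r < 1" "0 \<le> r" "r \<le> 1" "r \<noteq> 0"
proof -
  show "0 < r" "r < 1" unfolding r_def using alpha by (auto intro: powr_less_1)
  then show "0 \<le> r" "r \<le> 1" "r \<noteq> 0" by auto
qed

lemma wt_half [simp]: "wt (- (1 / 2)) = q" "wt (- 1 / 2) = q"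
  by (simp_all add: wt_def)

lemma wt_alpha: "wt \<alpha> = q * r"
proof -
  have "wt \<alpha> = q powr (1 + (2 * \<alpha> + 1))" by (simp add: wt_def add.commute)
  then show ?thesis by (simp only: powr_add[of q 1 "2 * \<alpha> + 1"] r_def) simp
qed

lemma wt_alpha_bounds: "0 < q * r" "q * r < 1"
  using wt_bounds[of \<alpha>] alpha by (simp_all add: wt_alpha)

lemma powi_powr: "(q powi n) powr s = (q powr s) powi n"
proof -
  have "(q powi n) powr s = (q powr of_int n) powr s"
    by (simp add: powr_real_of_int')
  also have "\<dots> = (q powr s) powr of_int n" by (simp add: powr_powr mult.commute)
  also have "\<dots> = (q powr s) powi n" by (simp add: powr_real_of_int')
  finally show ?thesis .
qed

lemma powi_times_powr: "q powi n * (q powi n) powr s = (q powr (s + 1)) powi n"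
  by (simp add: powi_powr powr_add power_int_mult_distrib mult.commute)

lemma powi_weight: "q powi n * (q powi n) powr (2 * \<beta> + 1) = wt \<beta> powi n"
  by (simp add: powi_times_powr wt_def add.assoc)

text \<open>The arguments of the kernel are lattice points because \<open>1 - q\<close> is a power of \<open>q\<close>.\<close>

lemma spectral_point: "(1 - q)\<^sup>2 * (q powi L)\<^sup>2 = p powi (L + \<kappa>)"
  by (simp add: kappa q2_powi power_int_add power_mult_distrib mult.commute)

lemma spectral_point_Rq_pos0: "b \<in> Rq_pos0 q \<Longrightarrow> (1 - q)\<^sup>2 * b\<^sup>2 \<in> Rq_pos0 p"
  using spectral_point by (auto simp: Rq_pos0_def Rq_pos_def)

lemma j3_qJ:
  assumes "- 1 < \<beta>"
  shows "j3 q \<beta> z = qJ p (wt \<beta>) ((1 - q)\<^sup>2 * z\<^sup>2) / qpoch_inf (wt \<beta>) p"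
proof -
  note w = wt_bounds[OF assms]
  have "(\<lambda>n. qexp_coeff p n * ((1 - q)\<^sup>2 * z\<^sup>2) ^ n * qpoch_inf (wt \<beta> * p ^ n) p / qpoch_inf (wt \<beta>) p)
    sums (qJ p (wt \<beta>) ((1 - q)\<^sup>2 * z\<^sup>2) / qpoch_inf (wt \<beta>) p)"
    using w by (intro sums_divide has_sum_imp_sums P.qJ_has_sum) auto
  moreover have "qexp_coeff p n * ((1 - q)\<^sup>2 * z\<^sup>2) ^ n * qpoch_inf (wt \<beta> * p ^ n) p / qpoch_inf (wt \<beta>) p
    = (- 1) ^ n * q ^ (n * (n - 1)) * (1 - q) ^ (2 * n) * z ^ (2 * n) / (qpoch p p n * qpoch (wt \<beta>) p n)" for n
  proof -
    have nz: "qpoch (wt \<beta>) p n \<noteq> 0" "qpoch_inf (wt \<beta> * p ^ n) p \<noteq> 0"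
      using P.qpoch_pos[of "wt \<beta>" n] P.qpoch_inf_pos[of "wt \<beta> * p ^ n"] P.mult_pow_less_1[of "wt \<beta>" n] w by auto
    have "p ^ (n * (n - 1) div 2) = q ^ (n * (n - 1))"
    proof -
      have "even (n * (n - 1))" by (cases n) auto
      then have "2 * (n * (n - 1) div 2) = n * (n - 1)" by (rule dvd_mult_div_cancel)
      then show ?thesis by (simp only: power_mult[symmetric])
    qed
    then show ?thesis
      using nz unfolding P.qpoch_inf_split[of "wt \<beta>" n] qexp_coeff_def
      by (simp add: power_mult power_mult_distrib)
  qed
  ultimately have "(\<lambda>n. (- 1) ^ n * q ^ (n * (n - 1)) * (1 - q) ^ (2 * n) * z ^ (2 * n) / (qpoch p p n * qpoch (wt \<beta>) p n))
    sums (qJ p (wt \<beta>) ((1 - q)\<^sup>2 * z\<^sup>2) / qpoch_inf (wt \<beta>) p)" by simp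
  then show ?thesis unfolding j3_def wt_def by (simp add: sums_iff)
qed

lemma wt_square: "p powr (\<beta> + 1) = wt \<beta>"
proof -
  have "p powr (\<beta> + 1) = (q powr 2) powr (\<beta> + 1)" by (simp add: powr_numeral)
  then show ?thesis by (simp only: powr_powr wt_def) (simp add: distrib_left)
qed

lemma qGamma_wt: "qGamma p (\<beta> + 1) = qpoch_inf p p / qpoch_inf (wt \<beta>) p * (1 - p) powr (- \<beta>)"
  by (simp add: qGamma_def wt_square)

lemma one_minus_p: "1 - p = (1 - q) * (1 + q)"
  by (simp add: power2_eq_square algebra_simps)

lemma hankel_const_pos [simp]: "0 < hankel_const \<beta>" "hankel_const \<beta> \<noteq> 0"
proof -
  show "0 < hankel_const \<beta>"
    unfolding hankel_const_def using P.qpoch_inf_pos[of p] P.p_less_1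
    by (intro divide_pos_pos mult_pos_pos) auto
  then show "hankel_const \<beta> \<noteq> 0" by simp
qed

lemma hankel_const_eq:
  assumes "- 1 < \<beta>"
  shows "c_q q \<beta> * (1 - q) / qpoch_inf (wt \<beta>) p = hankel_const \<beta>"
proof -
  have nz: "qpoch_inf (wt \<beta>) p \<noteq> 0" "qpoch_inf p p \<noteq> 0" "0 < 1 + q"
    using P.qpoch_inf_pos[of "wt \<beta>"] wt_bounds[OF assms] by (auto simp: add_pos_pos)
  have "(1 + 1 / q) powr (- \<beta>) / (1 - p) powr (- \<beta>) = ((1 + 1 / q) / (1 - p)) powr (- \<beta>)"
    by (simp add: powr_divide)
  also have "(1 + 1 / q) / (1 - p) = inverse (q * (1 - q))"
    using nz(3) unfolding one_minus_p by (simp add: divide_simps)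
  also have "inverse (q * (1 - q)) powr (- \<beta>) = (q * (1 - q)) powr \<beta>"
    by (subst inverse_powr) (simp_all add: powr_minus)
  finally have eq: "(1 + 1 / q) powr (- \<beta>) / (1 - p) powr (- \<beta>) = (q * (1 - q)) powr \<beta>" .
  have "c_q q \<beta> * (1 - q) / qpoch_inf (wt \<beta>) p
      = (1 + 1 / q) powr (- \<beta>) / (1 - p) powr (- \<beta>) * (1 - q) / qpoch_inf p p"
    using nz unfolding c_q_def qGamma_wt by simp
  then show ?thesis by (simp only: eq hankel_const_def)
qed

lemma F_q_qH:
  assumes "- 1 < \<beta>"
  shows "F_q q \<beta> f l = hankel_const \<beta> *\<^sub>R qH p (wt \<beta>) (\<lambda>N. f (q powi N)) ((1 - q)\<^sup>2 * l\<^sup>2)"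
proof -
  have "q powi n *\<^sub>R ((j3 q \<beta> (l * q powi n) * (q powi n) powr (2 * \<beta> + 1)) *\<^sub>R f (q powi n))
    = (1 / qpoch_inf (wt \<beta>) p) *\<^sub>R ((wt \<beta> powi n * qJ p (wt \<beta>) (p powi n * ((1 - q)\<^sup>2 * l\<^sup>2))) *\<^sub>R f (q powi n))" for n
    unfolding j3_qJ[OF assms] powi_weight[symmetric]
    by (simp add: q2_powi power_mult_distrib mult_ac)
  then have "jackson_0_infty q (\<lambda>x. (j3 q \<beta> (l * x) * x powr (2 * \<beta> + 1)) *\<^sub>R f x)
    = ((1 - q) / qpoch_inf (wt \<beta>) p) *\<^sub>R qH p (wt \<beta>) (\<lambda>N. f (q powi N)) ((1 - q)\<^sup>2 * l\<^sup>2)"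
    unfolding jackson_0_infty_def qH_def by (simp only: infsum_scaleR_right) simp
  then show ?thesis
    unfolding F_q_def hankel_const_eq[OF assms, symmetric] by simp
qed

lemma F_q_lattice:
  assumes "- 1 < \<beta>"
  shows "F_q q \<beta> f (q powi L) = hankel_const \<beta> *\<^sub>R qH p (wt \<beta>) (\<lambda>N. f (q powi N)) (p powi (L + \<kappa>))"
  by (simp only: F_q_qH[OF assms] spectral_point)

lemma F_q_half_lattice:
  "F_q q (- 1 / 2) f (q powi L) = hankel_const (- 1 / 2) *\<^sub>R qH p q (\<lambda>N. f (q powi N)) (p powi (L + \<kappa>))"
  using F_q_lattice[of "- 1 / 2" f L] by simp

lemma F_q_scaleR: "- 1 < \<beta> \<Longrightarrow> F_q q \<beta> (\<lambda>y. c *\<^sub>R f y) l = c *\<^sub>R F_q q \<beta> f l"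
  by (simp add: F_q_qH P.qH_scaleR mult.commute)

lemma T_q_scaleR: "- 1 < \<beta> \<Longrightarrow> T_q q \<beta> b (\<lambda>y. c *\<^sub>R f y) x = c *\<^sub>R T_q q \<beta> b f x"
proof -
  assume b: "- 1 < \<beta>"
  have "(\<lambda>l. j3 q \<beta> (l * b) *\<^sub>R F_q q \<beta> (\<lambda>y. c *\<^sub>R f y) l) = (\<lambda>l. c *\<^sub>R (j3 q \<beta> (l * b) *\<^sub>R F_q q \<beta> f l))"
    using b by (simp add: F_q_scaleR mult.commute)
  then show ?thesis
    unfolding T_q_def F_q_inv_def
    by (simp only: F_q_scaleR[OF b, of c "\<lambda>l. j3 q \<beta> (l * _) *\<^sub>R F_q q \<beta> f l"] scaleR_left_commute)
qed

lemma F_q_dilate: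
  assumes "- 1 < \<beta>"
  shows "F_q q \<beta> (\<lambda>y. (q powi A) powr (- 2 * \<beta> - 2) *\<^sub>R g (y / q powi A)) (q powi L) = F_q q \<beta> g (q powi (A + L))"
proof -
  have c: "(q powi A) powr (- 2 * \<beta> - 2) = wt \<beta> powi (- A)"
  proof -
    have "q powr (- 2 * \<beta> - 2) = inverse (wt \<beta>)" by (simp add: wt_def flip: powr_minus)
    then show ?thesis by (simp add: powi_powr power_int_minus power_int_inverse)
  qed
  have s: "g (q powi N / q powi A) = g (q powi (N + - A))" for N by (simp add: power_int_diff)
  have pp: "p powi A * p powi (L + \<kappa>) = p powi (A + L + \<kappa>)"
    by (simp add: power_int_add)
  have "qH p (wt \<beta>) (\<lambda>N. g (q powi (N + - A))) (p powi (L + \<kappa>))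
      = wt \<beta> powi A *\<^sub>R qH p (wt \<beta>) (\<lambda>N. g (q powi N)) (p powi (A + L + \<kappa>))"
    using P.qH_shift[of "wt \<beta>" "\<lambda>N. g (q powi N)" "- A"] wt_bounds[OF assms] pp by simp
  then have "F_q q \<beta> (\<lambda>y. g (y / q powi A)) (q powi L) = wt \<beta> powi A *\<^sub>R F_q q \<beta> g (q powi (A + L))"
    unfolding F_q_lattice[OF assms] s by (simp add: mult.commute)
  then show ?thesis
    using wt_bounds[OF assms] unfolding c F_q_scaleR[OF assms] by (simp add: power_int_minus)
qed

text \<open>At \<open>\<beta> = - 1 / 2\<close> the weight in the integral is \<open>1\<close>, and the two normalisations of the dilated
  wavelet agree: \<open>sqrt a * a powr (- 1) = 1 / sqrt a\<close>.\<close>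

lemma q_wavelet_eq_bessel_wavelet:
  assumes "a \<in> Rq_pos q"
  shows "q_wavelet_transform q h f a b = bessel_wavelet_transform q (- 1 / 2) h f a b"
proof -
  have a: "0 < a" using assms by (auto simp: Rq_pos_def)
  have "q_atom q h a b x = bessel_atom q (- 1 / 2) h a b x" for x
  proof -
    have sa: "sqrt a * (a powr (- 1)) = 1 / sqrt a"
    proof -
      have "sqrt a * inverse (sqrt a * sqrt a) = inverse (sqrt a)" using a by (simp del: real_sqrt_mult_self)
      then show ?thesis using a by (simp add: powr_minus inverse_eq_divide)
    qed
    have "T_q q (- 1 / 2) b (\<lambda>y. c *\<^sub>R h (y / a)) x = c *\<^sub>R T_q q (- 1 / 2) b (\<lambda>y. h (y / a)) x" for c
      by (rule T_q_scaleR) simp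
    moreover have "a powr (- 2 * (- 1 / 2) - 2) = a powr (- 1)" by simp
    ultimately show ?thesis
      unfolding q_atom_def bessel_atom_def by (simp only: scaleR_scaleR sa)
  qed
  moreover have "(q powi n) powr (2 * (- 1 / 2) + 1) = 1" for n by simp
  ultimately show ?thesis
    unfolding q_wavelet_transform_def bessel_wavelet_transform_def jackson_0_infty_def
    by (simp only: scaleR_one)
qed

lemma cnj_qH: "cnj (qH p w f Z) = qH p w (\<lambda>N. cnj (f N)) Z"
  unfolding qH_def infsum_cnj[symmetric] by simp

text \<open>Selfadjointness moves the transform from the wavelet to the analysed function, so that the
  wavelet transform becomes a single Hankel transform in the position variable.\<close>

theorem bessel_wavelet_transform_qH:
  assumes \<beta>: "- 1 < \<beta>"
    and f: "wsummable (wt \<beta>) (\<lambda>N. f (q powi N))"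
    and g: "wsummable (wt \<beta>) (\<lambda>L. F_q q \<beta> g (q powi L))"
    and b: "b \<in> Rq_pos0 q"
  shows "bessel_wavelet_transform q \<beta> g f (q powi A) b =
    (hankel_const \<beta> * sqrt (q powi A) * q powr (- 4 * \<beta> - 2)) *\<^sub>R
    qH p (wt \<beta>) (\<lambda>L. cnj (F_q q \<beta> g (q powi (A + L))) * F_q q \<beta> f (q powi L)) ((1 - q)\<^sup>2 * b\<^sup>2)"
proof -
  note w = wt_bounds[OF \<beta>]
  define Zb where "Zb = (1 - q)\<^sup>2 * b\<^sup>2"
  have Zb: "Zb \<in> Rq_pos0 p" unfolding Zb_def by (rule spectral_point_Rq_pos0[OF b])
  define P0 where "P0 = qpoch_inf (wt \<beta>) p"
  have P0: "0 < P0" unfolding P0_def using P.qpoch_inf_pos[of "wt \<beta>"] w by simp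
  have j: "j3 q \<beta> (q powi L * b) = qJ p (wt \<beta>) (p powi L * Zb) / P0" for L
    unfolding j3_qJ[OF \<beta>] P0_def Zb_def by (simp add: q2_powi power_mult_distrib mult_ac)
  define K where "K = sqrt (q powi A) * q powr (- 4 * \<beta> - 2) * hankel_const \<beta>"
  define k where "k L = j3 q \<beta> (q powi L * b) *\<^sub>R F_q q \<beta> g (q powi (A + L))" for L
  define kc where "kc L = cnj (k L)" for L
  have wk: "wsummable (wt \<beta>) kc"
  proof (rule wsummable_comparison)
    show "wsummable (wt \<beta>) (\<lambda>L. F_q q \<beta> g (q powi (L + A)))"
      using wsummable_shift[of "wt \<beta>" "\<lambda>L. F_q q \<beta> g (q powi L)" A] w g by simp
    show "norm (kc L) \<le> (P.qJ_bound (wt \<beta>) / P0) * norm (F_q q \<beta> g (q powi (L + A)))" for L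
      unfolding kc_def k_def j using w P0 Zb
      by (auto simp: abs_mult abs_divide add.commute intro!: mult_right_mono divide_right_mono)
  qed (use w in auto)
  have atom: "bessel_atom q \<beta> g (q powi A) b (q powi n) = K *\<^sub>R qH p (wt \<beta>) k (p powi (n + \<kappa>))" for n
    unfolding bessel_atom_def T_q_def F_q_inv_def F_q_lattice[OF \<beta>, of "\<lambda>l. j3 q \<beta> (l * b) *\<^sub>R _ l"]
      F_q_dilate[OF \<beta>] K_def k_def[abs_def] by (simp add: mult_ac)
  have "q powi n *\<^sub>R ((q powi n) powr (2 * \<beta> + 1) *\<^sub>R (f (q powi n) * cnj (bessel_atom q \<beta> g (q powi A) b (q powi n))))
    = K *\<^sub>R (wt \<beta> powi n *\<^sub>R (f (q powi n) * qH p (wt \<beta>) kc (p powi n * p powi \<kappa>)))" for n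
  proof -
    have "cnj (bessel_atom q \<beta> g (q powi A) b (q powi n)) = K *\<^sub>R qH p (wt \<beta>) kc (p powi n * p powi \<kappa>)"
      unfolding atom kc_def[abs_def] cnj_qH[symmetric] by (simp add: power_int_add)
    then show ?thesis unfolding powi_weight[symmetric] by (simp add: mult_ac)
  qed
  note eq = this
  have "bessel_wavelet_transform q \<beta> g f (q powi A) b
    = (c_q q \<beta> * (1 - q) * K) *\<^sub>R (\<Sum>\<^sub>\<infinity>n. wt \<beta> powi n *\<^sub>R (f (q powi n) * qH p (wt \<beta>) kc (p powi n * p powi \<kappa>)))"
    unfolding bessel_wavelet_transform_def jackson_0_infty_def eq
    unfolding infsum_scaleR_right
    unfolding scaleR_scaleR by (simp only: mult.assoc)
  also have "(\<Sum>\<^sub>\<infinity>n. wt \<beta> powi n *\<^sub>R (f (q powi n) * qH p (wt \<beta>) kc (p powi n * p powi \<kappa>)))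
    = (\<Sum>\<^sub>\<infinity>L. wt \<beta> powi L *\<^sub>R (kc L * qH p (wt \<beta>) (\<lambda>N. f (q powi N)) (p powi L * p powi \<kappa>)))"
    by (rule P.qH_selfadjoint[OF w _ f wk]) simp
  also have "\<dots> = (1 / (P0 * hankel_const \<beta>)) *\<^sub>R
      qH p (wt \<beta>) (\<lambda>L. cnj (F_q q \<beta> g (q powi (A + L))) * F_q q \<beta> f (q powi L)) Zb"
    unfolding qH_def[of p "wt \<beta>" "\<lambda>L. cnj (F_q q \<beta> g (q powi (A + L))) * F_q q \<beta> f (q powi L)"] infsum_scaleR_right[symmetric]
  proof (rule infsum_cong)
    fix L
    have "qH p (wt \<beta>) (\<lambda>N. f (q powi N)) (p powi L * p powi \<kappa>) = (1 / hankel_const \<beta>) *\<^sub>R F_q q \<beta> f (q powi L)"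
      unfolding F_q_lattice[OF \<beta>] by (simp add: power_int_add)
    then show "wt \<beta> powi L *\<^sub>R (kc L * qH p (wt \<beta>) (\<lambda>N. f (q powi N)) (p powi L * p powi \<kappa>))
      = (1 / (P0 * hankel_const \<beta>)) *\<^sub>R (wt \<beta> powi L * qJ p (wt \<beta>) (p powi L * Zb)) *\<^sub>R
        (cnj (F_q q \<beta> g (q powi (A + L))) * F_q q \<beta> f (q powi L))"
      unfolding kc_def k_def j by (simp add: mult.commute)
  qed
  finally have "bessel_wavelet_transform q \<beta> g f (q powi A) b = (c_q q \<beta> * (1 - q) / P0 * K / hankel_const \<beta>) *\<^sub>R
      qH p (wt \<beta>) (\<lambda>L. cnj (F_q q \<beta> g (q powi (A + L))) * F_q q \<beta> f (q powi L)) Zb"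
    by (simp add: mult_ac)
  also have "c_q q \<beta> * (1 - q) / P0 * K / hankel_const \<beta> = hankel_const \<beta> * sqrt (q powi A) * q powr (- 4 * \<beta> - 2)"
    unfolding P0_def hankel_const_eq[OF \<beta>] K_def by simp
  finally show ?thesis by (simp only: Zb_def)
qed

section \<open>The transforms of Riemann-Liouville and Weyl type\<close>

definition RL_const :: real where "RL_const = qpoch_inf q p / qpoch_inf (q * r) p"

definition Weyl_const :: real where "Weyl_const = (q * (1 - q)) powr (\<alpha> + 1 / 2)"

lemma qpoch_inf_q_pos: "0 < qpoch_inf q p" "0 < qpoch_inf (q * r) p" "0 < qpoch_inf r p" "0 < qpoch_inf p p"
  using wt_alpha_bounds P.p_less_1 by (simp_all add: P.qpoch_inf_pos)

lemma RL_const_nz [simp]: "RL_const \<noteq> 0" and Weyl_const_nz [simp]: "Weyl_const \<noteq> 0"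
  unfolding RL_const_def Weyl_const_def using qpoch_inf_q_pos by auto

lemma qGamma_values:
  "qGamma p (\<alpha> + 1) = qpoch_inf p p / qpoch_inf (q * r) p * (1 - p) powr (- \<alpha>)"
  "qGamma p (1 / 2) = qpoch_inf p p / qpoch_inf q p * (1 - p) powr (1 / 2)"
  "qGamma p (\<alpha> + 1 / 2) = qpoch_inf p p / qpoch_inf r p * (1 - p) powr (1 / 2 - \<alpha>)"
proof -
  show "qGamma p (\<alpha> + 1) = qpoch_inf p p / qpoch_inf (q * r) p * (1 - p) powr (- \<alpha>)"
    by (simp add: qGamma_wt wt_alpha)
  show "qGamma p (1 / 2) = qpoch_inf p p / qpoch_inf q p * (1 - p) powr (1 / 2)"
    using qGamma_wt[of "- 1 / 2"] by simp
  have "wt (\<alpha> - 1 / 2) = r" by (simp add: wt_def r_def algebra_simps)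
  then show "qGamma p (\<alpha> + 1 / 2) = qpoch_inf p p / qpoch_inf r p * (1 - p) powr (1 / 2 - \<alpha>)"
    using qGamma_wt[of "\<alpha> - 1 / 2"] by (simp add: add.commute)
qed

lemma kernel_ratio:
  "qpoch_inf (p * p ^ n) p / qpoch_inf (r * p ^ n) p = qpoch_inf p p / qpoch_inf r p * qbinom_coeff p r n"
proof -
  have "qpoch_inf (p * p ^ n) p = qpoch_inf p p / qpoch p p n" "qpoch_inf (r * p ^ n) p = qpoch_inf r p / qpoch r p n"
    using P.qpoch_inf_split[of p n] P.qpoch_inf_split[of r n] P.qpoch_p_nz[of n] P.qpoch_pos[of r n] by auto
  then show ?thesis by (simp add: qbinom_coeff_def)
qed

lemma RL_normalisation:
  "(1 + q) * qGamma p (\<alpha> + 1) / (qGamma p (1 / 2) * qGamma p (\<alpha> + 1 / 2)) * (1 - q) * (qpoch_inf p p / qpoch_inf r p) = RL_const"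
proof -
  have p1: "0 < 1 - p" using P.p_less_1 by simp
  have "(1 - p) powr (1 / 2) * (1 - p) powr (1 / 2 - \<alpha>) = (1 - p) powr (1 + - \<alpha>)"
    by (simp flip: powr_add)
  also have "\<dots> = (1 - p) * (1 - p) powr (- \<alpha>)" using p1 by (simp only: powr_add) simp
  finally have e: "(1 - p) powr (1 / 2) * (1 - p) powr (1 / 2 - \<alpha>) = (1 - q) * (1 + q) * (1 - p) powr (- \<alpha>)"
    by (simp only: one_minus_p)
  define X where "X = (1 - p) powr (- \<alpha>)"
  have X: "0 < X" using p1 by (simp add: X_def)
  have "(1 + q) * qGamma p (\<alpha> + 1) / (qGamma p (1 / 2) * qGamma p (\<alpha> + 1 / 2)) * (1 - q) * (qpoch_inf p p / qpoch_inf r p)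
    = (1 + q) * (qpoch_inf p p / qpoch_inf (q * r) p * X) /
      (qpoch_inf p p / qpoch_inf q p * (qpoch_inf p p / qpoch_inf r p) * ((1 - p) powr (1 / 2) * (1 - p) powr (1 / 2 - \<alpha>)))
      * (1 - q) * (qpoch_inf p p / qpoch_inf r p)"
    unfolding qGamma_values X_def by (simp only: mult_ac)
  also have "\<dots> = RL_const"
    unfolding e X_def[symmetric] RL_const_def
    using qpoch_inf_q_pos X q_pos by (simp add: divide_simps add_pos_pos)
  finally show ?thesis .
qed

text \<open>The bound makes the Jackson series absolutely convergent, so that it may be read as an unconditional
  sum.\<close>

lemma q_RL_eq:
  assumes x: "x \<in> Rq q" and B: "\<And>n. norm (f (x * q ^ n)) \<le> B"
  shows "q_RL q \<alpha> f x = RL_const *\<^sub>R (\<Sum>\<^sub>\<infinity>n. (qbinom_coeff p r n * q ^ n) *\<^sub>R f (x * q ^ n))"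
proof -
  define R where "R = qpoch_inf p p / qpoch_inf r p"
  have t: "q ^ n *\<^sub>R ((qpoch_inf ((1 * q ^ n)\<^sup>2 * q\<^sup>2) p / qpoch_inf ((1 * q ^ n)\<^sup>2 * q powr (2 * \<alpha> + 1)) p) *\<^sub>R f (x * (1 * q ^ n)))
    = R *\<^sub>R ((qbinom_coeff p r n * q ^ n) *\<^sub>R f (x * q ^ n))" for n
  proof -
    have "(1 * q ^ n)\<^sup>2 = p ^ n" by (simp add: mult.commute flip: power_mult)
    then have "qpoch_inf ((1 * q ^ n)\<^sup>2 * q\<^sup>2) p / qpoch_inf ((1 * q ^ n)\<^sup>2 * q powr (2 * \<alpha> + 1)) p = R * qbinom_coeff p r n"
      using kernel_ratio[of n] by (simp add: R_def r_def mult.commute)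
    then show ?thesis by (simp add: mult_ac)
  qed
  have s: "(\<lambda>n. (qbinom_coeff p r n * q ^ n) *\<^sub>R f (x * q ^ n)) summable_on UNIV"
  proof (rule abs_summable_summable, rule summable_on_comparison_test)
    show "(\<lambda>n. qbinom_coeff p r n * q ^ n * B) summable_on UNIV"
      by (intro summable_on_cmult_left P.qbinom_pow_summable) (auto intro: less_imp_le)
    show "norm ((qbinom_coeff p r n * q ^ n) *\<^sub>R f (x * q ^ n)) \<le> qbinom_coeff p r n * q ^ n * B" for n
      using B[of n] P.qbinom_coeff_bounds(1)[of r n] by (simp add: abs_mult mult_left_mono less_imp_le)
  qed auto
  have "(\<lambda>n. R *\<^sub>R ((qbinom_coeff p r n * q ^ n) *\<^sub>R f (x * q ^ n))) sums
      (R *\<^sub>R (\<Sum>\<^sub>\<infinity>n. (qbinom_coeff p r n * q ^ n) *\<^sub>R f (x * q ^ n)))"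
    by (intro sums_scaleR_right has_sum_imp_sums has_sum_infsum s)
  then have "jackson_0_to q 1 (\<lambda>t. (qpoch_inf (t\<^sup>2 * q\<^sup>2) p / qpoch_inf (t\<^sup>2 * q powr (2 * \<alpha> + 1)) p) *\<^sub>R f (x * t))
     = ((1 - q) * R) *\<^sub>R (\<Sum>\<^sub>\<infinity>n. (qbinom_coeff p r n * q ^ n) *\<^sub>R f (x * q ^ n))"
    unfolding jackson_0_to_def t by (simp add: sums_iff)
  then show ?thesis
    using x RL_normalisation unfolding q_RL_def R_def by (simp add: mult_ac)
qed

lemma Weyl_normalisation:
  "q * (1 + 1 / q) powr (- \<alpha> + 1 / 2) / qGamma p (\<alpha> + 1 / 2) * (1 - q) * (qpoch_inf p p / qpoch_inf r p) = Weyl_const"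
proof -
  define s where "s = 1 / 2 - \<alpha>"
  have "(1 + 1 / q) powr s / (1 - p) powr s = ((1 + 1 / q) / (1 - p)) powr s"
    by (simp add: powr_divide)
  also have "(1 + 1 / q) / (1 - p) = inverse (q * (1 - q))"
    using add_pos_pos[of 1 q] unfolding one_minus_p by (simp add: divide_simps)
  also have "inverse (q * (1 - q)) powr s = (q * (1 - q)) powr (- s)"
    by (subst inverse_powr) (simp_all add: powr_minus)
  finally have e: "(1 + 1 / q) powr s / (1 - p) powr s = (q * (1 - q)) powr (- s)" .
  have "q * (1 + 1 / q) powr (- \<alpha> + 1 / 2) / qGamma p (\<alpha> + 1 / 2) * (1 - q) * (qpoch_inf p p / qpoch_inf r p)
    = (q * (1 - q)) * ((1 + 1 / q) powr s / (1 - p) powr s)"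
    using qpoch_inf_q_pos unfolding qGamma_values s_def by (simp add: mult_ac)
  also have "\<dots> = (q * (1 - q)) powr 1 * (q * (1 - q)) powr (- s)" unfolding e by simp
  also have "\<dots> = Weyl_const" unfolding powr_add[symmetric] Weyl_const_def s_def by (simp add: add.commute)
  finally show ?thesis .
qed

text \<open>The kernel vanishes for \<open>t < x\<close>, so nothing is subtracted by the integral up to \<open>q * x\<close>, and the
  remaining points are \<open>t = q powi (B - n)\<close>.\<close>

lemma q_Weyl_lattice:
  "q_Weyl q \<alpha> f (q powi B) = Weyl_const *\<^sub>R Weyl_seq p r (\<lambda>N. f (q powi N)) B"
proof -
  define G where "G t = (qpoch_inf (q\<^sup>2 * (q powi B)\<^sup>2 / t\<^sup>2) p / qpoch_inf (q powr (2 * \<alpha> + 1) * (q powi B)\<^sup>2 / t\<^sup>2) p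
      * t powr (2 * \<alpha>)) *\<^sub>R f t" for t
  define R where "R = qpoch_inf p p / qpoch_inf r p"
  have quot: "(q powi B)\<^sup>2 / (q powi M)\<^sup>2 = p powi (B - M)" for M
    by (simp add: q2_powi power_int_diff power_divide)
  have zero: "G (q powi M) = 0" if "B < M" for M
  proof -
    have "q\<^sup>2 * (q powi B)\<^sup>2 / (q powi M)\<^sup>2 = p powi (1 + (B - M))"
      unfolding times_divide_eq_right[symmetric] quot by (simp add: power_int_add)
    then have "qpoch_inf (q\<^sup>2 * (q powi B)\<^sup>2 / (q powi M)\<^sup>2) p = 0"
      using P.qpoch_inf_powi_nonpos[of "1 + (B - M)"] that by simp
    then show ?thesis by (simp add: G_def)
  qed
  have "q * \<bar>q powi B\<bar> * q ^ n = q powi (B + 1 + int n)" for n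
    by (simp add: power_int_add mult_ac)
  then have "jackson_0_to q (q * \<bar>q powi B\<bar>) G = 0"
    unfolding jackson_0_to_def using zero by simp
  moreover have "jackson_0_infty q G = ((1 - q) * R) *\<^sub>R Weyl_seq p r (\<lambda>N. f (q powi N)) B"
  proof -
    have "(\<Sum>\<^sub>\<infinity>M. q powi M *\<^sub>R G (q powi M)) = (\<Sum>\<^sub>\<infinity>M\<in>range (\<lambda>n. B - int n). q powi M *\<^sub>R G (q powi M))"
    proof (rule infsum_cong_neutral)
      fix M :: int assume "M \<in> UNIV - range (\<lambda>n. B - int n)"
      have "B < M"
      proof (rule ccontr)
        assume "\<not> B < M"
        then have "M = B - int (nat (B - M))" by simp
        with \<open>M \<in> UNIV - range (\<lambda>n. B - int n)\<close> show False by blast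
      qed
      then show "q powi M *\<^sub>R G (q powi M) = 0" using zero by simp
    qed auto
    also have "\<dots> = (\<Sum>\<^sub>\<infinity>n. q powi (B - int n) *\<^sub>R G (q powi (B - int n)))"
      by (subst infsum_reindex) (auto simp: o_def)
    also have "\<dots> = (\<Sum>\<^sub>\<infinity>n. R *\<^sub>R ((qbinom_coeff p r n * r powi (B - int n)) *\<^sub>R f (q powi (B - int n))))"
    proof (rule infsum_cong)
      fix n :: nat
      have 1: "q\<^sup>2 * (q powi B)\<^sup>2 / (q powi (B - int n))\<^sup>2 = p * p ^ n"
        and 2: "q powr (2 * \<alpha> + 1) * (q powi B)\<^sup>2 / (q powi (B - int n))\<^sup>2 = r * p ^ n"
        using quot[of "B - int n"] by (simp_all add: r_def flip: times_divide_eq_right)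
      have 3: "q powi (B - int n) * (q powi (B - int n)) powr (2 * \<alpha>) = r powi (B - int n)"
        by (simp add: powi_times_powr r_def)
      have "q powi (B - int n) *\<^sub>R G (q powi (B - int n))
        = (qpoch_inf (p * p ^ n) p / qpoch_inf (r * p ^ n) p * (q powi (B - int n) * (q powi (B - int n)) powr (2 * \<alpha>))) *\<^sub>R f (q powi (B - int n))"
        unfolding G_def 1 2 by (simp add: mult_ac)
      also have "\<dots> = R *\<^sub>R ((qbinom_coeff p r n * r powi (B - int n)) *\<^sub>R f (q powi (B - int n)))"
        unfolding kernel_ratio 3 R_def by (simp add: mult_ac)
      finally show "q powi (B - int n) *\<^sub>R G (q powi (B - int n)) = R *\<^sub>R ((qbinom_coeff p r n * r powi (B - int n)) *\<^sub>R f (q powi (B - int n)))" .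
    qed
    finally show ?thesis unfolding jackson_0_infty_def Weyl_seq_def infsum_scaleR_right by simp
  qed
  ultimately have "jackson_from q (q * \<bar>q powi B\<bar>) G = ((1 - q) * R) *\<^sub>R Weyl_seq p r (\<lambda>N. f (q powi N)) B"
    unfolding jackson_from_def by simp
  then have "q_Weyl q \<alpha> f (q powi B) = (q * (1 + 1 / q) powr (- \<alpha> + 1 / 2) / qGamma p (\<alpha> + 1 / 2)) *\<^sub>R
      (((1 - q) * R) *\<^sub>R Weyl_seq p r (\<lambda>N. f (q powi N)) B)"
    unfolding q_Weyl_def G_def by simp
  then show ?thesis
    using Weyl_normalisation unfolding R_def scaleR_scaleR by (simp only: mult.assoc)
qed

lemma q_Weyl_0:
  "q_Weyl q \<alpha> f 0 = (Weyl_const * (qpoch_inf r p / qpoch_inf p p)) *\<^sub>R (\<Sum>\<^sub>\<infinity>N. r powi N *\<^sub>R f (q powi N))"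
proof -
  have e: "q powi N *\<^sub>R ((q powi N) powr (2 * \<alpha>) *\<^sub>R f (q powi N)) = r powi N *\<^sub>R f (q powi N)" for N
    by (simp add: powi_times_powr r_def)
  have c: "q * (1 + 1 / q) powr (- \<alpha> + 1 / 2) / qGamma p (\<alpha> + 1 / 2) * (1 - q) = Weyl_const * (qpoch_inf r p / qpoch_inf p p)"
    unfolding Weyl_normalisation[symmetric] using qpoch_inf_q_pos by simp
  have "q_Weyl q \<alpha> f 0 = (q * (1 + 1 / q) powr (- \<alpha> + 1 / 2) / qGamma p (\<alpha> + 1 / 2)) *\<^sub>R ((1 - q) *\<^sub>R
      (\<Sum>\<^sub>\<infinity>N. q powi N *\<^sub>R ((q powi N) powr (2 * \<alpha>) *\<^sub>R f (q powi N))))"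
    unfolding q_Weyl_def jackson_from_def jackson_0_infty_def jackson_0_to_def by simp
  then show ?thesis unfolding e unfolding scaleR_scaleR c .
qed

lemma q_Weyl_minus: "x \<in> Rq q \<Longrightarrow> q_Weyl q \<alpha> f (- x) = q_Weyl q \<alpha> f x"
  unfolding q_Weyl_def by (simp add: Rq_def) (auto)

end

context q_bessel
begin

lemma S_q_mom_iff:
  "f \<in> S_q_mom q \<beta> \<longleftrightarrow> f \<in> S_q q \<and> moments_vanish p (wt \<beta>) (\<lambda>N. f (q powi N))"
proof -
  have "jackson_0_infty q (\<lambda>x. x powr (2 * real k + 2 * \<beta> + 1) *\<^sub>R f x)
      = (1 - q) *\<^sub>R (\<Sum>\<^sub>\<infinity>N. (wt \<beta> * p ^ k) powi N *\<^sub>R f (q powi N))" for k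
  proof -
    have "wt \<beta> * p ^ k = q powr (2 * \<beta> + 2) * q powr real (2 * k)"
      by (subst powr_realpow) (simp_all add: wt_def power_mult)
    also have "\<dots> = q powr (2 * real k + 2 * \<beta> + 1 + 1)"
      by (simp add: powr_add[symmetric] algebra_simps)
    finally have "q powi N *\<^sub>R ((q powi N) powr (2 * real k + 2 * \<beta> + 1) *\<^sub>R f (q powi N))
        = (wt \<beta> * p ^ k) powi N *\<^sub>R f (q powi N)" for N
      by (simp only: scaleR_scaleR powi_times_powr)
    then show ?thesis unfolding jackson_0_infty_def by (simp only:)
  qed
  then show ?thesis unfolding S_q_mom_def moments_vanish_def by simp
qed

lemma S_q_mom_schwartz: "f \<in> S_q_mom q \<beta> \<Longrightarrow> schwartz_seq p (\<lambda>N. f (q powi N))"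
  using S_q_imp_schwartz_seq(1) S_q_mom_iff by blast

lemma S_q_mom_bounded:
  assumes "f \<in> S_q_mom q \<beta>" "x \<in> Rq q"
  shows "\<exists>B. \<forall>n. norm (f (x * q ^ n)) \<le> B"
proof -
  have fS: "f \<in> S_q q" using assms(1) S_q_mom_iff by blast
  obtain B where B: "\<And>N. norm (f (q powi N)) \<le> B"
    using P.schwartz_seq_bounded[OF S_q_mom_schwartz[OF assms(1)], of 0] by auto
  have "norm (f y) \<le> B + norm (f 0)" if "y \<in> Rq q" for y
  proof -
    have "0 \<le> B" using B[of 0] by (rule order_trans[OF norm_ge_zero])
    moreover have "norm (f (- (q powi N))) \<le> B" for N
      using B[of N] S_q_imp_schwartz_seq(3)[OF fS Rq_mem(1)[of N]] by simp
    ultimately show ?thesis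
      using that B by (auto simp: Rq_def Rq_pos_def intro: add_increasing2)
  qed
  then show ?thesis using Rq_mult_pow[OF assms(2)] by blast
qed

lemma q_RL_lattice:
  assumes "f \<in> S_q_mom q \<beta>"
  shows "q_RL q \<alpha> f (q powi N) = RL_const *\<^sub>R RL_seq p q r (\<lambda>N. f (q powi N)) N"
proof -
  obtain B where B: "\<And>n. norm (f (q powi N * q ^ n)) \<le> B"
    using S_q_mom_bounded[OF assms, of "q powi N"] by auto
  show ?thesis
    unfolding RL_seq_def using q_RL_eq[of "q powi N" f B] B by (simp add: power_int_add)
qed

text \<open>Extend the preimage on the lattice to an element of the function space; the values at \<open>0\<close> agree by
  continuity along the lattice.\<close>

theorem q_RL_surjective:
  assumes "f \<in> S_q_mom q \<alpha>"
  shows "f \<in> q_RL q \<alpha> ` S_q_mom q (- 1 / 2)"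
proof -
  have fS: "f \<in> S_q q" and fm: "moments_vanish p (q * r) (\<lambda>N. f (q powi N))"
    using assms unfolding S_q_mom_iff wt_alpha by auto
  define c where "c = 1 / RL_const"
  have c: "RL_const * c = 1" by (simp add: c_def)
  have "schwartz_seq p (\<lambda>N. c *\<^sub>R f (q powi N))"
    by (intro P.schwartz_seq_scaleR S_q_mom_schwartz[OF assms])
  moreover have "moments_vanish p (q * r) (\<lambda>N. c *\<^sub>R f (q powi N))"
    using fm unfolding moments_vanish_def scaleR_left_commute[of _ c] infsum_scaleR_right by simp
  ultimately obtain F :: "real \<Rightarrow> complex" where F:
    "schwartz_seq p (\<lambda>N. F (p powi N))" "moments_vanish p q (\<lambda>N. F (p powi N))"
    "(\<lambda>n. F (p powi int n)) \<longlonglongrightarrow> F 0"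
    "\<And>N. (\<Sum>\<^sub>\<infinity>n. (qbinom_coeff p r n * q ^ n) *\<^sub>R F (p powi N * p ^ n)) = c *\<^sub>R f (q powi N)"
    "(\<lambda>n. c *\<^sub>R f (q powi int n)) \<longlonglongrightarrow> (\<Sum>\<^sub>\<infinity>n. (qbinom_coeff p r n * q ^ n) *\<^sub>R F 0)"
    using P.RL_surjective_seq[of q r "\<lambda>N. c *\<^sub>R f (q powi N)"] by auto
  obtain h where h: "h \<in> S_q q" "\<And>N. h (q powi N) = F (p powi N)" "h 0 = F 0"
    using S_q_extension[OF F(1,3)] by blast
  have hm: "h \<in> S_q_mom q (- 1 / 2)"
    unfolding S_q_mom_iff wt_half using h(1) F(2) by (simp add: h(2))
  have RL: "q_RL q \<alpha> h x = RL_const *\<^sub>R (\<Sum>\<^sub>\<infinity>n. (qbinom_coeff p r n * q ^ n) *\<^sub>R h (x * q ^ n))" if "x \<in> Rq q" for x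
    using S_q_mom_bounded[OF hm that] q_RL_eq[OF that] by blast
  have lat: "q_RL q \<alpha> h (q powi N) = f (q powi N)" for N
  proof -
    have "h (q powi N * q ^ n) = F (p powi N * p ^ n)" for n
      using h(2)[of "N + int n"] by (simp add: power_int_add)
    then have "q_RL q \<alpha> h (q powi N) = RL_const *\<^sub>R (c *\<^sub>R f (q powi N))" by (simp add: RL F(4))
    then show ?thesis by (simp add: c)
  qed
  have "q_RL q \<alpha> h = f"
  proof (rule S_q_eqI[OF fS _ _ lat])
    show "q_RL q \<alpha> h \<in> extensional (Rq q)" by (simp add: q_RL_def)
    show "q_RL q \<alpha> h (- x) = q_RL q \<alpha> h x" if "x \<in> Rq q" for x
    proof -
      have "h (- x * t) = h (x * t)" if "x * t \<in> Rq q" for t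
        using S_q_imp_schwartz_seq(3)[OF h(1) that] by simp
      moreover have "x * q ^ n \<in> Rq q" for n using \<open>x \<in> Rq q\<close> by (rule Rq_mult_pow)
      moreover have "- x \<in> Rq q" using \<open>x \<in> Rq q\<close> by (auto simp: Rq_def)
      ultimately show ?thesis using \<open>x \<in> Rq q\<close> by (simp add: RL)
    qed
    have "(\<lambda>n. RL_const *\<^sub>R (c *\<^sub>R f (q powi int n))) \<longlonglongrightarrow> q_RL q \<alpha> h 0"
      using tendsto_scaleR[OF tendsto_const F(5), of RL_const] by (simp add: RL h(3))
    then show "(\<lambda>n. f (q ^ n)) \<longlonglongrightarrow> q_RL q \<alpha> h 0" by (simp add: c)
  qed
  then show ?thesis using hm by (intro image_eqI[of _ _ h]) auto
qed

theorem q_Weyl_surjective: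
  assumes "f \<in> S_q_mom q (- 1 / 2)"
  shows "f \<in> q_Weyl q \<alpha> ` S_q_mom q \<alpha>"
proof -
  have fS: "f \<in> S_q q" and fm: "moments_vanish p q (\<lambda>N. f (q powi N))"
    using assms unfolding S_q_mom_iff wt_half by auto
  define c where "c = 1 / Weyl_const"
  have c: "Weyl_const * c = 1" by (simp add: c_def)
  have "schwartz_seq p (\<lambda>N. c *\<^sub>R f (q powi N))"
    by (intro P.schwartz_seq_scaleR S_q_mom_schwartz[OF assms])
  moreover have "moments_vanish p q (\<lambda>N. c *\<^sub>R f (q powi N))"
    using fm unfolding moments_vanish_def scaleR_left_commute[of _ c] infsum_scaleR_right by simp
  ultimately obtain F :: "real \<Rightarrow> complex" where F:
    "schwartz_seq p (\<lambda>N. F (p powi N))" "moments_vanish p (q * r) (\<lambda>N. F (p powi N))"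
    "(\<lambda>n. F (p powi int n)) \<longlonglongrightarrow> F 0"
    "Weyl_seq p r (\<lambda>N. F (p powi N)) = (\<lambda>N. c *\<^sub>R f (q powi N))"
    "(\<lambda>n. c *\<^sub>R f (q powi int n)) \<longlonglongrightarrow> (qpoch_inf r p / qpoch_inf p p) *\<^sub>R (\<Sum>\<^sub>\<infinity>N. r powi N *\<^sub>R F (p powi N))"
    using P.Weyl_surjective_seq[of q r "\<lambda>N. c *\<^sub>R f (q powi N)"] by auto
  obtain h where h: "h \<in> S_q q" "\<And>N. h (q powi N) = F (p powi N)" "h 0 = F 0"
    using S_q_extension[OF F(1,3)] by blast
  have hm: "h \<in> S_q_mom q \<alpha>"
    unfolding S_q_mom_iff wt_alpha using h(1) F(2) by (simp add: h(2))
  have lat: "q_Weyl q \<alpha> h (q powi N) = f (q powi N)" for N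
    unfolding q_Weyl_lattice h(2) F(4) by (simp add: c)
  have "q_Weyl q \<alpha> h = f"
  proof (rule S_q_eqI[OF fS _ q_Weyl_minus lat])
    show "q_Weyl q \<alpha> h \<in> extensional (Rq q)" by (simp add: q_Weyl_def)
    have "(\<lambda>n. Weyl_const *\<^sub>R (c *\<^sub>R f (q powi int n))) \<longlonglongrightarrow> q_Weyl q \<alpha> h 0"
      using tendsto_scaleR[OF tendsto_const F(5), of Weyl_const] by (simp add: q_Weyl_0 h(2))
    then show "(\<lambda>n. f (q ^ n)) \<longlonglongrightarrow> q_Weyl q \<alpha> h 0" by (simp add: c)
  qed
  then show ?thesis using hm by (intro image_eqI[of _ _ h]) auto
qed

section \<open>The wavelet transforms\<close>

lemma Weyl_const_square: "Weyl_const * Weyl_const = r powi (1 + \<kappa>)"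
proof -
  have "q * (1 - q) = q powi (1 + \<kappa>)" by (simp add: kappa power_int_add)
  moreover have "Weyl_const * Weyl_const = (q * (1 - q)) powr (2 * \<alpha> + 1)"
    unfolding Weyl_const_def powr_add[symmetric] by (simp add: algebra_simps)
  ultimately show ?thesis by (simp only: powi_powr r_def)
qed

lemma hankel_const_alpha: "hankel_const \<alpha> = Weyl_const * hankel_const (- 1 / 2)"
proof -
  have "(q * (1 - q)) powr \<alpha> = (q * (1 - q)) powr (\<alpha> + 1 / 2) * (q * (1 - q)) powr (- 1 / 2)"
    by (simp flip: powr_add)
  then show ?thesis unfolding hankel_const_def Weyl_const_def by simp
qed

text \<open>The compatibility of all normalising constants, used in both parts of the main theorem.\<close>

lemma const_cancel:
  "Weyl_const * (Weyl_const * (q powr (- 4 * \<alpha> - 2) * (r powi (1 - \<kappa>) * y))) = y"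
proof -
  have "q powr (- 4 * \<alpha> - 2) = (q powr (2 * \<alpha> + 1)) powr (- 2)"
  proof -
    have "(2 * \<alpha> + 1) * (- 2) = - 4 * \<alpha> - 2" by (simp add: algebra_simps)
    then show ?thesis by (simp only: powr_powr)
  qed
  also have "\<dots> = r powi (- 2)"
    using powr_real_of_int'[of r "- 2"] by (simp add: r_def)
  finally have "Weyl_const * (Weyl_const * (q powr (- 4 * \<alpha> - 2) * (r powi (1 - \<kappa>) * y)))
      = (r powi (1 + \<kappa>) * (r powi (- 2) * r powi (1 - \<kappa>))) * y"
    unfolding Weyl_const_square[symmetric] by (simp only: mult.assoc)
  also have "r powi (1 + \<kappa>) * (r powi (- 2) * r powi (1 - \<kappa>)) = 1"
    by (simp flip: power_int_add del: power_int_minus)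
  finally show ?thesis by simp
qed

lemma F_q_schwartz:
  assumes "- 1 < \<beta>" "schwartz_seq p (\<lambda>N. f (q powi N))"
  shows "schwartz_seq p (\<lambda>L. F_q q \<beta> f (q powi L))"
  unfolding F_q_lattice[OF assms(1)] using wt_bounds[OF assms(1)]
  by (intro P.schwartz_seq_scaleR P.schwartz_seq_shift[of "\<lambda>L. qH p (wt \<beta>) (\<lambda>N. f (q powi N)) (p powi L)"] P.schwartz_seq_qH assms(2))

text \<open>This is \<open>qH_Weyl\<close> with constants attached: the cosine transform after \<open>q_Weyl\<close> is the Bessel
  transform.\<close>

theorem F_q_Weyl:
  assumes "wsummable (q * r) (\<lambda>N. g (q powi N))"
  shows "F_q q (- 1 / 2) (q_Weyl q \<alpha> g) (q powi L) = F_q q \<alpha> g (q powi L)"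
proof -
  have "F_q q (- 1 / 2) (q_Weyl q \<alpha> g) (q powi L)
    = (hankel_const (- 1 / 2) * Weyl_const) *\<^sub>R qH p q (Weyl_seq p r (\<lambda>N. g (q powi N))) (p powi (L + \<kappa>))"
    by (simp only: F_q_half_lattice q_Weyl_lattice P.qH_scaleR scaleR_scaleR)
  also have "\<dots> = hankel_const \<alpha> *\<^sub>R qH p (q * r) (\<lambda>N. g (q powi N)) (p powi (L + \<kappa>))"
    using assms by (subst P.qH_Weyl) (simp_all add: hankel_const_alpha mult.commute)
  also have "\<dots> = F_q q \<alpha> g (q powi L)"
    using alpha by (subst F_q_lattice) (simp_all add: wt_alpha)
  finally show ?thesis .
qed

text \<open>Dually, \<open>q_RL\<close> multiplies the transform by a power of the spectral variable \<open>q powi L\<close>, hidden in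
  \<open>r powi (- L)\<close>.\<close>

theorem F_q_RL:
  assumes "f \<in> S_q_mom q (- 1 / 2)"
  shows "F_q q \<alpha> (q_RL q \<alpha> f) (q powi L)
    = (Weyl_const * RL_const * r powi (1 - \<kappa>)) *\<^sub>R (r powi (- L) *\<^sub>R F_q q (- 1 / 2) f (q powi L))"
proof -
  have ws: "wsummable q (\<lambda>N. f (q powi N))"
    by (rule P.schwartz_seq_wsummable[OF S_q_mom_schwartz[OF assms]]) simp_all
  have "F_q q \<alpha> (q_RL q \<alpha> f) (q powi L)
    = (hankel_const \<alpha> * RL_const) *\<^sub>R qH p (q * r) (RL_seq p q r (\<lambda>N. f (q powi N))) (p powi (L + \<kappa>))"
    using alpha by (subst F_q_lattice) (simp_all add: wt_alpha q_RL_lattice[OF assms] P.qH_scaleR)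
  also have "\<dots> = (hankel_const \<alpha> * RL_const) *\<^sub>R (r powi (1 - (L + \<kappa>)) *\<^sub>R qH p q (\<lambda>N. f (q powi N)) (p powi (L + \<kappa>)))"
    using ws by (subst P.qH_RL) simp_all
  also have "r powi (1 - (L + \<kappa>)) = r powi (1 - \<kappa>) * r powi (- L)"
    by (simp flip: power_int_add add: algebra_simps)
  also have "(hankel_const \<alpha> * RL_const) *\<^sub>R ((r powi (1 - \<kappa>) * r powi (- L)) *\<^sub>R qH p q (\<lambda>N. f (q powi N)) (p powi (L + \<kappa>)))
    = (Weyl_const * RL_const * r powi (1 - \<kappa>)) *\<^sub>R (r powi (- L) *\<^sub>R (hankel_const (- 1 / 2) *\<^sub>R qH p q (\<lambda>N. f (q powi N)) (p powi (L + \<kappa>))))"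
    unfolding hankel_const_alpha scaleR_scaleR by (simp only: mult_ac)
  also have "hankel_const (- 1 / 2) *\<^sub>R qH p q (\<lambda>N. f (q powi N)) (p powi (L + \<kappa>)) = F_q q (- 1 / 2) f (q powi L)"
    by (simp only: F_q_half_lattice)
  finally show ?thesis .
qed

lemma q_wavelet_transform_qH:
  assumes g: "g \<in> S_q_mom q \<alpha>" and f: "f \<in> S_q_mom q (- 1 / 2)" and b: "b \<in> Rq_pos0 q"
  shows "q_wavelet_transform q (q_Weyl q \<alpha> g) f (q powi A) b =
    (hankel_const (- 1 / 2) * sqrt (q powi A)) *\<^sub>R
    qH p q (\<lambda>L. cnj (F_q q \<alpha> g (q powi (A + L))) * F_q q (- 1 / 2) f (q powi L)) ((1 - q)\<^sup>2 * b\<^sup>2)"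
proof -
  have half: "- 1 < (- 1 / 2 :: real)" by simp
  have wg: "wsummable (q * r) (\<lambda>N. g (q powi N))"
    by (rule P.schwartz_seq_wsummable[OF S_q_mom_schwartz[OF g] wt_alpha_bounds])
  have wf: "wsummable (wt (- 1 / 2)) (\<lambda>N. f (q powi N))"
    unfolding wt_half by (rule P.schwartz_seq_wsummable[OF S_q_mom_schwartz[OF f]]) simp_all
  have wF: "wsummable (wt (- 1 / 2)) (\<lambda>L. F_q q (- 1 / 2) (q_Weyl q \<alpha> g) (q powi L))"
    unfolding wt_half F_q_Weyl[OF wg] using alpha
    by (intro P.schwartz_seq_wsummable F_q_schwartz S_q_mom_schwartz[OF g]) simp_all
  have one: "q powr (- 4 * (- 1 / 2) - 2) = 1" by simp
  have "q powi A \<in> Rq_pos q" by (simp add: Rq_pos_def)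
  then show ?thesis
    unfolding q_wavelet_eq_bessel_wavelet[OF \<open>q powi A \<in> Rq_pos q\<close>]
      bessel_wavelet_transform_qH[OF half wf wF b] F_q_Weyl[OF wg] one wt_half by simp
qed

lemma product_wsummable:
  assumes "g \<in> S_q_mom q \<alpha>" "- 1 < \<beta>" "schwartz_seq p (\<lambda>N. f (q powi N))"
  shows "wsummable q (\<lambda>L. cnj (F_q q \<alpha> g (q powi (A + L))) * F_q q \<beta> f (q powi L))"
proof -
  have "schwartz_seq p (\<lambda>L. F_q q \<alpha> g (q powi L))"
    using alpha by (intro F_q_schwartz S_q_mom_schwartz[OF assms(1)]) simp
  then obtain B where B: "\<And>N. norm (F_q q \<alpha> g (q powi N)) \<le> B"
    using P.schwartz_seq_bounded[of _ 0] by auto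
  have "wsummable q (\<lambda>L. F_q q \<beta> f (q powi L))"
    by (intro P.schwartz_seq_wsummable F_q_schwartz assms) simp_all
  then show ?thesis
    by (rule wsummable_comparison[where C = B]) (simp_all add: norm_mult B mult_right_mono)
qed

text \<open>By \<open>F_q_RL\<close> the density of the left-hand side is the density \<open>U\<close> of the \<open>q\<close>-wavelet transform times
  \<open>r powi (- L)\<close>, and by \<open>RL_qH\<close> this factor is what \<open>q_RL\<close> produces in the position variable.\<close>

theorem bessel_wavelet_transform_RL:
  assumes g: "g \<in> S_q_mom q \<alpha>" and f: "f \<in> S_q_mom q (- 1 / 2)" and Rf: "q_RL q \<alpha> f \<in> S_q_mom q \<alpha>"
    and b: "b \<in> Rq_pos0 q"
  shows "bessel_wavelet_transform q \<alpha> g (q_RL q \<alpha> f) (q powi A) b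
    = q_RL q \<alpha> (q_wavelet_transform q (q_Weyl q \<alpha> g) f (q powi A)) b"
proof -
  have a1: "- 1 < \<alpha>" using alpha by simp
  define Zb where "Zb = (1 - q)\<^sup>2 * b\<^sup>2"
  have Zb: "Zb \<in> Rq_pos0 p" unfolding Zb_def by (rule spectral_point_Rq_pos0[OF b])
  define U where "U L = cnj (F_q q \<alpha> g (q powi (A + L))) * F_q q (- 1 / 2) f (q powi L)" for L
  have wU: "wsummable q U" unfolding U_def
    by (intro product_wsummable g S_q_mom_schwartz[OF f]) simp
  have wR: "wsummable (wt \<alpha>) (\<lambda>N. q_RL q \<alpha> f (q powi N))"
    unfolding wt_alpha by (rule P.schwartz_seq_wsummable[OF S_q_mom_schwartz[OF Rf] wt_alpha_bounds])
  have wFg: "wsummable (wt \<alpha>) (\<lambda>L. F_q q \<alpha> g (q powi L))"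
    unfolding wt_alpha by (intro P.schwartz_seq_wsummable F_q_schwartz S_q_mom_schwartz[OF g] a1 wt_alpha_bounds)
  define V where "V = qH p (q * r) (\<lambda>L. r powi (- L) *\<^sub>R U L) Zb"
  have "(\<lambda>L. cnj (F_q q \<alpha> g (q powi (A + L))) * F_q q \<alpha> (q_RL q \<alpha> f) (q powi L))
      = (\<lambda>L. (Weyl_const * RL_const * r powi (1 - \<kappa>)) *\<^sub>R (r powi (- L) *\<^sub>R U L))"
    unfolding F_q_RL[OF f] U_def by (simp only: mult_scaleR_right)
  then have "bessel_wavelet_transform q \<alpha> g (q_RL q \<alpha> f) (q powi A) b
      = (hankel_const \<alpha> * sqrt (q powi A) * q powr (- 4 * \<alpha> - 2)) *\<^sub>R ((Weyl_const * RL_const * r powi (1 - \<kappa>)) *\<^sub>R V)"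
    unfolding bessel_wavelet_transform_qH[OF a1 wR wFg b] V_def Zb_def[symmetric] wt_alpha by (simp only: P.qH_scaleR)
  also have "\<dots> = (Weyl_const * (Weyl_const * (q powr (- 4 * \<alpha> - 2) * (r powi (1 - \<kappa>) *
      (hankel_const (- 1 / 2) * sqrt (q powi A) * RL_const))))) *\<^sub>R V"
    unfolding hankel_const_alpha scaleR_scaleR by (simp only: mult_ac)
  also have "\<dots> = (hankel_const (- 1 / 2) * sqrt (q powi A) * RL_const) *\<^sub>R V"
    by (simp only: const_cancel)
  finally have L: "bessel_wavelet_transform q \<alpha> g (q_RL q \<alpha> f) (q powi A) b
      = (hankel_const (- 1 / 2) * sqrt (q powi A) * RL_const) *\<^sub>R V" .
  define D where "D = hankel_const (- 1 / 2) * sqrt (q powi A)"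
  have bn: "b * q ^ n \<in> Rq_pos0 q" for n
    using Q.Rq_pos0_mult_pow[OF b] by simp
  have zn: "(1 - q)\<^sup>2 * (b * q ^ n)\<^sup>2 = Zb * p ^ n" for n
    by (simp add: Zb_def power_mult_distrib mult_ac flip: power_mult)
  have \<Phi>: "q_wavelet_transform q (q_Weyl q \<alpha> g) f (q powi A) (b * q ^ n) = D *\<^sub>R qH p q U (Zb * p ^ n)" for n
    unfolding q_wavelet_transform_qH[OF g f bn] zn D_def U_def ..
  have bq: "b \<in> Rq q" using b by (auto simp: Rq_def Rq_pos0_def)
  have bound: "norm (q_wavelet_transform q (q_Weyl q \<alpha> g) f (q powi A) (b * q ^ n))
      \<le> \<bar>D\<bar> * (P.qJ_bound q * (\<Sum>\<^sub>\<infinity>N. q powi N * norm (U N)))" for n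
    unfolding \<Phi> norm_scaleR real_norm_def
    by (intro mult_left_mono P.qH_bounded P.Rq_pos0_mult_pow Zb wU) simp_all
  have "q_RL q \<alpha> (q_wavelet_transform q (q_Weyl q \<alpha> g) f (q powi A)) b
      = RL_const *\<^sub>R (\<Sum>\<^sub>\<infinity>n. (qbinom_coeff p r n * q ^ n) *\<^sub>R (D *\<^sub>R qH p q U (Zb * p ^ n)))"
    by (subst q_RL_eq[where f = "q_wavelet_transform q (q_Weyl q \<alpha> g) f (q powi A)", OF bq bound]) (simp only: \<Phi>)
  also have "\<dots> = RL_const *\<^sub>R (D *\<^sub>R V)"
    unfolding scaleR_left_commute[of _ D] infsum_scaleR_right V_def
    using P.RL_qH[of q r U Zb] wU Zb by simp
  finally show ?thesis unfolding L D_def by (simp add: mult_ac)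
qed

text \<open>By \<open>F_q_Weyl\<close> both wavelet transforms have the same density \<open>U\<close>, and \<open>Weyl_qH\<close> exchanges the kernels.
  The shift by \<open>\<kappa>\<close> is the factor \<open>1 - q\<close> in the argument of the kernel.\<close>

theorem q_wavelet_transform_Weyl:
  assumes g: "g \<in> S_q_mom q \<alpha>" and f: "f \<in> S_q_mom q \<alpha>" and Wf: "q_Weyl q \<alpha> f \<in> S_q_mom q (- 1 / 2)"
    and b: "b \<in> Rq_pos0 q"
  shows "q_wavelet_transform q (q_Weyl q \<alpha> g) (q_Weyl q \<alpha> f) (q powi A) b
    = q_Weyl q \<alpha> (bessel_wavelet_transform q \<alpha> g f (q powi A)) b"
proof -
  have a1: "- 1 < \<alpha>" using alpha by simp
  define U where "U L = cnj (F_q q \<alpha> g (q powi (A + L))) * F_q q \<alpha> f (q powi L)" for L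
  have wU: "wsummable q U" unfolding U_def
    by (intro product_wsummable g S_q_mom_schwartz[OF f] a1)
  have wf: "wsummable (wt \<alpha>) (\<lambda>N. f (q powi N))"
    unfolding wt_alpha by (rule P.schwartz_seq_wsummable[OF S_q_mom_schwartz[OF f] wt_alpha_bounds])
  have wFg: "wsummable (wt \<alpha>) (\<lambda>L. F_q q \<alpha> g (q powi L))"
    unfolding wt_alpha by (intro P.schwartz_seq_wsummable F_q_schwartz S_q_mom_schwartz[OF g] a1 wt_alpha_bounds)
  define D where "D = hankel_const (- 1 / 2) * sqrt (q powi A)"
  have L: "q_wavelet_transform q (q_Weyl q \<alpha> g) (q_Weyl q \<alpha> f) (q powi A) b = D *\<^sub>R qH p q U ((1 - q)\<^sup>2 * b\<^sup>2)"
    unfolding q_wavelet_transform_qH[OF g Wf b] F_q_Weyl[OF wf[unfolded wt_alpha]] D_def U_def ..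
  define K where "K = hankel_const \<alpha> * sqrt (q powi A) * q powr (- 4 * \<alpha> - 2)"
  define G where "G N = qH p (q * r) U (p powi N)" for N
  have \<Psi>: "bessel_wavelet_transform q \<alpha> g f (q powi A) (q powi N) = K *\<^sub>R G (N + \<kappa>)" for N
    unfolding bessel_wavelet_transform_qH[OF a1 wf wFg Q.powi_Rq_pos0] spectral_point K_def G_def U_def wt_alpha ..
  have rk: "r powi N *\<^sub>R X = r powi (- \<kappa>) *\<^sub>R (r powi (N + \<kappa>) *\<^sub>R X)" for N and X :: complex
    by (simp flip: power_int_add del: power_int_minus)
  have const: "Weyl_const * (K * (r powi (- \<kappa>) * r)) = D"
  proof -
    have "r powi (- \<kappa>) * r = r powi (1 - \<kappa>)" using power_int_add[of r "- \<kappa>" 1] by simp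
    then have "Weyl_const * (K * (r powi (- \<kappa>) * r))
      = Weyl_const * (Weyl_const * (q powr (- 4 * \<alpha> - 2) * (r powi (1 - \<kappa>) * (hankel_const (- 1 / 2) * sqrt (q powi A)))))"
      unfolding K_def hankel_const_alpha by (simp only: mult_ac)
    then show ?thesis by (simp only: const_cancel D_def)
  qed
  show ?thesis
  proof (cases "b = 0")
    case True
    have "(\<Sum>\<^sub>\<infinity>N. r powi N *\<^sub>R (K *\<^sub>R G (N + \<kappa>))) = K *\<^sub>R (r powi (- \<kappa>) *\<^sub>R (\<Sum>\<^sub>\<infinity>N. r powi (N + \<kappa>) *\<^sub>R G (N + \<kappa>)))"
      unfolding scaleR_left_commute[of _ K] infsum_scaleR_right by (subst rk) (simp only: infsum_scaleR_right)
    also have "(\<Sum>\<^sub>\<infinity>N. r powi (N + \<kappa>) *\<^sub>R G (N + \<kappa>)) = (\<Sum>\<^sub>\<infinity>N. r powi N *\<^sub>R G N)"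
      by (rule infsum_int_shift)
    also have "\<dots> = (r * qpoch_inf p p / qpoch_inf r p) *\<^sub>R qH p q U 0"
      unfolding G_def using wU by (intro P.Weyl_qH_at_0) simp_all
    finally have "q_Weyl q \<alpha> (bessel_wavelet_transform q \<alpha> g f (q powi A)) 0
        = (Weyl_const * (qpoch_inf r p / qpoch_inf p p)) *\<^sub>R (K *\<^sub>R (r powi (- \<kappa>) *\<^sub>R ((r * qpoch_inf p p / qpoch_inf r p) *\<^sub>R qH p q U 0)))"
      unfolding q_Weyl_0 \<Psi> by (simp only:)
    also have "\<dots> = (Weyl_const * (K * (r powi (- \<kappa>) * r))) *\<^sub>R qH p q U 0"
      using qpoch_inf_q_pos by (simp add: divide_simps)
    finally show ?thesis using L by (simp add: const True)
  next
    case False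
    then obtain B where B: "b = q powi B" using b by (auto simp: Rq_pos0_def Rq_pos_def)
    have "Weyl_seq p r (\<lambda>N. K *\<^sub>R G (N + \<kappa>)) B = K *\<^sub>R (r powi (- \<kappa>) *\<^sub>R Weyl_seq p r G (B + \<kappa>))"
    proof -
      have "(qbinom_coeff p r n * r powi (B - int n)) *\<^sub>R (K *\<^sub>R G (B - int n + \<kappa>))
        = K *\<^sub>R (r powi (- \<kappa>) *\<^sub>R ((qbinom_coeff p r n * r powi (B + \<kappa> - int n)) *\<^sub>R G (B + \<kappa> - int n)))" for n
      proof -
        have e: "B - int n + \<kappa> = B + \<kappa> - int n" by simp
        have "r powi (B - int n) = r powi (- \<kappa>) * r powi (B + \<kappa> - int n)"
          by (simp flip: power_int_add del: power_int_minus)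
        then show ?thesis unfolding e by (simp only: scaleR_scaleR mult_ac)
      qed
      then show ?thesis unfolding Weyl_seq_def by (simp only: infsum_scaleR_right)
    qed
    also have "Weyl_seq p r G (B + \<kappa>) = r *\<^sub>R qH p q U (p powi (B + \<kappa>))"
      unfolding G_def using wU by (intro P.Weyl_qH) simp_all
    finally have "q_Weyl q \<alpha> (bessel_wavelet_transform q \<alpha> g f (q powi A)) (q powi B)
        = (Weyl_const * (K * (r powi (- \<kappa>) * r))) *\<^sub>R qH p q U (p powi (B + \<kappa>))"
      unfolding q_Weyl_lattice \<Psi> by (simp only: scaleR_scaleR)
    then show ?thesis using L by (simp add: const B spectral_point)
  qed
qed

end

lemma powi_of_ln_quotient:
  fixes q :: real
  assumes "0 < q" "q < 1" "ln (1 - q) / ln q \<in> \<int>"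
  obtains \<kappa> :: int where "1 - q = q powi \<kappa>"
proof -
  obtain k where k: "ln (1 - q) / ln q = of_int k" using assms(3) by (elim Ints_cases)
  have "ln q < 0" using assms by simp
  with k have "ln (1 - q) = of_int k * ln q" by (simp add: divide_eq_eq)
  moreover have "1 - q = exp (ln (1 - q))" using assms by simp
  ultimately have "1 - q = q powr of_int k" using assms by (simp add: powr_def)
  then show ?thesis using that[of k] assms by (simp add: powr_real_of_int')
qed

theorem theorem13:
  fixes q \<alpha> :: real and g :: "real \<Rightarrow> complex"
  assumes "0 < q" and "q < 1" and "ln (1 - q) / ln q \<in> \<int>" and "\<alpha> > - 1 / 2"
    and "bessel_q_wavelet q \<alpha> g" and "g \<in> S_q_mom q \<alpha>"
  shows "(\<forall>f \<in> S_q_mom q \<alpha>. \<forall>a \<in> Rq_pos q. \<forall>b \<in> Rq_pos0 q.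
            bessel_wavelet_transform q \<alpha> g f a b
              = q_RL q \<alpha> (q_wavelet_transform q (q_Weyl q \<alpha> g) (q_RL_inv q \<alpha> f) a) b) \<and>
         (\<forall>f \<in> S_q_mom q (- 1 / 2). \<forall>a \<in> Rq_pos q. \<forall>b \<in> Rq_pos0 q.
            q_wavelet_transform q (q_Weyl q \<alpha> g) f a b
              = q_Weyl q \<alpha> (bessel_wavelet_transform q \<alpha> g (q_Weyl_inv q \<alpha> f) a) b)"
proof -
  obtain \<kappa> where "1 - q = q powi \<kappa>" using powi_of_ln_quotient[OF assms(1-3)] .
  then interpret q_bessel q \<alpha> \<kappa> using assms by unfold_locales auto
  show ?thesis
  proof (intro conjI ballI)
    fix f a b assume f: "f \<in> S_q_mom q \<alpha>" and a: "a \<in> Rq_pos q" and b: "b \<in> Rq_pos0 q"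
    obtain A where A: "a = q powi A" using a by (auto simp: Rq_pos_def)
    have "q_RL q \<alpha> (q_RL_inv q \<alpha> f) = f" "q_RL_inv q \<alpha> f \<in> S_q_mom q (- 1 / 2)"
      unfolding q_RL_inv_def
      by (rule f_inv_into_f[OF q_RL_surjective[OF f]], rule inv_into_into[OF q_RL_surjective[OF f]])
    then show "bessel_wavelet_transform q \<alpha> g f a b
        = q_RL q \<alpha> (q_wavelet_transform q (q_Weyl q \<alpha> g) (q_RL_inv q \<alpha> f) a) b"
      using bessel_wavelet_transform_RL[OF assms(6), of "q_RL_inv q \<alpha> f" b A] f b A by simp
  next
    fix f a b assume f: "f \<in> S_q_mom q (- 1 / 2)" and a: "a \<in> Rq_pos q" and b: "b \<in> Rq_pos0 q"
    obtain A where A: "a = q powi A" using a by (auto simp: Rq_pos_def)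
    have "q_Weyl q \<alpha> (q_Weyl_inv q \<alpha> f) = f" "q_Weyl_inv q \<alpha> f \<in> S_q_mom q \<alpha>"
      unfolding q_Weyl_inv_def
      by (rule f_inv_into_f[OF q_Weyl_surjective[OF f]], rule inv_into_into[OF q_Weyl_surjective[OF f]])
    then show "q_wavelet_transform q (q_Weyl q \<alpha> g) f a b
        = q_Weyl q \<alpha> (bessel_wavelet_transform q \<alpha> g (q_Weyl_inv q \<alpha> f) a) b"
      using q_wavelet_transform_Weyl[OF assms(6), of "q_Weyl_inv q \<alpha> f" b A] f b A by simp
  qed
qed

end
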